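(* Let $S$ be a density operator on $L^2(\mathbb{R}^d)$ and let $\Omega\subset\mathbb{R}^{2d}$ be a compact domain. Then $$\|\rho^S_{R\Omega}(R\,\cdot\,)-\chi_\Omega\|_{L^1(\mathbb{R}^{2d})}\to 0\quad\text{as } R\to\infty .$$
   Context: Fix $d\ge 1$. For $z=(x,\omega)\in\mathbb{R}^{2d}$ let $\pi(z)\psi(t)=e^{2\pi i\omega\cdot t}\psi(t-x)$ on $L^2(\mathbb{R}^d)$. For a bounded operator $A$ on $L^2(\mathbb{R}^d)$ let $\alpha_z(A)=\pi(z)A\pi(z)^*$ and $\check A=PAP$, where $P\psi(x)=\psi(-x)$. For $f\in L^1(\mathbb{R}^{2d})$ and a trace class operator $S$, $f\star S=\int_{\mathbb{R}^{2d}}f(z)\alpha_z(S)\,dz$ (weakly defined; a trace class operator). For trace class operators $S,T$, $S\star T$ is the function $S\star T(z)=\mathrm{tr}(S\,\alpha_z(\check T))$ on $\mathbb{R}^{2d}$. The rank-one operator $\psi\otimes\varphi$ is $\xi\mapsto\langle\xi,\varphi\rangle\psi$. A density operator is a positive trace class operator $S$ with $\mathrm{tr}(S)=1$. For such $S$ and $\psi\in L^2(\mathbb{R}^d)$ put $Q_S(\psi)=\check S\star(\psi\otimes\psi)$ (a function on $\mathbb{R}^{2d}$). A compact domain is a compact subset $\Omega\subset\mathbb{R}^{2d}$; $|\Omega|$ is its Lebesgue measure, $\chi_\Omega$ its characteristic function, and $R\Omega=\{Rz:z\in\Omega\}$. The operator $\chi_\Omega\star S$ is positive and trace class; $\lambda_1^\Omega\ge\lambda_2^\Omega\ge\cdots$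 are its eigenvalues (counted with multiplicity, in decreasing order) and $\{h_k^\Omega\}_{k\in\mathbb{N}}$ is an orthonormal system of corresponding eigenfunctions, so that $\chi_\Omega\star S=\sum_{k\ge1}\lambda_k^\Omega h_k^\Omega\otimes h_k^\Omega$ (any fixed choice). With $A_\Omega=\lceil|\Omega|\rceil$, the accumulated Cohen class distribution is $\rho_\Omega^S(z)=\sum_{k=1}^{A_\Omega}Q_S(h_k^\Omega)(z)$, $z\in\mathbb{R}^{2d}$. *)

theory Defs
  imports "HOL-Analysis.Analysis"
begin

section \<open>The complex Hilbert space of square integrable functions\<close>

definition square_integrable :: "('a::euclidean_space \<Rightarrow> complex) \<Rightarrow> bool" where
  "square_integrable f \<longleftrightarrow>
     f \<in> borel_measurable lborel \<and> integrable lborel (\<lambda>t. (cmod (f t))\<^sup>2)"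

definition l2rel :: "('a::euclidean_space \<Rightarrow> complex) \<Rightarrow> ('a \<Rightarrow> complex) \<Rightarrow> bool" where
  "l2rel f g \<longleftrightarrow> square_integrable f \<and> square_integrable g \<and> (AE t in lborel. f t = g t)"

lemma square_integrable_zero: "square_integrable (\<lambda>_. 0)"
  by (simp add: square_integrable_def)

lemma part_equivp_l2rel: "part_equivp (l2rel :: ('a::euclidean_space \<Rightarrow> complex) \<Rightarrow> _)"
proof (rule part_equivpI)
  show "\<exists>f :: 'a \<Rightarrow> complex. l2rel f f"
    by (rule exI[of _ "\<lambda>_. 0"]) (simp add: l2rel_def square_integrable_zero)
  show "symp (l2rel :: ('a \<Rightarrow> complex) \<Rightarrow> _)"
    by (rule sympI) (auto simp: l2rel_def)
  show "transp (l2rel :: ('a \<Rightarrow> complex) \<Rightarrow> _)"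
  proof (rule transpI)
    fix f g h :: "'a \<Rightarrow> complex"
    assume fg: "l2rel f g" and gh: "l2rel g h"
    have "AE t in lborel. f t = g t" "AE t in lborel. g t = h t"
      using fg gh
      by (auto simp: l2rel_def)
    then have "AE t in lborel. f t = h t"
      by eventually_elim simp
    with fg gh show "l2rel f h"
      by (simp add: l2rel_def)
  qed
qed

quotient_type (overloaded) 'a L2 = "'a::euclidean_space \<Rightarrow> complex" / partial: l2rel
  by (rule part_equivp_l2rel)

lemma square_integrable_add:
  assumes f: "square_integrable f" and g: "square_integrable g"
  shows "square_integrable (\<lambda>t. f t + g t)"
proof -
  have [measurable]: "f \<in> borel_measurable lborel" "g \<in> borel_measurable lborel"
    using f g by (auto simp: square_integrable_def)
  have "integrable lborel (\<lambda>t. (cmod (f t + g t))\<^sup>2)"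
  proof (rule Bochner_Integration.integrable_bound)
    show "integrable lborel (\<lambda>t. 2 * (cmod (f t))\<^sup>2 + 2 * (cmod (g t))\<^sup>2)"
      using f g by (simp add: square_integrable_def)
    show "AE t in lborel. norm ((cmod (f t + g t))\<^sup>2)
            \<le> norm (2 * (cmod (f t))\<^sup>2 + 2 * (cmod (g t))\<^sup>2)"
    proof (rule AE_I2)
      fix t
      have "(cmod (f t + g t))\<^sup>2 \<le> (cmod (f t) + cmod (g t))\<^sup>2"
        by (intro power_mono norm_triangle_ineq) simp
      also have "\<dots> \<le> 2 * (cmod (f t))\<^sup>2 + 2 * (cmod (g t))\<^sup>2"
        using sum_squares_bound[of "cmod (f t)" "cmod (g t)"] by (simp add: power2_sum)
      finally show "norm ((cmod (f t + g t))\<^sup>2)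
            \<le> norm (2 * (cmod (f t))\<^sup>2 + 2 * (cmod (g t))\<^sup>2)" by simp
    qed
  qed simp
  then show ?thesis by (simp add: square_integrable_def)
qed

lemma square_integrable_mult:
  assumes f: "square_integrable f"
  shows "square_integrable (\<lambda>t. c * f t)"
  using f by (auto simp: square_integrable_def norm_mult power_mult_distrib)

lemma square_integrable_cong_norm:
  assumes f: "square_integrable f" and g: "g \<in> borel_measurable lborel"
    and eq: "\<And>t. cmod (g t) = cmod (f t)"
  shows "square_integrable g"
  using f g by (simp add: square_integrable_def eq)

lemma borel_measurable_cnj [measurable (raw)]:
  "f \<in> borel_measurable M \<Longrightarrow> (\<lambda>x. cnj (f x)) \<in> borel_measurable M"
  by (rule borel_measurable_continuous_on[of cnj]) (intro continuous_intros)

lemma square_integrable_prod: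
  assumes f: "square_integrable f" and g: "square_integrable g"
  shows "integrable lborel (\<lambda>t. f t * cnj (g t))"
proof (rule Bochner_Integration.integrable_bound)
  have [measurable]: "f \<in> borel_measurable lborel" "g \<in> borel_measurable lborel"
    using f g by (auto simp: square_integrable_def)
  show "integrable lborel (\<lambda>t. (cmod (f t))\<^sup>2 + (cmod (g t))\<^sup>2)"
    using f g by (simp add: square_integrable_def)
  show "(\<lambda>t. f t * cnj (g t)) \<in> borel_measurable lborel"
    by measurable
  show "AE t in lborel. norm (f t * cnj (g t)) \<le> norm ((cmod (f t))\<^sup>2 + (cmod (g t))\<^sup>2)"
  proof (rule AE_I2)
    fix t
    have "2 * cmod (f t) * cmod (g t) \<le> (cmod (f t))\<^sup>2 + (cmod (g t))\<^sup>2"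
      by (rule sum_squares_bound)
    moreover have "0 \<le> cmod (f t) * cmod (g t)" by simp
    ultimately have "cmod (f t) * cmod (g t) \<le> (cmod (f t))\<^sup>2 + (cmod (g t))\<^sup>2"
      by linarith
    then show "norm (f t * cnj (g t)) \<le> norm ((cmod (f t))\<^sup>2 + (cmod (g t))\<^sup>2)"
      by (simp add: norm_mult)
  qed
qed

lemma lborel_distr_affine:
  fixes a :: "'a::euclidean_space"
  assumes "\<bar>c\<bar> = 1"
  shows "distr lborel borel (\<lambda>t. a + c *\<^sub>R t) = lborel"
proof -
  have "c \<noteq> 0" using assms by auto
  from lborel_affine[OF this, of a] show ?thesis
    using assms by (simp add: density_1 one_ennreal_def[symmetric])
qed

lemma l2rel_affine:
  fixes a :: "'a::euclidean_space"
  assumes c: "\<bar>c\<bar> = 1" and fg: "l2rel f g"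
  shows "l2rel (\<lambda>t. f (a + c *\<^sub>R t)) (\<lambda>t. g (a + c *\<^sub>R t))"
proof -
  let ?T = "\<lambda>t::'a. a + c *\<^sub>R t"
  have [measurable]: "f \<in> borel_measurable borel" "g \<in> borel_measurable borel"
    using fg by (auto simp: l2rel_def square_integrable_def)
  have T[measurable]: "?T \<in> borel_measurable borel" by simp
  have sq: "square_integrable (\<lambda>t. u (?T t))" if u: "square_integrable u" for u :: "'a \<Rightarrow> complex"
  proof -
    have [measurable]: "u \<in> borel_measurable borel"
      using u by (simp add: square_integrable_def)
    have "integrable (distr lborel borel ?T) (\<lambda>t. (cmod (u t))\<^sup>2)"
      using u by (simp add: lborel_distr_affine[OF c] square_integrable_def)
    then have "integrable lborel (\<lambda>t. (cmod (u (?T t)))\<^sup>2)"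
      by (subst (asm) integrable_distr_eq) auto
    then show ?thesis by (simp add: square_integrable_def)
  qed
  have "AE t in distr lborel borel ?T. f t = g t"
    using fg unfolding lborel_distr_affine[OF c] by (simp add: l2rel_def)
  then have "AE t in lborel. f (?T t) = g (?T t)"
    by (rule AE_distrD[rotated]) simp
  with fg sq show ?thesis by (auto simp: l2rel_def)
qed

lift_definition cinner :: "'a::euclidean_space L2 \<Rightarrow> 'a L2 \<Rightarrow> complex"
  is "\<lambda>f g. LINT t|lborel. f t * cnj (g t)"
proof -
  fix f f' g g' :: "'a \<Rightarrow> complex"
  assume rel: "l2rel f f'" "l2rel g g'"
  then have [measurable]: "f \<in> borel_measurable lborel" "f' \<in> borel_measurable lborel"
      "g \<in> borel_measurable lborel" "g' \<in> borel_measurable lborel"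
    by (auto simp: l2rel_def square_integrable_def)
  show "(LINT t|lborel. f t * cnj (g t)) = (LINT t|lborel. f' t * cnj (g' t))"
  proof (rule integral_cong_AE)
    have "AE t in lborel. f t = f' t" "AE t in lborel. g t = g' t"
      using rel by (auto simp: l2rel_def)
    then show "AE t in lborel. f t * cnj (g t) = f' t * cnj (g' t)"
      by eventually_elim simp
  qed measurable
qed

lift_definition scaleC :: "complex \<Rightarrow> 'a::euclidean_space L2 \<Rightarrow> 'a L2" (infixr \<open>*\<^sub>C\<close> 75)
  is "\<lambda>c f t. c * f t"
  by (auto simp: l2rel_def intro: square_integrable_mult)

lemma cinner_scaleC_left: "cinner (c *\<^sub>C f) g = c * cinner f g"
  by transfer (simp add: mult.assoc)

lemma cinner_commute: "cinner f g = cnj (cinner g f)"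
  by transfer (simp add: mult.commute flip: Bochner_Integration.integral_cnj)

instantiation L2 :: (euclidean_space) real_inner
begin

lift_definition zero_L2 :: "'a L2" is "\<lambda>_. 0"
  by (simp add: l2rel_def square_integrable_zero)

lift_definition plus_L2 :: "'a L2 \<Rightarrow> 'a L2 \<Rightarrow> 'a L2" is "\<lambda>f g t. f t + g t"
  by (auto simp: l2rel_def intro: square_integrable_add)

lift_definition uminus_L2 :: "'a L2 \<Rightarrow> 'a L2" is "\<lambda>f t. - f t"
  by (auto simp: l2rel_def square_integrable_def)

definition minus_L2 :: "'a L2 \<Rightarrow> 'a L2 \<Rightarrow> 'a L2" where
  "minus_L2 f g = f + (- g)"

definition scaleR_L2 :: "real \<Rightarrow> 'a L2 \<Rightarrow> 'a L2" where
  "scaleR_L2 r f = of_real r *\<^sub>C f"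

definition inner_L2 :: "'a L2 \<Rightarrow> 'a L2 \<Rightarrow> real" where
  "inner_L2 f g = Re (cinner f g)"

definition norm_L2 :: "'a L2 \<Rightarrow> real" where
  "norm_L2 f = sqrt (inner f f)"

definition dist_L2 :: "'a L2 \<Rightarrow> 'a L2 \<Rightarrow> real" where
  "dist_L2 f g = norm (f - g)"

definition sgn_L2 :: "'a L2 \<Rightarrow> 'a L2" where
  "sgn_L2 f = scaleR (inverse (norm f)) f"

definition uniformity_L2 :: "('a L2 \<times> 'a L2) filter" where
  "uniformity_L2 = (INF e\<in>{0 <..}. principal {(x, y). dist x y < e})"

definition open_L2 :: "'a L2 set \<Rightarrow> bool" where
  "open_L2 U \<longleftrightarrow> (\<forall>x\<in>U. eventually (\<lambda>(x', y). x' = x \<longrightarrow> y \<in> U) uniformity)"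

instance
proof
  fix f g h :: "'a L2" and r s :: real
  show "f + g + h = f + (g + h)"
    by transfer (auto simp: l2rel_def add.assoc intro: square_integrable_add)
  show "f + g = g + f"
    by transfer (auto simp: l2rel_def add.commute intro: square_integrable_add)
  show "0 + f = f"
    by transfer (simp add: l2rel_def)
  show "- f + f = 0"
    by transfer (simp add: l2rel_def square_integrable_zero)
  show "f - g = f + - g"
    by (simp add: minus_L2_def)
  show "r *\<^sub>R (f + g) = r *\<^sub>R f + r *\<^sub>R g"
    unfolding scaleR_L2_def
    by transfer
      (auto simp: l2rel_def distrib_left intro!: square_integrable_add square_integrable_mult)
  show "(r + s) *\<^sub>R f = r *\<^sub>R f + s *\<^sub>R f"
    unfolding scaleR_L2_def
    by transfer
      (auto simp: l2rel_def distrib_right intro!: square_integrable_add square_integrable_mult)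
  show "r *\<^sub>R s *\<^sub>R f = (r * s) *\<^sub>R f"
    unfolding scaleR_L2_def
    by transfer (auto simp: l2rel_def mult.assoc intro!: square_integrable_mult)
  show "1 *\<^sub>R f = f"
    unfolding scaleR_L2_def
    by transfer (simp add: l2rel_def)
  show "sgn f = scaleR (inverse (norm f)) f"
    by (rule sgn_L2_def)
  show "dist f g = norm (f - g)"
    by (rule dist_L2_def)
  show "(uniformity :: ('a L2 \<times> 'a L2) filter)
          = (INF e\<in>{0 <..}. principal {(x, y). dist x y < e})"
    by (rule uniformity_L2_def)
  show "open U \<longleftrightarrow> (\<forall>x\<in>U. eventually (\<lambda>(x', y). x' = x \<longrightarrow> y \<in> U) uniformity)"
    for U :: "'a L2 set"
    by (rule open_L2_def)
  show "norm f = sqrt (inner f f)"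
    by (rule norm_L2_def)
  have comm: "cinner f g = cnj (cinner g f)"
    by (rule cinner_commute)
  then show "inner f g = inner g f"
    by (simp add: inner_L2_def)
  have "cinner (f + g) h = cinner f h + cinner g h"
    by transfer
      (simp add: l2rel_def distrib_right square_integrable_prod Bochner_Integration.integral_add)
  then show "inner (f + g) h = inner f h + inner g h"
    by (simp add: inner_L2_def)
  show "inner (r *\<^sub>R f) g = r * inner f g"
    by (simp add: inner_L2_def scaleR_L2_def cinner_scaleC_left)
  have sq: "inner f f = (LINT t|lborel. (cmod (u t))\<^sup>2)" "square_integrable u"
    if "rep_L2 f = u" for u
  proof -
    have "l2rel u u"
      using Quotient_rep_reflp[OF Quotient_L2] that by blast
    then show u: "square_integrable u" by (simp add: l2rel_def)
    have "cinner f f = (LINT t|lborel. u t * cnj (u t))"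
      using that by (simp add: cinner.rep_eq)
    also have "\<dots> = (LINT t|lborel. complex_of_real ((cmod (u t))\<^sup>2))"
      by (intro Bochner_Integration.integral_cong refl) (metis complex_norm_square of_real_power)
    also have "\<dots> = complex_of_real (LINT t|lborel. (cmod (u t))\<^sup>2)"
      by (rule integral_complex_of_real)
    finally show "inner f f = (LINT t|lborel. (cmod (u t))\<^sup>2)"
      by (simp add: inner_L2_def)
  qed
  show "0 \<le> inner f f"
    by (subst sq(1)[OF refl]) simp
  show "inner f f = 0 \<longleftrightarrow> f = 0"
  proof
    assume "inner f f = 0"
    then have "(LINT t|lborel. (cmod (rep_L2 f t))\<^sup>2) = 0"
      using sq(1)[OF refl] by simp
    then have "AE t in lborel. (cmod (rep_L2 f t))\<^sup>2 = 0"
      using sq(2)[OF refl]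
      by (subst (asm) integral_nonneg_eq_0_iff_AE) (auto simp: square_integrable_def)
    then have "l2rel (rep_L2 f) (\<lambda>_. 0)"
      using sq(2)[OF refl] by (simp add: l2rel_def square_integrable_zero)
    then have "abs_L2 (rep_L2 f) = abs_L2 (\<lambda>_. 0)"
      using Quotient_rel[OF Quotient_L2] by blast
    then show "f = 0"
      by (simp add: Quotient_abs_rep[OF Quotient_L2] zero_L2_def)
  next
    assume "f = 0"
    moreover have "cinner (0 :: 'a L2) 0 = 0" by transfer simp
    ultimately show "inner f f = 0" by (simp add: inner_L2_def)
  qed
qed

end

section \<open>Operators and traces\<close>

text \<open>\<open>bounded_linear\<close> only asks for real linearity.\<close>

definition bounded_op :: "('a::euclidean_space L2 \<Rightarrow> 'a L2) \<Rightarrow> bool" where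
  "bounded_op A \<longleftrightarrow> bounded_linear A \<and> (\<forall>c f. A (c *\<^sub>C f) = c *\<^sub>C A f)"

definition adj :: "('a::euclidean_space L2 \<Rightarrow> 'a L2) \<Rightarrow> 'a L2 \<Rightarrow> 'a L2" where
  "adj A = (THE B. \<forall>f g. cinner (A f) g = cinner f (B g))"

definition positive_op :: "('a::euclidean_space L2 \<Rightarrow> 'a L2) \<Rightarrow> bool" where
  "positive_op A \<longleftrightarrow> bounded_op A \<and> (\<forall>f. cinner (A f) f \<in> \<real>\<^sub>\<ge>\<^sub>0)"

definition orthonormal :: "'a::euclidean_space L2 set \<Rightarrow> bool" where
  "orthonormal E \<longleftrightarrow> (\<forall>e\<in>E. \<forall>e'\<in>E. cinner e e' = (if e = e' then 1 else 0))"

definition onb :: "'a::euclidean_space L2 set \<Rightarrow> bool" where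
  "onb E \<longleftrightarrow> orthonormal E \<and> (\<forall>f. (\<forall>e\<in>E. cinner f e = 0) \<longrightarrow> f = 0)"

text \<open>The operator \<open>B\<close> below is the absolute value of \<open>T\<close>, the positive square root of
  \<open>T\<^sup>*T\<close>; the condition on \<open>B\<close> does not depend on the orthonormal basis.\<close>

definition trace_class :: "('a::euclidean_space L2 \<Rightarrow> 'a L2) \<Rightarrow> bool" where
  "trace_class T \<longleftrightarrow> bounded_op T \<and>
     (\<exists>B. positive_op B \<and> B \<circ> B = adj T \<circ> T \<and>
       (\<exists>E. onb E \<and> (\<lambda>e. cinner (B e) e) summable_on E))"

text \<open>For a trace class operator the value does not depend on the orthonormal basis chosen
  (lemma \<open>onb_exists\<close> below shows that there is one).\<close>

definition op_trace :: "('a::euclidean_space L2 \<Rightarrow> 'a L2) \<Rightarrow> complex" where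
  "op_trace T = (\<Sum>\<^sub>\<infinity>e\<in>(SOME E. onb E). cinner (T e) e)"

definition density_op :: "('a::euclidean_space L2 \<Rightarrow> 'a L2) \<Rightarrow> bool" where
  "density_op S \<longleftrightarrow> positive_op S \<and> trace_class S \<and> op_trace S = 1"

definition rank_one :: "'a::euclidean_space L2 \<Rightarrow> 'a L2 \<Rightarrow> 'a L2 \<Rightarrow> 'a L2" where
  "rank_one \<psi> \<phi> = (\<lambda>\<xi>. cinner \<xi> \<phi> *\<^sub>C \<psi>)"

lemma onb_exists: "\<exists>E :: 'a::euclidean_space L2 set. onb E"
proof -
  let ?A = "{E :: 'a L2 set. orthonormal E}"
  have "\<exists>M\<in>?A. \<forall>X\<in>?A. M \<subseteq> X \<longrightarrow> X = M"
  proof (rule subset_Zorn_nonempty)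
    have "{} \<in> ?A" by (simp add: orthonormal_def)
    then show "?A \<noteq> {}" by blast
  next
    fix C assume C: "C \<noteq> {}" "subset.chain ?A C"
    have "\<exists>X\<in>C. e \<in> X \<and> e' \<in> X" if "e \<in> \<Union>C" "e' \<in> \<Union>C" for e e'
      using that C(2) unfolding subset_chain_def by blast
    moreover have "orthonormal X" if "X \<in> C" for X
      using that C(2) unfolding subset_chain_def by blast
    ultimately show "\<Union>C \<in> ?A"
      unfolding orthonormal_def mem_Collect_eq by (metis (no_types, lifting))
  qed
  then obtain M :: "'a L2 set" where M: "orthonormal M"
    and max: "\<And>X. orthonormal X \<Longrightarrow> M \<subseteq> X \<Longrightarrow> X = M"
    by blast
  have "f = 0" if f: "\<forall>e\<in>M. cinner f e = 0" for f
  proof (rule ccontr)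
    assume "f \<noteq> 0"
    define u where "u = of_real (1 / norm f) *\<^sub>C f"
    have nf: "cinner f f = of_real ((norm f)\<^sup>2)"
    proof (rule complex_eqI)
      have "Im (cinner f f) = - Im (cinner f f)"
        by (metis cinner_commute cnj.simps(2))
      then show "Im (cinner f f) = Im (of_real ((norm f)\<^sup>2))" by simp
      show "Re (cinner f f) = Re (of_real ((norm f)\<^sup>2))"
        by (simp add: power2_norm_eq_inner inner_L2_def)
    qed
    have uu: "cinner u u = 1"
      using \<open>f \<noteq> 0\<close> unfolding u_def
      by (subst cinner_scaleC_left, subst cinner_commute, subst cinner_scaleC_left)
         (simp add: nf power2_eq_square)
    have ue: "cinner u e = 0" if "e \<in> M" for e
      using f that by (simp add: u_def cinner_scaleC_left)
    have eu: "cinner e u = 0" if "e \<in> M" for e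
      using ue[OF that] cinner_commute[of e u] by simp
    have "u \<notin> M" using ue uu by force
    moreover have "orthonormal (insert u M)"
      using M uu ue eu \<open>u \<notin> M\<close> unfolding orthonormal_def by auto
    ultimately show False using max[of "insert u M"] by blast
  qed
  with M show ?thesis unfolding onb_def by blast
qed

section \<open>Quantum harmonic analysis\<close>

lift_definition tf_shift :: "'a::euclidean_space \<times> 'a \<Rightarrow> 'a L2 \<Rightarrow> 'a L2"
  is "\<lambda>(x, \<omega>) \<psi> t. exp (2 * of_real pi * \<i> * of_real (\<omega> \<bullet> t)) * \<psi> (t - x)"
proof -
  fix z :: "'a \<times> 'a" and f g :: "'a \<Rightarrow> complex"
  assume fg: "l2rel f g"
  obtain x \<omega> where z: "z = (x, \<omega>)" by fastforce
  let ?m = "\<lambda>t. exp (2 * complex_of_real pi * \<i> * of_real (\<omega> \<bullet> t))"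
  have shift: "l2rel (\<lambda>t. f (t - x)) (\<lambda>t. g (t - x))"
    using l2rel_affine[of 1 f g "- x"] fg by simp
  have m1: "cmod (?m t) = 1" for t
    by (simp add: norm_exp_eq_Re)
  have sq: "square_integrable (\<lambda>t. ?m t * u t)" if u: "square_integrable u" for u
  proof (rule square_integrable_cong_norm[OF u])
    have [measurable]: "u \<in> borel_measurable lborel"
      using u by (simp add: square_integrable_def)
    have "continuous_on UNIV ?m" by (intro continuous_intros)
    then have [measurable]: "?m \<in> borel_measurable borel"
      by (rule borel_measurable_continuous_onI)
    show "(\<lambda>t. ?m t * u t) \<in> borel_measurable lborel" by simp
  qed (simp add: norm_mult m1)
  have "l2rel (\<lambda>t. ?m t * f (t - x)) (\<lambda>t. ?m t * g (t - x))"
    using shift sq unfolding l2rel_def by auto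
  then show "l2rel ((case z of (x, \<omega>) \<Rightarrow>
        \<lambda>\<psi> t. exp (2 * of_real pi * \<i> * of_real (\<omega> \<bullet> t)) * \<psi> (t - x)) f)
      ((case z of (x, \<omega>) \<Rightarrow>
        \<lambda>\<psi> t. exp (2 * of_real pi * \<i> * of_real (\<omega> \<bullet> t)) * \<psi> (t - x)) g)"
    by (simp add: z)
qed

lift_definition parity :: "'a::euclidean_space L2 \<Rightarrow> 'a L2" is "\<lambda>\<psi> t. \<psi> (- t)"
  using l2rel_affine[of "-1" _ _ 0] by simp

definition op_shift ::
  "'a::euclidean_space \<times> 'a \<Rightarrow> ('a L2 \<Rightarrow> 'a L2) \<Rightarrow> 'a L2 \<Rightarrow> 'a L2" where
  "op_shift z A = tf_shift z \<circ> A \<circ> adj (tf_shift z)"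

definition op_check :: "('a::euclidean_space L2 \<Rightarrow> 'a L2) \<Rightarrow> 'a L2 \<Rightarrow> 'a L2" where
  "op_check A = parity \<circ> A \<circ> parity"

text \<open>The operator-valued integral is defined weakly, by its matrix elements.\<close>

definition fun_op_conv ::
  "('a::euclidean_space \<times> 'a \<Rightarrow> complex) \<Rightarrow> ('a L2 \<Rightarrow> 'a L2) \<Rightarrow> 'a L2 \<Rightarrow> 'a L2" where
  "fun_op_conv f S = (THE T. bounded_op T \<and>
     (\<forall>\<phi> \<psi>. cinner (T \<phi>) \<psi> = (LINT z|lborel. f z * cinner (op_shift z S \<phi>) \<psi>)))"

definition op_op_conv ::
  "('a::euclidean_space L2 \<Rightarrow> 'a L2) \<Rightarrow> ('a L2 \<Rightarrow> 'a L2) \<Rightarrow> 'a \<times> 'a \<Rightarrow> complex" where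
  "op_op_conv S T z = op_trace (S \<circ> op_shift z (op_check T))"

definition cohen ::
  "('a::euclidean_space L2 \<Rightarrow> 'a L2) \<Rightarrow> 'a L2 \<Rightarrow> 'a \<times> 'a \<Rightarrow> complex" where
  "cohen S \<psi> = op_op_conv (op_check S) (rank_one \<psi> \<psi>)"

text \<open>Sequences are indexed from 0, so \<open>\<lambda>\<^sub>k\<close> and \<open>h\<^sub>k\<close> with \<open>k \<ge> 1\<close> are
  \<open>lam (k - 1)\<close> and \<open>h (k - 1)\<close>. If \<open>T\<close> has finite rank, \<open>lam\<close> is eventually zero.\<close>

definition eigensystem ::
  "('a::euclidean_space L2 \<Rightarrow> 'a L2) \<Rightarrow> (nat \<Rightarrow> real) \<Rightarrow> (nat \<Rightarrow> 'a L2) \<Rightarrow> bool" where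
  "eigensystem T lam h \<longleftrightarrow>
     decseq lam \<and>
     (\<forall>j k. cinner (h j) (h k) = (if j = k then 1 else 0)) \<and>
     (\<forall>k. T (h k) = lam k *\<^sub>R h k) \<and>
     (\<forall>f. (\<lambda>k. lam k *\<^sub>R rank_one (h k) (h k) f) sums T f)"

definition accumulated_cohen ::
  "('a::euclidean_space L2 \<Rightarrow> 'a L2) \<Rightarrow> (('a \<times> 'a) set \<Rightarrow> nat \<Rightarrow> 'a L2) \<Rightarrow>
    ('a \<times> 'a) set \<Rightarrow> 'a \<times> 'a \<Rightarrow> complex" where
  "accumulated_cohen S h \<Omega> z = (\<Sum>k<nat \<lceil>measure lborel \<Omega>\<rceil>. cohen S (h \<Omega> k) z)"

end

theory Submission
  imports Defs "HOL-Probability.Characteristic_Functions"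
begin

text \<open>
  Write \<open>S = \<Sum>\<^sub>n v\<^sub>n \<otimes> v\<^sub>n\<close> with \<open>\<Sum>\<^sub>n \<parallel>v\<^sub>n\<parallel>\<^sup>2 = 1\<close>, so that
  \<open>Q\<^sub>S(\<psi>)(z) = \<Sum>\<^sub>n \<bar>\<langle>\<psi>, \<pi>(z) v\<^sub>n\<rangle>\<bar>\<^sup>2\<close>. Moyal's identity gives \<open>\<integral> Q\<^sub>S(h\<^sub>k) = 1\<close>, Bessel's inequality
  gives \<open>0 \<le> \<rho>\<^sub>\<Omega> \<le> 1\<close>, and \<open>\<lambda>\<^sub>k = \<integral>\<^sub>\<Omega> Q\<^sub>S(h\<^sub>k)\<close>. Hence, with \<open>A = \<lceil>\<bar>\<Omega>\<bar>\<rceil>\<close>,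
  \<open>\<parallel>\<rho>\<^sub>\<Omega> - \<chi>\<^sub>\<Omega>\<parallel>\<^sub>1 = \<bar>\<Omega>\<bar> + A - 2 \<Sum>\<^sub>k\<^sub>\<le>\<^sub>A \<lambda>\<^sub>k\<close>. Since the \<open>\<lambda>\<^sub>k\<close> decrease, lie in \<open>[0, 1]\<close> and sum to at
  most \<open>A\<close>, the partial sum \<open>\<Sum>\<^sub>k\<^sub>\<le>\<^sub>A \<lambda>\<^sub>k\<close> is at least \<open>\<Sum>\<^sub>k \<lambda>\<^sub>k\<^sup>2\<close>, the squared Hilbert--Schmidt norm of
  \<open>\<chi>\<^sub>\<Omega> \<star> S\<close>. This norm equals \<open>\<integral> G(w) \<bar>\<Omega> \<inter> (\<Omega> - w)\<bar> dw\<close> for a probability density \<open>G\<close> depending only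
  on \<open>S\<close>. For \<open>R\<Omega>\<close> it is \<open>R\<^sup>2\<^sup>d \<integral> G(w) \<bar>\<Omega> \<inter> (\<Omega> - w/R)\<bar> dw\<close>, which is asymptotic to \<open>R\<^sup>2\<^sup>d \<bar>\<Omega>\<bar>\<close> by
  continuity of translations in \<open>L\<^sup>1\<close>.
\<close>

section \<open>The Hilbert space \<open>L\<^sup>2\<close>\<close>

text \<open>The vectors v_n need not be eigenvectors of S. Only <Sf, f> = sum_n |<f, v_n>|^2 and
  sum_n |v_n|^2 = 1 enter, so an elimination along any orthonormal basis supplies them. The trace
  alone cannot finish the argument: it bounds the total mass of the eigenvalues but does not tell
  how much of it sits beyond index A. The Hilbert-Schmidt norm does, because sum lambda_k - sum
  lambda_k^2 is small only if the eigenvalues cluster near 0 and 1, and it can be computed from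
  Omega and S without knowing the eigenfunctions: one factor lambda_k comes from the mass of
  Q_S(h_k) on Omega, the other is absorbed by the expansion of the localization operator. Dilating
  Omega leaves G fixed, so on the scale of Omega the density G concentrates at the origin. Rounding
  |Omega| up costs at most 1, which becomes R^(-2d) once the integral is rescaled. The exchanges
  behind the Hilbert-Schmidt identity take place in \<open>ennreal\<close>; Moyal's identity has
  oscillating integrands and needs a regularization.\<close>

lemma cinner_add_left: "cinner (f + g) h = cinner f h + cinner g h"
  by transfer (simp add: l2rel_def distrib_right square_integrable_prod Bochner_Integration.integral_add)

lemma cinner_add_right: "cinner h (f + g) = cinner h f + cinner h g"
  by (metis cinner_add_left cinner_commute complex_cnj_add)

lemma cinner_scaleC_right: "cinner f (c *\<^sub>C g) = cnj c * cinner f g"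
  by (metis cinner_scaleC_left cinner_commute complex_cnj_mult)

lemma scaleR_scaleC: "r *\<^sub>R f = of_real r *\<^sub>C f" for f :: "'a::euclidean_space L2"
  by (simp add: scaleR_L2_def)

lemma cinner_scaleR_left: "cinner (r *\<^sub>R f) g = of_real r * cinner f g"
  by (simp add: scaleR_scaleC cinner_scaleC_left)

lemma cinner_scaleR_right: "cinner f (r *\<^sub>R g) = of_real r * cinner f g"
  by (simp add: scaleR_scaleC cinner_scaleC_right)

lemma cinner_zero_left [simp]: "cinner 0 f = 0"
  using cinner_add_left[of 0 0 f] by simp

lemma cinner_zero_right [simp]: "cinner f 0 = 0"
  using cinner_add_right[of f 0 0] by simp

lemma cinner_minus_left: "cinner (- f) g = - cinner f g"
  using cinner_scaleR_left[of "-1" f g] by simp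

lemma cinner_minus_right: "cinner f (- g) = - cinner f g"
  using cinner_scaleR_right[of f "-1" g] by simp

lemma cinner_diff_left: "cinner (f - g) h = cinner f h - cinner g h"
  by (simp only: diff_conv_add_uminus cinner_add_left cinner_minus_left)

lemma cinner_diff_right: "cinner h (f - g) = cinner h f - cinner h g"
  by (simp only: diff_conv_add_uminus cinner_add_right cinner_minus_right)

lemma cinner_sum_left: "cinner (\<Sum>i\<in>I. f i) g = (\<Sum>i\<in>I. cinner (f i) g)"
  by (induction I rule: infinite_finite_induct) (simp_all add: cinner_add_left)

lemma cinner_sum_right: "cinner g (\<Sum>i\<in>I. f i) = (\<Sum>i\<in>I. cinner g (f i))"
  by (induction I rule: infinite_finite_induct) (simp_all add: cinner_add_right)

lemma scaleC_add_right: "c *\<^sub>C (f + g) = c *\<^sub>C f + c *\<^sub>C g"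
  by transfer (auto simp: l2rel_def algebra_simps intro!: square_integrable_add square_integrable_mult)

lemma scaleC_scaleC [simp]: "a *\<^sub>C b *\<^sub>C f = (a * b) *\<^sub>C f"
  by transfer (auto simp: l2rel_def mult.assoc intro!: square_integrable_mult)

lemma scaleC_one [simp]: "1 *\<^sub>C f = f"
  using scaleR_one[of f] by (simp add: scaleR_scaleC)

lemma scaleC_zero_left [simp]: "0 *\<^sub>C f = 0"
  using scaleR_zero_left[of f] by (simp add: scaleR_scaleC)

lemma scaleC_zero_right [simp]: "c *\<^sub>C 0 = 0"
  using scaleC_add_right[of c 0 0] by simp

text \<open>Operators are specified by their matrix elements, so this is the way in which vector and
  operator identities are checked below.\<close>

lemma cinner_eqI:
  assumes "\<And>h. cinner f h = cinner g h"
  shows "f = g"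
proof -
  have "inner (f - g) (f - g) = 0"
    using assms by (simp add: inner_L2_def cinner_diff_left)
  then show ?thesis by simp
qed

lemma scaleC_add_left: "(a + b) *\<^sub>C f = a *\<^sub>C f + b *\<^sub>C f"
  by (rule cinner_eqI) (simp add: cinner_scaleC_left cinner_add_left distrib_right)

lemma scaleC_diff_left: "(a - b) *\<^sub>C f = a *\<^sub>C f - b *\<^sub>C f"
  by (rule cinner_eqI) (simp add: cinner_scaleC_left cinner_diff_left left_diff_distrib)

lemma Re_cinner: "Re (cinner f g) = inner f g"
  by (simp add: inner_L2_def)

lemma cinner_self: "cinner f f = of_real ((norm f)\<^sup>2)"
proof (rule complex_eqI)
  have "Im (cinner f f) = - Im (cinner f f)"
    by (metis cinner_commute cnj.simps(2))
  then show "Im (cinner f f) = Im (of_real ((norm f)\<^sup>2))" by simp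
qed (simp add: Re_cinner power2_norm_eq_inner)

lemma mult_cnj_norm: "z * cnj z = (complex_of_real (cmod z))\<^sup>2"
  using complex_norm_square[of z] by simp

lemma cinner_mult_commuted: "cinner f g * cinner g f = of_real ((cmod (cinner f g))\<^sup>2)"
  by (metis cinner_commute complex_norm_square)

lemma cmod_cinner_commute: "cmod (cinner f g) = cmod (cinner g f)"
  by (metis cinner_commute complex_mod_cnj)

lemma norm_scaleC [simp]: "norm (c *\<^sub>C f) = cmod c * norm f"
proof -
  have "complex_of_real ((norm (c *\<^sub>C f))\<^sup>2) = of_real ((cmod c * norm f)\<^sup>2)"
    unfolding cinner_self[symmetric] cinner_scaleC_left cinner_scaleC_right power_mult_distrib
    by (simp add: cinner_self mult_cnj_norm mult_ac)
  then have "(norm (c *\<^sub>C f))\<^sup>2 = (cmod c * norm f)\<^sup>2"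
    by (simp only: of_real_eq_iff)
  then show ?thesis by simp
qed

text \<open>A unimodular factor turns <f, g> into its modulus, a real number, where the
  Cauchy-Schwarz inequality of the real inner product applies.\<close>

lemma Cauchy_Schwarz_cinner: "cmod (cinner f g) \<le> norm f * norm g"
proof (cases "cinner f g = 0")
  case False
  define c where "c = cnj (sgn (cinner f g))"
  have c1: "cmod c = 1" using False by (simp add: c_def norm_sgn)
  have "cinner (c *\<^sub>C f) g = cinner f g * cnj (cinner f g) / of_real (cmod (cinner f g))"
    by (simp add: c_def cinner_scaleC_left sgn_eq)
  also have "\<dots> = complex_of_real (cmod (cinner f g))"
    unfolding complex_norm_square[symmetric] using False by (simp add: power2_eq_square)
  finally have "complex_of_real (cmod (cinner f g)) = cinner (c *\<^sub>C f) g" by simp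
  then have "cmod (cinner f g) = inner (c *\<^sub>C f) g"
    by (metis Re_cinner Re_complex_of_real)
  also have "\<dots> \<le> norm (c *\<^sub>C f) * norm g"
    by (rule norm_cauchy_schwarz)
  finally show ?thesis by (simp add: c1)
qed simp

lemma bounded_linear_cinner_left: "bounded_linear (\<lambda>f. cinner f g)"
  by (rule bounded_linear_intro[where K = "norm g"])
     (auto simp: cinner_add_left cinner_scaleR_left scaleR_conv_of_real Cauchy_Schwarz_cinner)

lemma square_integrable_rep: "square_integrable (rep_L2 f)"
  using Quotient_rep_reflp[OF Quotient_L2, of f] by (simp add: l2rel_def)

lemma measurable_rep [measurable]: "rep_L2 f \<in> borel_measurable borel"
  using square_integrable_rep[of f] by (simp add: square_integrable_def)

lemma cinner_rep: "cinner f g = (LINT t|lborel. rep_L2 f t * cnj (rep_L2 g t))"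
  by (simp add: cinner.rep_eq)

lemma cinner_abs:
  assumes "square_integrable u" "square_integrable v"
  shows "cinner (abs_L2 u) (abs_L2 v) = (LINT t|lborel. u t * cnj (v t))"
  using assms by (intro cinner.abs_eq) (auto simp: l2rel_def)

lemma norm_rep: "(norm f)\<^sup>2 = (LINT t|lborel. (cmod (rep_L2 f t))\<^sup>2)"
proof -
  have "complex_of_real ((norm f)\<^sup>2) = of_real (LINT t|lborel. (cmod (rep_L2 f t))\<^sup>2)"
    unfolding cinner_self[symmetric] cinner_rep integral_complex_of_real[symmetric]
    by (intro Bochner_Integration.integral_cong refl) (simp add: mult_cnj_norm)
  then show ?thesis by (simp only: of_real_eq_iff)
qed

lemma rep_abs_AE:
  assumes "square_integrable u"
  shows "AE t in lborel. rep_L2 (abs_L2 u) t = u t"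
proof -
  have "l2rel (rep_L2 (abs_L2 u)) u"
    using Quotient_rep_abs[OF Quotient_L2, of u] assms by (simp add: l2rel_def)
  then show ?thesis by (simp add: l2rel_def)
qed

lemma abs_rep: "abs_L2 (rep_L2 f) = f"
  by (rule Quotient_abs_rep[OF Quotient_L2])

lemma square_integrable_diff:
  assumes "square_integrable f" "square_integrable g"
  shows "square_integrable (\<lambda>t. f t - g t)"
proof -
  have "square_integrable (\<lambda>t. f t + (- 1) * g t)"
    using assms by (intro square_integrable_add square_integrable_mult)
  then show ?thesis by simp
qed

text \<open>\<open>rep_L2\<close> picks some representative of each class, so
  \<open>rep_L2 (f - g)\<close> and the pointwise difference need only agree almost
  everywhere.\<close>

lemma norm_diff_rep: "(norm (f - g))\<^sup>2 = (LINT t|lborel. (cmod (rep_L2 f t - rep_L2 g t))\<^sup>2)"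
  and square_integrable_diff_rep: "square_integrable (\<lambda>t. rep_L2 f t - rep_L2 g t)"
proof -
  show sq: "square_integrable (\<lambda>t. rep_L2 f t - rep_L2 g t)"
    by (rule square_integrable_diff[OF square_integrable_rep square_integrable_rep])
  have "f - g = abs_L2 (rep_L2 f) + - abs_L2 (rep_L2 g)"
    unfolding abs_rep by (rule minus_L2_def)
  also have "\<dots> = abs_L2 (\<lambda>t. rep_L2 f t - rep_L2 g t)"
  proof -
    have g: "square_integrable (\<lambda>t. - rep_L2 g t)"
      using square_integrable_diff[OF square_integrable_zero square_integrable_rep[of g]] by simp
    show ?thesis
      using square_integrable_rep[of f] square_integrable_rep[of g] g
      by (simp add: uminus_L2.abs_eq plus_L2.abs_eq l2rel_def del: add_uminus_conv_diff)
         (simp add: add_uminus_conv_diff)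
  qed
  finally have fg: "f - g = abs_L2 (\<lambda>t. rep_L2 f t - rep_L2 g t)" .
  have ae: "AE t in lborel. rep_L2 (f - g) t = rep_L2 f t - rep_L2 g t"
    unfolding fg by (rule rep_abs_AE[OF sq])
  show "(norm (f - g))\<^sup>2 = (LINT t|lborel. (cmod (rep_L2 f t - rep_L2 g t))\<^sup>2)"
    unfolding norm_rep
    by (intro integral_cong_AE) (use ae in auto)
qed

lemma nn_norm_diff_rep:
  "(\<integral>\<^sup>+t. ennreal ((cmod (rep_L2 f t - rep_L2 g t))\<^sup>2) \<partial>lborel) = ennreal ((norm (f - g))\<^sup>2)"
  unfolding norm_diff_rep using square_integrable_diff_rep[of f g]
  by (intro nn_integral_eq_integral) (auto simp: square_integrable_def)

text \<open>Fatou's lemma turns the almost everywhere limit of a rapidly convergent subsequence into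
  the \<open>L\<^sup>2\<close> limit.\<close>

lemma L2_limit_of_fast_sequence:
  fixes Y :: "nat \<Rightarrow> 'a::euclidean_space L2"
  assumes fast: "\<And>m n. n \<le> m \<Longrightarrow> (norm (Y m - Y n))\<^sup>2 \<le> (1 / 8) ^ n"
  obtains g where "\<And>n. (norm (g - Y n))\<^sup>2 \<le> (1 / 8) ^ n"
proof -
  define u where "u n = rep_L2 (Y n)" for n
  have um [measurable]: "u n \<in> borel_measurable borel" for n
    by (simp add: u_def)
  \<comment> \<open>The weight 4^n balances two demands: 4^n / 8^n = 2^(-n) is still summable, and
    boundedness of 4^n |difference|^2 makes the differences decay like 2^(-n), so the sequence
    converges pointwise.\<close>
  have "(\<integral>\<^sup>+t. (\<Sum>n. ennreal (4 ^ n * (cmod (u (Suc n) t - u n t))\<^sup>2)) \<partial>lborel)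
      = (\<Sum>n. \<integral>\<^sup>+t. ennreal (4 ^ n * (cmod (u (Suc n) t - u n t))\<^sup>2) \<partial>lborel)"
    by (rule nn_integral_suminf) simp
  also have "\<dots> = (\<Sum>n. ennreal (4 ^ n * (norm (Y (Suc n) - Y n))\<^sup>2))"
    by (simp add: ennreal_mult nn_integral_cmult u_def nn_norm_diff_rep)
  also have "\<dots> \<le> (\<Sum>n. ennreal ((1 / 2) ^ n))"
  proof (intro suminf_le ennreal_leI)
    fix n
    have "4 ^ n * (norm (Y (Suc n) - Y n))\<^sup>2 \<le> 4 ^ n * (1 / 8) ^ n"
      using fast[of n "Suc n"] by simp
    also have "\<dots> = (1 / 2 :: real) ^ n" by (simp flip: power_mult_distrib)
    finally show "4 ^ n * (norm (Y (Suc n) - Y n))\<^sup>2 \<le> (1 / 2 :: real) ^ n" .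
  qed auto
  also have "\<dots> = ennreal (\<Sum>n. (1 / 2) ^ n)"
    by (rule suminf_ennreal2) (auto simp: summable_geometric)
  also have "\<dots> < \<infinity>" by simp
  finally have "AE t in lborel. (\<Sum>n. ennreal (4 ^ n * (cmod (u (Suc n) t - u n t))\<^sup>2)) \<noteq> \<infinity>"
    by (intro nn_integral_PInf_AE) auto
  then have conv: "AE t in lborel. convergent (\<lambda>n. u n t)"
  proof eventually_elim
    case (elim t)
    then have "summable (\<lambda>n. 4 ^ n * (cmod (u (Suc n) t - u n t))\<^sup>2)"
      by (intro summable_suminf_not_top) auto
    then obtain C where C: "\<And>n. 4 ^ n * (cmod (u (Suc n) t - u n t))\<^sup>2 \<le> C"
      using summable_imp_Bseq[of "\<lambda>n. 4 ^ n * (cmod (u (Suc n) t - u n t))\<^sup>2"]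
      unfolding Bseq_def by (auto simp: abs_le_iff)
    have "C \<ge> 0" using C[of 0] by (rule order_trans[rotated]) simp
    have "cmod (u (Suc n) t - u n t) \<le> sqrt C * (1 / 2) ^ n" for n
    proof (rule power2_le_imp_le)
      have "(cmod (u (Suc n) t - u n t))\<^sup>2 \<le> C / 4 ^ n"
        using C[of n] by (simp add: field_simps)
      also have "\<dots> = (sqrt C * (1 / 2) ^ n)\<^sup>2"
      proof -
        have "(4 :: real) ^ n = (2 ^ n)\<^sup>2"
          by (simp add: power2_eq_square flip: power_mult_distrib)
        then show ?thesis
          using \<open>C \<ge> 0\<close> by (simp add: power_mult_distrib power_divide)
      qed
      finally show "(cmod (u (Suc n) t - u n t))\<^sup>2 \<le> (sqrt C * (1 / 2) ^ n)\<^sup>2" .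
    qed (use \<open>C \<ge> 0\<close> in simp)
    moreover have "summable (\<lambda>n. sqrt C * (1 / 2) ^ n)"
      by (rule summable_mult) (rule summable_geometric, simp)
    ultimately have "summable (\<lambda>n. u (Suc n) t - u n t)"
      by (rule summable_comparison_test'[rotated])
    then have "convergent (\<lambda>n. u 0 t + (\<Sum>k<n. u (Suc k) t - u k t))"
      unfolding summable_iff_convergent by (rule convergent_add[OF convergent_const])
    then show ?case by (simp only: sum_lessThan_telescope[of "\<lambda>n. u n t"]) simp
  qed
  define w where "w t = lim (\<lambda>n. u n t)" for t
  have wm [measurable]: "w \<in> borel_measurable borel"
    unfolding w_def by measurable
  have lim: "AE t in lborel. (\<lambda>n. u n t) \<longlonglongrightarrow> w t"
    using conv by eventually_elim (simp add: w_def convergent_LIMSEQ_iff)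
  have bound: "(\<integral>\<^sup>+t. ennreal ((cmod (w t - u n t))\<^sup>2) \<partial>lborel) \<le> ennreal ((1 / 8) ^ n)" for n
  proof -
    have "(\<integral>\<^sup>+t. ennreal ((cmod (w t - u n t))\<^sup>2) \<partial>lborel)
        = (\<integral>\<^sup>+t. liminf (\<lambda>m. ennreal ((cmod (u m t - u n t))\<^sup>2)) \<partial>lborel)"
    proof (rule nn_integral_cong_AE, use lim in eventually_elim)
      fix t assume "(\<lambda>n. u n t) \<longlonglongrightarrow> w t"
      then have "(\<lambda>m. ennreal ((cmod (u m t - u n t))\<^sup>2)) \<longlonglongrightarrow> ennreal ((cmod (w t - u n t))\<^sup>2)"
        by (intro tendsto_intros tendsto_ennrealI)
      then show "ennreal ((cmod (w t - u n t))\<^sup>2) = liminf (\<lambda>m. ennreal ((cmod (u m t - u n t))\<^sup>2))"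
        by (simp only: lim_imp_Liminf[OF trivial_limit_sequentially])
    qed
    also have "\<dots> \<le> liminf (\<lambda>m. \<integral>\<^sup>+t. ennreal ((cmod (u m t - u n t))\<^sup>2) \<partial>lborel)"
      by (rule nn_integral_liminf) simp
    also have "\<dots> \<le> ennreal ((1 / 8) ^ n)"
    proof -
      have "eventually (\<lambda>m. (\<integral>\<^sup>+t. ennreal ((cmod (u m t - u n t))\<^sup>2) \<partial>lborel) \<le> ennreal ((1 / 8) ^ n)) sequentially"
      proof (rule eventually_sequentiallyI[of n])
        fix m assume "n \<le> m"
        from ennreal_leI[OF fast[OF this]]
        show "(\<integral>\<^sup>+t. ennreal ((cmod (u m t - u n t))\<^sup>2) \<partial>lborel) \<le> ennreal ((1 / 8) ^ n)"
          unfolding u_def nn_norm_diff_rep .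
      qed
      then show ?thesis
        by (intro Liminf_le) auto
    qed
    finally show ?thesis .
  qed
  have sqd: "square_integrable (\<lambda>t. w t - u n t)" for n
    using bound[of n] unfolding square_integrable_def
    by (auto intro!: integrableI_bounded order.strict_trans1[OF bound[of n]])
  have sqw: "square_integrable w"
    using square_integrable_add[OF sqd[of 0] square_integrable_rep[of "Y 0"]]
    by (simp add: u_def)
  show thesis
  proof (rule that[of "abs_L2 w"])
    fix n
    have "ennreal ((norm (abs_L2 w - Y n))\<^sup>2)
        = (\<integral>\<^sup>+t. ennreal ((cmod (rep_L2 (abs_L2 w) t - u n t))\<^sup>2) \<partial>lborel)"
      by (simp add: u_def nn_norm_diff_rep)
    also have "\<dots> = (\<integral>\<^sup>+t. ennreal ((cmod (w t - u n t))\<^sup>2) \<partial>lborel)"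
      using rep_abs_AE[OF sqw] by (intro nn_integral_cong_AE) (auto elim: eventually_mono)
    also note bound[of n]
    finally show "(norm (abs_L2 w - Y n))\<^sup>2 \<le> (1 / 8) ^ n"
      by (subst (asm) ennreal_le_iff) auto
  qed
qed

instance L2 :: (euclidean_space) complete_space
proof
  fix X :: "nat \<Rightarrow> 'a L2"
  assume X: "Cauchy X"
  have "\<exists>r. strict_mono r \<and> (\<forall>n. \<forall>i\<ge>r n. \<forall>j\<ge>r n. norm (X i - X j) < sqrt ((1 / 8) ^ n))"
  proof -
    have "\<exists>N. \<forall>i\<ge>N. \<forall>j\<ge>N. norm (X i - X j) < sqrt ((1 / 8) ^ n)" for n
      using CauchyD[OF X, of "sqrt ((1 / 8) ^ n)"] by simp
    then obtain N where N: "\<And>n i j. i \<ge> N n \<Longrightarrow> j \<ge> N n \<Longrightarrow> norm (X i - X j) < sqrt ((1 / 8) ^ n)"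
      by metis
    \<comment> \<open>Summing the successors makes \<open>r\<close> strictly increasing while
      keeping it above \<open>N\<close>.\<close>
    define r where "r n = (\<Sum>k\<le>n. Suc (N k))" for n
    have "strict_mono r" by (rule strict_monoI_Suc) (simp add: r_def)
    moreover have "N n \<le> r n" for n
      by (cases n) (simp_all add: r_def)
    ultimately show ?thesis using N order_trans[of "N _" "r _"]
      by (intro exI[of _ r] conjI allI impI) blast+
  qed
  then obtain r where r: "strict_mono r"
      "\<And>n i j. i \<ge> r n \<Longrightarrow> j \<ge> r n \<Longrightarrow> norm (X i - X j) < sqrt ((1 / 8) ^ n)"
    by blast
  have "(norm (X (r m) - X (r n)))\<^sup>2 \<le> (1 / 8) ^ n" if "n \<le> m" for m n
  proof -
    have "norm (X (r m) - X (r n)) \<le> sqrt ((1 / 8) ^ n)"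
      using r(2)[of n "r m" "r n"] strict_mono_less_eq[OF r(1)] that by simp
    then have "(norm (X (r m) - X (r n)))\<^sup>2 \<le> (sqrt ((1 / 8) ^ n))\<^sup>2"
      by (intro power_mono) auto
    then show ?thesis by simp
  qed
  then obtain g where g: "\<And>n. (norm (g - X (r n)))\<^sup>2 \<le> (1 / 8) ^ n"
    using L2_limit_of_fast_sequence[of "\<lambda>n. X (r n)"] by blast
  have "(\<lambda>n. X (r n)) \<longlonglongrightarrow> g"
  proof -
    have "(\<lambda>n. (1 / 8 :: real) ^ n) \<longlonglongrightarrow> 0" by (intro LIMSEQ_power_zero) simp
    then have "(\<lambda>n. (norm (g - X (r n)))\<^sup>2) \<longlonglongrightarrow> 0"
      by (rule Lim_null_comparison[rotated]) (simp add: g)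
    then have "(\<lambda>n. sqrt ((norm (g - X (r n)))\<^sup>2)) \<longlonglongrightarrow> sqrt 0" by (rule tendsto_real_sqrt)
    then have "(\<lambda>n. norm (X (r n) - g)) \<longlonglongrightarrow> 0" by (simp add: norm_minus_commute)
    then show ?thesis by (metis LIM_zero_cancel tendsto_norm_zero_cancel)
  qed
  then have "X \<longlonglongrightarrow> g"
    using Cauchy_converges_subseq[OF X r(1)] unfolding o_def by blast
  then show "convergent X" by (auto simp: convergent_def)
qed

section \<open>Projections, the Riesz representation theorem and orthonormal bases\<close>

text \<open>\<open>M\<close> need not be closed, so the point of least distance lies only in its
  closure. This lets the lemma serve both kernels of functionals and spans of bases.\<close>

lemma exists_orthogonal_projection:
  fixes M :: "'b::{real_inner, complete_space} set"
  assumes M: "subspace M"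
  obtains p where "p \<in> closure M" "\<And>y. y \<in> M \<Longrightarrow> inner (x - p) y = 0"
proof -
  define d where "d = (INF y\<in>M. (norm (x - y))\<^sup>2)"
  have bdd: "bdd_below ((\<lambda>y. (norm (x - y))\<^sup>2) ` M)"
    by (intro bdd_belowI[of _ 0]) auto
  have ne: "M \<noteq> {}" using subspace_0[OF M] by auto
  have d_le: "d \<le> (norm (x - y))\<^sup>2" if "y \<in> M" for y
    unfolding d_def by (rule cINF_lower[OF bdd that])
  have "\<exists>y\<in>M. (norm (x - y))\<^sup>2 < d + 1 / Suc n" for n
    unfolding d_def using cINF_less_iff[OF ne bdd, of "d + 1 / Suc n"] unfolding d_def by simp
  then obtain Y where Y: "\<And>n. Y n \<in> M" "\<And>n. (norm (x - Y n))\<^sup>2 < d + 1 / Suc n"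
    by metis
  have close: "(norm (Y m - Y n))\<^sup>2 \<le> 4 / Suc N" if "N \<le> m" "N \<le> n" for m n N
  proof -
    \<comment> \<open>Parallelogram law: the midpoint lies in \<open>M\<close>, hence at squared
      distance at least \<open>d\<close>, and twice the two excesses, each at most 1 / (N + 1),
      gives 4 / (N + 1).\<close>
    have "(1 / 2) *\<^sub>R (Y m + Y n) \<in> M"
      by (intro subspace_scale[OF M] subspace_add[OF M] Y)
    note d_le[OF this]
    moreover have "(norm (Y m - Y n))\<^sup>2 = 2 * (norm (x - Y m))\<^sup>2 + 2 * (norm (x - Y n))\<^sup>2
        - 4 * (norm (x - (1 / 2) *\<^sub>R (Y m + Y n)))\<^sup>2"
      unfolding power2_norm_eq_inner
      by (simp add: inner_simps algebra_simps inner_commute)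
    moreover have "1 / real (Suc m) \<le> 1 / Suc N" "1 / real (Suc n) \<le> 1 / Suc N"
      using that by (simp_all add: frac_le)
    ultimately show ?thesis using Y(2)[of m] Y(2)[of n] by linarith
  qed
  have "Cauchy Y"
  proof (rule CauchyI)
    fix e :: real assume "0 < e"
    then obtain N where N: "inverse (real (Suc N)) < e\<^sup>2 / 4"
      using reals_Archimedean[of "e\<^sup>2 / 4"] by auto
    have "norm (Y m - Y n) < e" if "m \<ge> N" "n \<ge> N" for m n
    proof (rule power_less_imp_less_base)
      show "(norm (Y m - Y n))\<^sup>2 < e\<^sup>2"
        using close[OF that] N by (simp add: inverse_eq_divide)
    qed (use \<open>0 < e\<close> in simp)
    then show "\<exists>N. \<forall>m\<ge>N. \<forall>n\<ge>N. norm (Y m - Y n) < e" by blast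
  qed
  then obtain p where p: "Y \<longlonglongrightarrow> p"
    using Cauchy_convergent_iff convergent_def by blast
  show thesis
  proof (rule that)
    show "p \<in> closure M" using p Y(1) closure_sequential by blast
    fix z assume z: "z \<in> M"
    have xp: "(norm (x - p))\<^sup>2 \<le> d"
    proof (rule LIMSEQ_le)
      show "(\<lambda>n. (norm (x - Y n))\<^sup>2) \<longlonglongrightarrow> (norm (x - p))\<^sup>2" by (intro tendsto_intros p)
      have "(\<lambda>n. 1 / real (Suc n)) \<longlonglongrightarrow> 0"
        using LIMSEQ_inverse_real_of_nat by (simp add: inverse_eq_divide)
      then show "(\<lambda>n. d + 1 / real (Suc n)) \<longlonglongrightarrow> d"
        using tendsto_add[OF tendsto_const[of d]] by fastforce
    qed (use Y(2) less_imp_le in blast)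
    have dmin: "d \<le> (norm (x - p - t *\<^sub>R z))\<^sup>2" for t
    proof (rule LIMSEQ_le_const)
      show "(\<lambda>n. (norm (x - Y n - t *\<^sub>R z))\<^sup>2) \<longlonglongrightarrow> (norm (x - p - t *\<^sub>R z))\<^sup>2"
        by (intro tendsto_intros p)
      have "d \<le> (norm (x - Y n - t *\<^sub>R z))\<^sup>2" for n
        using d_le[OF subspace_add[OF M Y(1)[of n] subspace_scale[OF M z, of t]]]
        by (simp add: diff_diff_eq)
      then show "\<exists>N. \<forall>n\<ge>N. d \<le> (norm (x - Y n - t *\<^sub>R z))\<^sup>2" by blast
    qed
    show "inner (x - p) z = 0"
    proof (cases "z = 0")
      case False
      define a where "a = inner (x - p) z"
      \<comment> \<open>The minimizer of the quadratic polynomial |x - p - t z|^2 in t. Its value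
        there is |x - p|^2 - a^2 / <z, z>, so minimality at p forces \<open>a\<close> to
        vanish.\<close>
      define t where "t = a / inner z z"
      have zz: "inner z z > 0" using False by simp
      have "(norm (x - p - t *\<^sub>R z))\<^sup>2 = (norm (x - p))\<^sup>2 - 2 * t * a + t * t * inner z z"
        unfolding power2_norm_eq_inner a_def
        by (simp add: inner_simps algebra_simps inner_commute)
      also have "\<dots> = (norm (x - p))\<^sup>2 - a\<^sup>2 / inner z z"
        using zz by (simp add: t_def field_simps power2_eq_square)
      finally have "a\<^sup>2 / inner z z \<le> 0" using dmin[of t] xp by linarith
      then show ?thesis using zz by (simp add: divide_le_0_iff a_def)
    qed simp
  qed
qed

lemma Riesz_representation_real:
  fixes F :: "'b::{real_inner, complete_space} \<Rightarrow> real"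
  assumes F: "bounded_linear F"
  obtains v where "\<And>x. F x = inner x v"
proof (cases "\<exists>x. F x \<noteq> 0")
  case True
  then obtain x where x: "F x \<noteq> 0" by blast
  interpret F: bounded_linear F by fact
  have sub: "subspace {x. F x = 0}"
    by (auto simp: subspace_def F.zero F.add F.scaleR)
  have cl: "closed {x. F x = 0}"
    by (intro closed_Collect_eq F.continuous_on continuous_intros)
  obtain p where p: "F p = 0" and orth: "\<And>y. F y = 0 \<Longrightarrow> inner (x - p) y = 0"
    using exists_orthogonal_projection[OF sub, of x] closure_closed[OF cl] by auto
  define u where "u = x - p"
  have Fu: "F u \<noteq> 0" using x p by (simp add: u_def F.diff)
  then have u: "inner u u \<noteq> 0" by (auto simp: F.zero)
  show thesis
  proof (rule that[of "(F u / inner u u) *\<^sub>R u"])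
    fix y
    have "F (y - (F y / F u) *\<^sub>R u) = 0" using Fu by (simp add: F.diff F.scaleR)
    from orth[OF this] have "inner u y = F y / F u * inner u u"
      by (simp add: inner_diff_right flip: u_def)
    then show "F y = inner y ((F u / inner u u) *\<^sub>R u)"
      using Fu u by (simp add: inner_commute[of y])
  qed
next
  case False
  then show thesis by (intro that[of 0]) simp
qed

text \<open>A complex functional is recovered from its real part by Im F(f) = Re F(-i f), so the
  vector that represents the real part already represents \<open>F\<close>.\<close>

lemma Riesz_representation:
  assumes F: "bounded_linear F" and hom: "\<And>c f. F (c *\<^sub>C f) = c * F f"
  obtains v :: "'a::euclidean_space L2" where "\<And>f. F f = cinner f v"
proof -
  have "bounded_linear (\<lambda>f. Re (F f))"
    by (rule bounded_linear_compose[OF bounded_linear_Re F])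
  then obtain v where v: "\<And>f. Re (F f) = inner f v"
    using Riesz_representation_real by blast
  have "F f = cinner f v" for f
  proof (rule complex_eqI)
    show "Re (F f) = Re (cinner f v)" by (simp add: v Re_cinner)
    have "Im (F f) = Re (F (- \<i> *\<^sub>C f))" by (simp add: hom)
    also have "\<dots> = Re (cinner (- \<i> *\<^sub>C f) v)" by (simp only: v Re_cinner)
    finally show "Im (F f) = Im (cinner f v)" by (simp add: cinner_scaleC_left)
  qed
  then show thesis by (rule that)
qed

text \<open>Supplies the operator behind the weak definition of \<open>fun_op_conv\<close>.\<close>

lemma bounded_op_of_sesquilinear_form:
  fixes B :: "'a::euclidean_space L2 \<Rightarrow> 'a L2 \<Rightarrow> complex"
  assumes add1: "\<And>f f' g. B (f + f') g = B f g + B f' g"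
    and mult1: "\<And>c f g. B (c *\<^sub>C f) g = c * B f g"
    and add2: "\<And>f g g'. B f (g + g') = B f g + B f g'"
    and mult2: "\<And>c f g. B f (c *\<^sub>C g) = cnj c * B f g"
    and bound: "\<And>f g. cmod (B f g) \<le> C * norm f * norm g"
  obtains T where "bounded_op T" "\<And>f g. cinner (T f) g = B f g"
proof -
  have "\<exists>v. \<forall>g. cinner v g = B f g" for f
  proof -
    have "bounded_linear (\<lambda>g. cnj (B f g))"
      by (rule bounded_linear_intro[where K = "C * norm f"])
         (use bound[of f] in \<open>auto simp: add2 mult2 scaleR_scaleC scaleR_conv_of_real mult_ac\<close>)
    then obtain v where "\<And>g. cnj (B f g) = cinner g v"
      using Riesz_representation[of "\<lambda>g. cnj (B f g)"] by (force simp: mult2)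
    then have "\<forall>g. cinner v g = B f g"
      by (metis cinner_commute complex_cnj_cnj)
    then show ?thesis by blast
  qed
  then obtain T where T: "\<And>f g. cinner (T f) g = B f g" by metis
  have Tmult: "T (c *\<^sub>C f) = c *\<^sub>C T f" for c f
    by (rule cinner_eqI) (simp add: T mult1 cinner_scaleC_left)
  have "bounded_linear T"
  proof (rule bounded_linear_intro[where K = C])
    show "T (f + f') = T f + T f'" for f f'
      by (rule cinner_eqI) (simp add: T add1 cinner_add_left)
    show "T (r *\<^sub>R f) = r *\<^sub>R T f" for r f
      by (simp add: scaleR_scaleC Tmult)
    show "norm (T f) \<le> norm f * C" for f
    proof (cases "T f = 0")
      case True
      \<comment> \<open>The sign of \<open>C\<close> comes from the bound itself: at the pair (f, f)
        it gives C >= 0 unless f = 0.\<close>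
      have "0 \<le> C * norm f * norm f"
        using bound[of f f] norm_ge_zero order_trans by blast
      then have "0 \<le> C \<or> norm f = 0" by (auto simp: zero_le_mult_iff)
      then show ?thesis using True by auto
    next
      case False
      have "norm (T f) * norm (T f) = cmod (cinner (T f) (T f))"
        by (simp add: cinner_self power2_eq_square norm_mult)
      also have "\<dots> \<le> C * norm f * norm (T f)" by (simp only: T bound)
      finally show ?thesis using False by (simp add: mult.commute)
    qed
  qed
  with Tmult T show thesis by (intro that[of T]) (auto simp: bounded_op_def)
qed

lemma adj_eqI:
  assumes "\<And>f g. cinner (A f) g = cinner f (B g)"
  shows "adj A = B"
  unfolding adj_def
proof (rule the_equality)
  fix B' assume B': "\<forall>f g. cinner (A f) g = cinner f (B' g)"
  have "cinner (B' g) f = cinner (B g) f" for f g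
    by (metis B' assms cinner_commute)
  then show "B' = B" by (intro ext cinner_eqI)
qed (use assms in blast)

text \<open>Pythagoras for the projection onto a finite part of the system. The identity serves
  twice: its left side is nonnegative, which is Bessel's inequality, and dropping the sum shows that
  taking residuals is a contraction, which drives the convergence of expansions.\<close>

lemma orthonormal_residual_norm:
  assumes "orthonormal E" "F \<subseteq> E" "finite F"
  shows "(norm (f - (\<Sum>e\<in>F. cinner f e *\<^sub>C e)))\<^sup>2 = (norm f)\<^sup>2 - (\<Sum>e\<in>F. (cmod (cinner f e))\<^sup>2)"
proof -
  have Fe: "cinner (\<Sum>e\<in>F. cinner f e *\<^sub>C e) e' = cinner f e'" if "e' \<in> F" for e'
  proof -
    have "cinner (\<Sum>e\<in>F. cinner f e *\<^sub>C e) e' = (\<Sum>e\<in>F. cinner f e * (if e = e' then 1 else 0))"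
      unfolding cinner_sum_left cinner_scaleC_left
    proof (intro sum.cong refl)
      fix e assume "e \<in> F"
      then have "cinner e e' = (if e = e' then 1 else 0)"
        using assms that unfolding orthonormal_def by blast
      then show "cinner f e * cinner e e' = cinner f e * (if e = e' then 1 else 0)" by simp
    qed
    also have "\<dots> = cinner f e'"
      using assms that by (simp add: if_distrib[of "(*) (cinner f _)"] cong: if_cong)
    finally show ?thesis .
  qed
  let ?P = "\<Sum>e\<in>F. cinner f e *\<^sub>C e"
  have "cinner (f - ?P) ?P = 0"
    unfolding cinner_sum_right cinner_scaleC_right
    by (intro sum.neutral ballI) (simp add: cinner_diff_left Fe)
  then have "cinner (f - ?P) (f - ?P) = cinner (f - ?P) f"
    by (simp add: cinner_diff_right)
  also have "\<dots> = cinner f f - (\<Sum>e\<in>F. cinner f e * cinner e f)"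
    by (simp add: cinner_diff_left cinner_sum_left cinner_scaleC_left)
  also have "(\<Sum>e\<in>F. cinner f e * cinner e f) = of_real (\<Sum>e\<in>F. (cmod (cinner f e))\<^sup>2)"
    unfolding of_real_sum
    by (intro sum.cong refl cinner_mult_commuted)
  finally have "complex_of_real ((norm (f - ?P))\<^sup>2)
      = of_real ((norm f)\<^sup>2 - (\<Sum>e\<in>F. (cmod (cinner f e))\<^sup>2))"
    unfolding cinner_self by (simp only: of_real_diff)
  then show ?thesis by (simp only: of_real_eq_iff)
qed

lemma Bessel_inequality:
  assumes "orthonormal E" "F \<subseteq> E" "finite F"
  shows "(\<Sum>e\<in>F. (cmod (cinner f e))\<^sup>2) \<le> (norm f)\<^sup>2"
  using orthonormal_residual_norm[OF assms, of f] zero_le_power2[of "norm (f - (\<Sum>e\<in>F. cinner f e *\<^sub>C e))"]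
  by linarith

text \<open>\<open>onb\<close> demands only a trivial orthogonal complement. The span is the real
  one, so the generators are all complex multiples of basis vectors; the multiples by 1 and i
  recover the real and imaginary parts of <f - p, e>.\<close>

lemma onb_span_dense:
  assumes E: "onb E"
  shows "closure (span {c *\<^sub>C e | c e. e \<in> E}) = UNIV"
proof -
  let ?M = "span {c *\<^sub>C e | c e. e \<in> E}"
  have "f \<in> closure ?M" for f
  proof -
    obtain p where p: "p \<in> closure ?M" "\<And>y. y \<in> ?M \<Longrightarrow> inner (f - p) y = 0"
      using exists_orthogonal_projection[OF subspace_span] by blast
    have "cinner (f - p) e = 0" if "e \<in> E" for e
    proof (rule complex_eqI)
      have ce: "Re (cinner (f - p) (c *\<^sub>C e)) = 0" for c
        unfolding Re_cinner using that by (intro p(2) span_base) auto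
      show "Re (cinner (f - p) e) = Re 0" using ce[of 1] by simp
      show "Im (cinner (f - p) e) = Im 0" using ce[of \<i>] by (simp add: cinner_scaleC_right)
    qed
    then have "f - p = 0" using E unfolding onb_def by blast
    then show ?thesis using p(1) by simp
  qed
  then show ?thesis by blast
qed

text \<open>On finite combinations the basis expansion is eventually exact; density then carries
  convergence over to all vectors.\<close>

lemma span_onb_eq_partial_sum:
  assumes E: "orthonormal E" and y: "y \<in> span {c *\<^sub>C e | c e. e \<in> E}"
  shows "\<exists>F. finite F \<and> F \<subseteq> E \<and> (\<forall>F'. finite F' \<longrightarrow> F \<subseteq> F' \<longrightarrow> F' \<subseteq> E \<longrightarrow>
    (\<Sum>e\<in>F'. cinner y e *\<^sub>C e) = y)"
  using y
proof (induction rule: span_induct_alt)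
  case base
  show ?case by (intro exI[of _ "{}"]) simp
next
  case (step r x y)
  then obtain c e where x: "x = c *\<^sub>C e" "e \<in> E" by blast
  obtain F where F: "finite F" "F \<subseteq> E"
    "\<And>F'. finite F' \<Longrightarrow> F \<subseteq> F' \<Longrightarrow> F' \<subseteq> E \<Longrightarrow> (\<Sum>e\<in>F'. cinner y e *\<^sub>C e) = y"
    using step by blast
  show ?case
  proof (intro exI[of _ "insert e F"] conjI allI impI)
    fix F' assume F': "finite F'" "insert e F \<subseteq> F'" "F' \<subseteq> E"
    have "(\<Sum>e'\<in>F'. cinner x e' *\<^sub>C e') = (\<Sum>e'\<in>F'. if e' = e then x else 0)"
    proof (intro sum.cong refl)
      fix e' assume "e' \<in> F'"
      then have "cinner e e' = (if e = e' then 1 else 0)"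
        using E F' x(2) unfolding orthonormal_def by blast
      then show "cinner x e' *\<^sub>C e' = (if e' = e then x else 0)"
        by (auto simp: x(1) cinner_scaleC_left)
    qed
    also have "\<dots> = x" using F' by simp
    finally have "(\<Sum>e'\<in>F'. cinner x e' *\<^sub>C e') = x" .
    moreover have "(\<Sum>e'\<in>F'. cinner y e' *\<^sub>C e') = y"
      using F' by (intro F(3)) auto
    moreover have "(\<Sum>e'\<in>F'. cinner (r *\<^sub>R x + y) e' *\<^sub>C e')
        = r *\<^sub>R (\<Sum>e'\<in>F'. cinner x e' *\<^sub>C e') + (\<Sum>e'\<in>F'. cinner y e' *\<^sub>C e')"
      by (simp add: cinner_add_left cinner_scaleR_left scaleC_add_left sum.distrib scaleR_sum_right)
         (simp add: scaleR_scaleC)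
    ultimately show "(\<Sum>e'\<in>F'. cinner (r *\<^sub>R x + y) e' *\<^sub>C e') = r *\<^sub>R x + y"
      by simp
  qed (use F x in auto)
qed

lemma onb_expansion:
  assumes E: "onb E"
  shows "((\<lambda>e. cinner f e *\<^sub>C e) has_sum f) E"
  unfolding has_sum_def
proof (rule tendstoI)
  fix r :: real assume "0 < r"
  have on: "orthonormal E" using E by (simp add: onb_def)
  let ?P = "\<lambda>F g. \<Sum>e\<in>F. cinner g e *\<^sub>C e"
  obtain y where y: "y \<in> span {c *\<^sub>C e | c e. e \<in> E}" "dist y f < r"
    using closure_approachable[of f "span {c *\<^sub>C e | c e. e \<in> E}"] onb_span_dense[OF E] \<open>0 < r\<close> by auto
  obtain F where F: "finite F" "F \<subseteq> E"
    "\<And>F'. finite F' \<Longrightarrow> F \<subseteq> F' \<Longrightarrow> F' \<subseteq> E \<Longrightarrow> ?P F' y = y"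
    using span_onb_eq_partial_sum[OF on y(1)] by blast
  \<comment> \<open>Since \<open>y\<close> is reproduced exactly, f and f - y have the same
    residual, whose norm is at most that of f - y.\<close>
  have "dist (?P F' f) f < r" if F': "finite F'" "F \<subseteq> F'" "F' \<subseteq> E" for F'
  proof -
    have "(norm ((f - y) - ?P F' (f - y)))\<^sup>2 \<le> (norm (f - y))\<^sup>2"
      unfolding orthonormal_residual_norm[OF on F'(3,1)] by (simp add: sum_nonneg)
    then have "norm ((f - y) - ?P F' (f - y)) \<le> norm (f - y)" by (rule power2_le_imp_le) simp
    moreover have "?P F' (f - y) = ?P F' f - y"
      using F(3)[OF F'] by (simp add: cinner_diff_left scaleC_diff_left sum_subtractf)
    ultimately show ?thesis using y(2) by (simp add: dist_norm norm_minus_commute)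
  qed
  then show "eventually (\<lambda>F. dist (?P F f) f < r) (finite_subsets_at_top E)"
    unfolding eventually_finite_subsets_at_top using F by blast
qed

lemma Parseval_has_sum:
  assumes "onb E"
  shows "((\<lambda>e. cinner f e * cinner e g) has_sum cinner f g) E"
  using has_sum_bounded_linear[OF bounded_linear_cinner_left[of g] onb_expansion[OF assms, of f]]
  by (simp add: o_def cinner_scaleC_left)

lemma Parseval_norm_has_sum:
  assumes "onb E"
  shows "((\<lambda>e. (cmod (cinner f e))\<^sup>2) has_sum (norm f)\<^sup>2) E"
proof -
  have "((\<lambda>e. complex_of_real ((cmod (cinner f e))\<^sup>2)) has_sum of_real ((norm f)\<^sup>2)) E"
    using Parseval_has_sum[OF assms, of f f] by (simp only: cinner_mult_commuted cinner_self)
  then show ?thesis by (simp only: has_sum_of_real_iff)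
qed

text \<open>Parseval holds for whichever basis \<open>SOME\<close> selects, so the choice inside
  \<open>op_trace\<close> does not affect the value.\<close>

lemma op_trace_rank_one: "op_trace (rank_one f g) = cinner f g"
proof -
  have "onb (SOME E :: 'a L2 set. onb E)" using onb_exists by (rule someI_ex)
  from Parseval_has_sum[OF this, of f g] show ?thesis
    unfolding op_trace_def rank_one_def
    by (intro infsumI) (simp add: cinner_scaleC_left mult.commute)
qed

section \<open>Density operators as sums of rank-one operators\<close>

lemma bounded_op_scaleC: "bounded_op A \<Longrightarrow> A (c *\<^sub>C f) = c *\<^sub>C A f"
  by (simp add: bounded_op_def)

lemma bounded_op_add: "bounded_op A \<Longrightarrow> A (f + g) = A f + A g"
  by (simp add: bounded_op_def bounded_linear.linear linear_add)

lemma bounded_op_diff: "bounded_op A \<Longrightarrow> A (f - g) = A f - A g"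
  by (simp add: bounded_op_def bounded_linear.linear linear_diff)

lemma positive_op_cinner_self:
  assumes "positive_op A"
  shows "cinner (A f) f = of_real (Re (cinner (A f) f))" "0 \<le> Re (cinner (A f) f)"
proof -
  have "cinner (A f) f \<in> \<real>\<^sub>\<ge>\<^sub>0" using assms by (simp add: positive_op_def)
  then obtain r where "0 \<le> r" "cinner (A f) f = of_real r" by (rule nonneg_Reals_cases)
  then show "cinner (A f) f = of_real (Re (cinner (A f) f))" "0 \<le> Re (cinner (A f) f)"
    by simp_all
qed

text \<open>Reality of the quadratic form at f + g settles the imaginary parts, and at f + i g the
  real parts.\<close>

lemma positive_op_hermitian:
  assumes A: "positive_op A"
  shows "cinner (A f) g = cinner f (A g)"
proof -
  have bA: "bounded_op A" using A by (simp add: positive_op_def)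
  have Im0: "Im (cinner (A h) h) = 0" for h
    by (subst positive_op_cinner_self(1)[OF A]) simp
  have "Im (cinner (A f) g) = - Im (cinner (A g) f)"
    using Im0[of "f + g"] Im0[of f] Im0[of g]
    by (simp add: bounded_op_add[OF bA] cinner_add_left cinner_add_right)
  moreover have "Re (cinner (A f) g) = Re (cinner (A g) f)"
    using Im0[of "f + \<i> *\<^sub>C g"] Im0[of f] Im0[of "\<i> *\<^sub>C g"]
    by (simp add: bounded_op_add[OF bA] bounded_op_scaleC[OF bA] cinner_add_left cinner_add_right
        cinner_scaleC_left cinner_scaleC_right)
  ultimately have "cinner (A f) g = cnj (cinner (A g) f)"
    by (simp add: complex_eq_iff)
  then show ?thesis by (metis cinner_commute)
qed

text \<open>One step of Cholesky elimination: the rank-one operator of this vector agrees with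
  \<open>A\<close> at \<open>e\<close>, and subtracting it leaves the Schur complement
  \<open>deflate A e\<close>. If <Ae, e> = 0, the convention 1 / 0 = 0 makes the pivot zero and the
  step trivial.\<close>

definition pivot :: "('a::euclidean_space L2 \<Rightarrow> 'a L2) \<Rightarrow> 'a L2 \<Rightarrow> 'a L2" where
  "pivot A e = (1 / sqrt (Re (cinner (A e) e))) *\<^sub>R A e"

definition deflate :: "('a::euclidean_space L2 \<Rightarrow> 'a L2) \<Rightarrow> 'a L2 \<Rightarrow> 'a L2 \<Rightarrow> 'a L2" where
  "deflate A e f = A f - cinner f (pivot A e) *\<^sub>C pivot A e"

lemma quadratic_deflate:
  "Re (cinner (deflate A e f) f) = Re (cinner (A f) f) - (cmod (cinner f (pivot A e)))\<^sup>2"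
  by (simp add: deflate_def cinner_diff_left cinner_scaleC_left cinner_mult_commuted flip: of_real_power)

text \<open>Cauchy-Schwarz for the form <A f, g>, read off from its value at f - (a / q) e. It is
  exactly what keeps the deflated operator positive.\<close>

lemma pivot_bound:
  assumes A: "positive_op A"
  shows "(cmod (cinner f (pivot A e)))\<^sup>2 \<le> Re (cinner (A f) f)"
proof (cases "Re (cinner (A e) e) = 0")
  case True
  then show ?thesis using positive_op_cinner_self(2)[OF A] by (simp add: pivot_def)
next
  case False
  have bA: "bounded_op A" using A by (simp add: positive_op_def)
  define q where "q = Re (cinner (A e) e)"
  have q: "q > 0" "cinner (A e) e = of_real q"
    using False positive_op_cinner_self[OF A, of e] by (auto simp: q_def)
  define a where "a = cinner f (A e)"
  have a': "cinner (A e) f = cnj a" "cinner (A f) e = a"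
    by (metis a_def cinner_commute, simp add: a_def positive_op_hermitian[OF A])
  have cm: "a * cnj a = of_real ((cmod a)\<^sup>2)" by (simp add: mult_cnj_norm)
  have "0 \<le> Re (cinner (A (f - (a / q) *\<^sub>C e)) (f - (a / q) *\<^sub>C e))"
    by (rule positive_op_cinner_self[OF A])
  also have "cinner (A (f - (a / q) *\<^sub>C e)) (f - (a / q) *\<^sub>C e)
      = cinner (A f) f - (a * cnj a) / q"
    using q
    by (simp add: bounded_op_diff[OF bA] bounded_op_scaleC[OF bA] cinner_diff_left cinner_diff_right
        cinner_scaleC_left cinner_scaleC_right a' field_simps)
  also have "Re \<dots> = Re (cinner (A f) f) - (cmod a)\<^sup>2 / q"
    unfolding cm by simp
  finally have "(cmod a)\<^sup>2 / q \<le> Re (cinner (A f) f)" by simp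
  moreover have "cmod (cinner f (pivot A e)) = cmod a / sqrt q"
    using q by (simp add: pivot_def cinner_scaleR_right a_def q_def[symmetric] norm_divide norm_mult)
  ultimately show ?thesis
    using q by (simp add: power_divide)
qed

lemma positive_op_null:
  assumes A: "positive_op A" and "Re (cinner (A e) e) = 0"
  shows "A e = 0"
proof -
  have "(cmod (cinner e (pivot A f)))\<^sup>2 \<le> 0" for f
    using pivot_bound[OF A, of e f] assms(2) by simp
  then have ef: "cinner e (pivot A f) = 0" for f by simp
  have "cinner (A e) f = 0" for f
  proof (cases "Re (cinner (A f) f) = 0")
    case False
    then show ?thesis
      using ef[of f] by (simp add: pivot_def cinner_scaleR_right positive_op_hermitian[OF A])
  next
    \<comment> \<open>The pivot at \<open>f\<close> vanishes and carries no information. Testing the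
      form at e - a f instead gives -2 |a|^2, so positivity forces a = 0.\<close>
    case True
    have bA: "bounded_op A" using A by (simp add: positive_op_def)
    have e0: "cinner (A e) e = 0" and f0: "cinner (A f) f = 0"
      using positive_op_cinner_self(1)[OF A, of e] positive_op_cinner_self(1)[OF A, of f] True assms(2)
      by simp_all
    define a where "a = cinner (A e) f"
    have a': "cinner (A f) e = cnj a"
      unfolding a_def by (metis cinner_commute positive_op_hermitian[OF A])
    have "0 \<le> Re (cinner (A (e - a *\<^sub>C f)) (e - a *\<^sub>C f))"
      by (rule positive_op_cinner_self[OF A])
    also have "cinner (A (e - a *\<^sub>C f)) (e - a *\<^sub>C f) = - 2 * (a * cnj a)"
      by (simp add: bounded_op_diff[OF bA] bounded_op_scaleC[OF bA] cinner_diff_left cinner_diff_right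
          cinner_scaleC_left cinner_scaleC_right a' e0 f0 flip: a_def)
    also have "Re \<dots> = - 2 * (cmod a)\<^sup>2" unfolding mult_cnj_norm by (simp flip: of_real_power)
    finally show ?thesis by (simp add: a_def)
  qed
  then show ?thesis by (intro cinner_eqI) simp
qed

lemma positive_op_deflate:
  assumes A: "positive_op A"
  shows "positive_op (deflate A e)"
proof -
  have bA: "bounded_linear A" "\<And>c f. A (c *\<^sub>C f) = c *\<^sub>C A f"
    using A by (auto simp: positive_op_def bounded_op_def)
  have "bounded_linear (\<lambda>f. cinner f (pivot A e) *\<^sub>C pivot A e)"
  proof (rule bounded_linear_intro[where K = "norm (pivot A e) * norm (pivot A e)"])
    show "norm (cinner f (pivot A e) *\<^sub>C pivot A e) \<le> norm f * (norm (pivot A e) * norm (pivot A e))" for f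
      using mult_right_mono[OF Cauchy_Schwarz_cinner[of f "pivot A e"], of "norm (pivot A e)"]
      by (simp add: mult.assoc)
  qed (auto simp: cinner_add_left cinner_scaleC_left scaleC_add_left scaleR_scaleC)
  then have "bounded_linear (deflate A e)"
    unfolding deflate_def[abs_def] by (intro bounded_linear_sub bA)
  moreover have "deflate A e (c *\<^sub>C f) = c *\<^sub>C deflate A e f" for c f
    by (rule cinner_eqI) (simp add: deflate_def bA cinner_scaleC_left cinner_diff_left algebra_simps)
  moreover have "cinner (deflate A e f) f \<in> \<real>\<^sub>\<ge>\<^sub>0" for f
  proof -
    have "Im (cinner (deflate A e f) f) = Im (cinner (A f) f)"
      by (simp add: deflate_def cinner_diff_left cinner_scaleC_left cinner_mult_commuted flip: of_real_power)
    also have "\<dots> = 0" by (subst positive_op_cinner_self(1)[OF A]) simp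
    finally have "Im (cinner (deflate A e f) f) = 0" .
    moreover have "0 \<le> Re (cinner (deflate A e f) f)"
      unfolding quadratic_deflate using pivot_bound[OF A] by simp
    ultimately show ?thesis by (simp add: complex_nonneg_Reals_iff)
  qed
  ultimately show ?thesis by (simp add: positive_op_def bounded_op_def)
qed

text \<open>\<open>e\<close> is an arbitrary sequence. A repeated vector does no harm: it already
  lies in the kernel of the remainder, so its pivot is zero.\<close>

primrec cholesky_rest ::
  "('a::euclidean_space L2 \<Rightarrow> 'a L2) \<Rightarrow> (nat \<Rightarrow> 'a L2) \<Rightarrow> nat \<Rightarrow> 'a L2 \<Rightarrow> 'a L2" where
  "cholesky_rest S e 0 = S"
| "cholesky_rest S e (Suc n) = deflate (cholesky_rest S e n) (e n)"

text \<open>By the second claim the kernels of successive remainders increase, so a later step never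
  undoes an earlier one.\<close>

lemma deflate_kills:
  assumes A: "positive_op A"
  shows "deflate A e e = 0" and "A f = 0 \<Longrightarrow> deflate A e f = 0"
proof -
  show "deflate A e e = 0"
  proof (cases "Re (cinner (A e) e) = 0")
    case True
    then show ?thesis using positive_op_null[OF A True] by (simp add: deflate_def pivot_def)
  next
    case False
    define q where "q = Re (cinner (A e) e)"
    have q: "q > 0" "cinner e (A e) = of_real q"
      using False positive_op_cinner_self[OF A, of e] by (auto simp: q_def positive_op_hermitian[OF A, symmetric])
    then show ?thesis
      by (simp add: deflate_def pivot_def cinner_scaleC_right scaleR_scaleC flip: q_def of_real_mult)
  qed
  assume "A f = 0"
  then have "cinner f (A e) = 0" by (simp flip: positive_op_hermitian[OF A])
  then show "deflate A e f = 0"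
    using \<open>A f = 0\<close> by (simp add: deflate_def pivot_def cinner_scaleR_right)
qed

lemma cholesky_rest_positive: "positive_op S \<Longrightarrow> positive_op (cholesky_rest S e n)"
  by (induction n) (simp_all add: positive_op_deflate)

lemma cholesky_rest_quadratic:
  "Re (cinner (S f) f) = (\<Sum>k<n. (cmod (cinner f (pivot (cholesky_rest S e k) (e k))))\<^sup>2)
    + Re (cinner (cholesky_rest S e n f) f)"
  by (induction n) (simp_all add: quadratic_deflate)

lemma cholesky_rest_kills:
  assumes "positive_op S" "k < n"
  shows "cholesky_rest S e n (e k) = 0"
  using \<open>k < n\<close>
proof (induction n)
  case (Suc n)
  note pos = cholesky_rest_positive[OF assms(1), of e n]
  show ?case using Suc deflate_kills[OF pos] by (cases "k = n") auto
qed simp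

text \<open>The Cholesky factorization of a positive operator along an orthonormal basis needs neither
  square roots of operators nor a spectral theorem.\<close>

lemma positive_op_decomposition:
  assumes S: "positive_op S" and E: "onb E"
    and e: "\<And>b. b \<in> E \<Longrightarrow> S b \<noteq> 0 \<Longrightarrow> b \<in> range e"
  shows "(\<lambda>n. (cmod (cinner f (pivot (cholesky_rest S e n) (e n))))\<^sup>2) sums Re (cinner (S f) f)"
proof -
  let ?R = "cholesky_rest S e"
  let ?q = "\<lambda>n f. Re (cinner (?R n f) f)"
  have pos: "positive_op (?R n)" for n by (rule cholesky_rest_positive[OF S])
  then have bop: "bounded_op (?R n)" for n by (simp add: positive_op_def)
  have le: "?q n f \<le> Re (cinner (S f) f)" for n f
    unfolding cholesky_rest_quadratic[of S f e n] by (simp add: sum_nonneg)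
  \<comment> \<open>Basis vectors missed by \<open>e\<close> satisfy S b = 0. As quadratic forms the
    remainders are dominated by \<open>S\<close>, so they kill such \<open>b\<close> as
    well.\<close>
  have kill: "\<exists>N. \<forall>n\<ge>N. ?R n b = 0" if b: "b \<in> E" for b
  proof (cases "S b = 0")
    case True
    then have "?q n b = 0" for n
      using le[of n b] positive_op_cinner_self(2)[OF pos, of n b] by simp
    then show ?thesis using positive_op_null[OF pos] by blast
  next
    case False
    then obtain k where "b = e k" using e[OF b] by auto
    then have "?R n b = 0" if "n \<ge> Suc k" for n
      using cholesky_rest_kills[OF S, of k n e] that by simp
    then show ?thesis by blast
  qed
  have killspan: "\<exists>N. \<forall>n\<ge>N. ?R n y = 0" if "y \<in> span {c *\<^sub>C e | c e. e \<in> E}" for y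
    using that
  proof (induction rule: span_induct_alt)
    case base
    have "?R n 0 = 0" for n using bounded_op_diff[OF bop, of n 0 0] by simp
    then show ?case by blast
  next
    case (step r x y)
    then obtain c b where x: "x = c *\<^sub>C b" "b \<in> E" by blast
    obtain N where N: "\<And>n. n \<ge> N \<Longrightarrow> ?R n y = 0" using step by blast
    obtain M where M: "\<And>n. n \<ge> M \<Longrightarrow> ?R n b = 0" using kill[OF x(2)] by blast
    have "?R n (r *\<^sub>R x + y) = 0" if "n \<ge> max M N" for n
      using M[of n] N[of n] that
      by (simp add: bounded_op_add[OF bop] bounded_op_scaleC[OF bop] x scaleR_scaleC)
    then show ?case by blast
  qed
  obtain K where K: "\<And>f. norm (S f) \<le> norm f * K" "K > 0"
    using S bounded_linear.pos_bounded unfolding positive_op_def bounded_op_def by metis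
  have "(\<lambda>n. ?q n f) \<longlonglongrightarrow> 0"
  proof (rule LIMSEQ_I)
    fix r :: real assume "0 < r"
    define d where "d = sqrt (r / K)"
    have "d > 0" using \<open>0 < r\<close> K by (simp add: d_def)
    then obtain y where y: "y \<in> span {c *\<^sub>C e | c e. e \<in> E}" "dist y f < d"
      using closure_approachable[of f "span {c *\<^sub>C e | c e. e \<in> E}"] onb_span_dense[OF E] by auto
    obtain N where N: "\<And>n. n \<ge> N \<Longrightarrow> ?R n y = 0" using killspan[OF y(1)] by blast
    have "?q n f < r" if "n \<ge> N" for n
    proof -
      \<comment> \<open>Once the remainder kills \<open>y\<close>, its form does not distinguish f
        from f - y. The latter is short, and \<open>S\<close> bounds all remainders
        uniformly.\<close>
      have "cinner (?R n (f - y)) (f - y) = cinner (?R n f) f"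
        using N[OF that] bounded_op_diff[OF bop, of n f y] positive_op_hermitian[OF pos, of n f y]
        by (simp add: cinner_diff_right)
      then have "?q n f \<le> Re (cinner (S (f - y)) (f - y))" using le[of n "f - y"] by simp
      also have "\<dots> \<le> norm (S (f - y)) * norm (f - y)"
        using complex_Re_le_cmod Cauchy_Schwarz_cinner order_trans by blast
      also have "\<dots> \<le> norm (f - y) * K * norm (f - y)"
        by (intro mult_right_mono K) simp
      also have "\<dots> = (norm (f - y))\<^sup>2 * K" by (simp add: power2_eq_square)
      also have "\<dots> < d\<^sup>2 * K"
        using y(2) K by (intro mult_strict_right_mono power_strict_mono) (auto simp: dist_norm norm_minus_commute)
      also have "\<dots> = r" using K \<open>0 < r\<close> by (simp add: d_def)
      finally show ?thesis .
    qed
    then show "\<exists>N. \<forall>n\<ge>N. norm (?q n f - 0) < r"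
      using positive_op_cinner_self(2)[OF pos] by (intro exI[of _ N]) auto
  qed
  then have "(\<lambda>n. Re (cinner (S f) f) - ?q n f) \<longlonglongrightarrow> Re (cinner (S f) f) - 0"
    by (intro tendsto_intros)
  moreover have "(\<Sum>k<n. (cmod (cinner f (pivot (?R k) (e k))))\<^sup>2) = Re (cinner (S f) f) - ?q n f" for n
    using cholesky_rest_quadratic[of S f e n] by simp
  ultimately show ?thesis unfolding sums_def by simp
qed

text \<open>A finite trace leaves only countably many basis vectors with <Se, e> nonzero, and
  elimination along an enumeration of these exhausts \<open>S\<close>.\<close>

lemma density_op_decomposition:
  assumes S: "density_op S"
  obtains v where "\<And>f. (\<lambda>n. (cmod (cinner f (v n)))\<^sup>2) sums Re (cinner (S f) f)"
    and "(\<lambda>n. (norm (v n))\<^sup>2) sums 1"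
proof -
  have pos: "positive_op S" using S by (simp add: density_op_def)
  define E where "E = (SOME E :: 'a L2 set. onb E)"
  have E: "onb E" unfolding E_def using onb_exists by (rule someI_ex)
  define q where "q f = Re (cinner (S f) f)" for f
  have qc: "cinner (S f) f = of_real (q f)" for f
    unfolding q_def by (rule positive_op_cinner_self[OF pos])
  have "(\<Sum>\<^sub>\<infinity>e\<in>E. cinner (S e) e) = 1"
    using S by (simp add: density_op_def op_trace_def E_def)
  \<comment> \<open>A sum that does not exist has the default value 0, so the value 1 entails
    convergence.\<close>
  then have "((\<lambda>e. cinner (S e) e) has_sum 1) E"
    by (metis has_sum_infsum infsum_not_exists zero_neq_one)
  then have hs: "(q has_sum 1) E"
    unfolding qc by (metis has_sum_of_real_iff of_real_1)
  have "countable {e \<in> E. q e \<noteq> 0}"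
    using hs summable_countable_real has_sum_imp_summable by blast
  moreover have "{e \<in> E. q e \<noteq> 0} \<noteq> {}"
  proof
    assume "{e \<in> E. q e \<noteq> 0} = {}"
    then have "(q has_sum 0) E" by (intro has_sum_0) auto
    with hs show False using has_sum_unique by fastforce
  qed
  ultimately obtain e :: "nat \<Rightarrow> 'a L2" where e: "{e \<in> E. q e \<noteq> 0} = range e"
    by (metis range_from_nat_into)
  define v where "v n = pivot (cholesky_rest S e n) (e n)" for n
  have "b \<in> range e" if "b \<in> E" "S b \<noteq> 0" for b
  proof -
    have "q b \<noteq> 0" using positive_op_null[OF pos, of b] that(2) unfolding q_def by blast
    then have "b \<in> {e \<in> E. q e \<noteq> 0}" using that(1) by simp
    then show ?thesis unfolding e .
  qed
  from positive_op_decomposition[OF pos E this]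
  have sums: "(\<lambda>n. (cmod (cinner f (v n)))\<^sup>2) sums q f" for f
    by (simp add: v_def q_def)
  \<comment> \<open>The double sum of |<b, v_n>|^2 is computed in both orders: over n first it gives
    the trace of \<open>S\<close>, over b first it gives sum_n |v_n|^2 by Parseval.\<close>
  have Sig: "((\<lambda>(b, n). (cmod (cinner b (v n)))\<^sup>2) has_sum 1) (E \<times> UNIV)"
  proof (rule has_sum_SigmaI)
    show fiber: "((\<lambda>n. case (b, n) of (b, n) \<Rightarrow> (cmod (cinner b (v n)))\<^sup>2) has_sum q b) UNIV" for b
      using sums[of b] by (simp add: sums_nonneg_imp_has_sum)
    show "(\<lambda>(b, n). (cmod (cinner b (v n)))\<^sup>2) summable_on E \<times> UNIV"
      by (rule summable_on_SigmaI[where g = q]) (use fiber hs has_sum_imp_summable in auto)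
  qed (fact hs)
  have "((\<lambda>n. (norm (v n))\<^sup>2) has_sum 1) UNIV"
  proof (rule has_sum_SigmaD)
    show "((\<lambda>(n, b). (cmod (cinner b (v n)))\<^sup>2) has_sum 1) (UNIV \<times> E)"
      using Sig unfolding has_sum_swap[of _ _ E] by simp
    show "((\<lambda>b. case (n, b) of (n, b) \<Rightarrow> (cmod (cinner b (v n)))\<^sup>2) has_sum (norm (v n))\<^sup>2) E" for n
      using Parseval_norm_has_sum[OF E, of "v n"] by (simp add: cmod_cinner_commute[of _ "v n"])
  qed
  then have "(\<lambda>n. (norm (v n))\<^sup>2) sums 1" by (rule has_sum_imp_sums)
  then show thesis using that[of v] sums by (simp add: q_def)
qed

section \<open>Time-frequency shifts\<close>

abbreviation character :: "'a::euclidean_space \<Rightarrow> 'a \<Rightarrow> complex" where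
  "character \<omega> t \<equiv> exp (2 * of_real pi * \<i> * of_real (\<omega> \<bullet> t))"

lemma cmod_character [simp]: "cmod (character \<omega> t) = 1"
  by (simp add: norm_exp_eq_Re)

lemma measurable_character [measurable (raw)]:
  assumes [measurable]: "f \<in> borel_measurable M" "g \<in> borel_measurable M"
  shows "(\<lambda>x. character (f x) (g x)) \<in> borel_measurable M"
proof -
  have "continuous_on UNIV (\<lambda>r. exp (2 * complex_of_real pi * \<i> * of_real r))"
    by (intro continuous_intros)
  then have [measurable]: "(\<lambda>r. exp (2 * complex_of_real pi * \<i> * of_real r)) \<in> borel_measurable borel"
    by (rule borel_measurable_continuous_onI)
  show ?thesis
    by (rule measurable_compose[of "\<lambda>x. f x \<bullet> g x"]) measurable
qed

lemma cnj_character: "cnj (character \<omega> t) = character \<omega> (- t)"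
  by (simp add: exp_cnj)

lemma character_add: "character \<omega> (s + t) = character \<omega> s * character \<omega> t"
  by (simp add: inner_add_right algebra_simps flip: exp_add)

lemma character_add_left: "character (\<omega> + \<eta>) t = character \<omega> t * character \<eta> t"
  by (simp add: inner_add_left algebra_simps flip: exp_add)

lemma lborel_integral_affine:
  fixes u :: "'a::euclidean_space \<Rightarrow> 'b::{banach, second_countable_topology}"
  assumes [measurable]: "u \<in> borel_measurable borel" and "\<bar>c\<bar> = 1"
  shows "(LINT t|lborel. u (a + c *\<^sub>R t)) = (LINT t|lborel. u t)"
proof -
  have "(LINT t|lborel. u t) = (LINT t|distr lborel borel (\<lambda>t. a + c *\<^sub>R t). u t)"
    by (simp add: lborel_distr_affine[OF assms(2)])
  also have "\<dots> = (LINT t|lborel. u (a + c *\<^sub>R t))"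
    by (rule integral_distr) auto
  finally show ?thesis by simp
qed

lemma lborel_nn_integral_affine:
  fixes u :: "'a::euclidean_space \<Rightarrow> ennreal"
  assumes [measurable]: "u \<in> borel_measurable borel" and "\<bar>c\<bar> = 1"
  shows "(\<integral>\<^sup>+t. u (a + c *\<^sub>R t) \<partial>lborel) = (\<integral>\<^sup>+t. u t \<partial>lborel)"
proof -
  have "(\<integral>\<^sup>+t. u t \<partial>lborel) = (\<integral>\<^sup>+t. u t \<partial>distr lborel borel (\<lambda>t. a + c *\<^sub>R t))"
    by (simp add: lborel_distr_affine[OF assms(2)])
  also have "\<dots> = (\<integral>\<^sup>+t. u (a + c *\<^sub>R t) \<partial>lborel)"
    by (rule nn_integral_distr) auto
  finally show ?thesis by simp
qed

lemma square_integrable_tf_shift: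
  assumes "square_integrable u"
  shows "square_integrable (\<lambda>t. character \<omega> t * u (t - x))"
  using rel_funD[OF rel_funD[OF tf_shift.rsp refl[of "(x, \<omega>)"]], of u u] assms
  by (simp add: l2rel_def)

lemma square_integrable_affine:
  assumes "square_integrable u" "\<bar>c\<bar> = 1"
  shows "square_integrable (\<lambda>t. u (a + c *\<^sub>R t))"
  using l2rel_affine[OF assms(2), of u u a] assms(1) by (simp add: l2rel_def)

lemma l2relI:
  assumes "square_integrable f" "\<And>t. f t = g t"
  shows "l2rel f g"
proof -
  have "f = g" using assms(2) by (rule ext)
  then show ?thesis using assms(1) by (simp add: l2rel_def)
qed

lemma tf_shift_add: "tf_shift z (f + g) = tf_shift z f + tf_shift z g"
proof (cases z)
  case (Pair x \<omega>)
  show ?thesis unfolding Pair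
  proof (transfer, simp only: prod.case, rule l2relI)
    fix x \<omega> :: 'a and f g :: "'a \<Rightarrow> complex"
    assume "l2rel f f" "l2rel g g"
    then show "square_integrable (\<lambda>t. character \<omega> t * (f (t - x) + g (t - x)))"
      using square_integrable_tf_shift[of "\<lambda>t. f t + g t" \<omega> x] square_integrable_add
      by (auto simp: l2rel_def)
  qed (rule distrib_left)
qed

lemma tf_shift_scaleC: "tf_shift z (c *\<^sub>C f) = c *\<^sub>C tf_shift z f"
proof (cases z)
  case (Pair x \<omega>)
  show ?thesis unfolding Pair
  proof (transfer, simp only: prod.case, rule l2relI)
    fix x \<omega> :: 'a and c and f :: "'a \<Rightarrow> complex"
    assume "l2rel f f"
    then show "square_integrable (\<lambda>t. character \<omega> t * (c * f (t - x)))"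
      using square_integrable_tf_shift[of "\<lambda>t. c * f t" \<omega> x] square_integrable_mult
      by (auto simp: l2rel_def)
  qed (rule mult.left_commute)
qed

lemma tf_shift_zero: "tf_shift (0, 0) f = f"
  by transfer (simp add: l2rel_def)

text \<open>The Weyl relation: moving the modulation past the translation leaves a phase, which
  drops out of every modulus taken later.\<close>

lemma tf_shift_tf_shift:
  "tf_shift (x, \<omega>) (tf_shift (y, \<eta>) f) = character \<eta> (- x) *\<^sub>C tf_shift (x + y, \<omega> + \<eta>) f"
proof (transfer, simp only: prod.case, rule l2relI)
  fix x \<omega> y \<eta> :: 'a and f :: "'a \<Rightarrow> complex"
  assume "l2rel f f"
  then show "square_integrable (\<lambda>t. character \<omega> t * (character \<eta> (t - x) * f (t - x - y)))"
    by (intro square_integrable_tf_shift) (simp add: l2rel_def)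
  show "character \<omega> t * (character \<eta> (t - x) * f (t - x - y))
      = character \<eta> (- x) * (character (\<omega> + \<eta>) t * f (t - (x + y)))" for t
    using character_add[of \<eta> t "- x"] character_add_left[of \<omega> \<eta> t]
    by (simp add: diff_diff_eq mult_ac)
qed

lemma cinner_tf_shift_tf_shift: "cinner (tf_shift z f) (tf_shift z g) = cinner f g"
proof (cases z)
  case (Pair x \<omega>)
  show ?thesis unfolding Pair
  proof (transfer, simp only: prod.case)
    fix x \<omega> :: 'a and f g :: "'a \<Rightarrow> complex"
    assume "l2rel f f" "l2rel g g"
    then have [measurable]: "f \<in> borel_measurable borel" "g \<in> borel_measurable borel"
      by (auto simp: l2rel_def square_integrable_def)
    have "character \<omega> t * f (t - x) * cnj (character \<omega> t * g (t - x))
        = f (- x + 1 *\<^sub>R t) * cnj (g (- x + 1 *\<^sub>R t))" for t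
    proof -
      have "character \<omega> t * f (t - x) * cnj (character \<omega> t * g (t - x))
        = (character \<omega> t * cnj (character \<omega> t)) * (f (t - x) * cnj (g (t - x)))"
        by (simp only: complex_cnj_mult mult_ac)
      also have "character \<omega> t * cnj (character \<omega> t) = 1"
        by (simp only: mult_cnj_norm cmod_character) simp
      finally show ?thesis by simp
    qed
    then show "(LINT t|lborel. character \<omega> t * f (t - x) * cnj (character \<omega> t * g (t - x)))
        = (LINT t|lborel. f t * cnj (g t))"
      by (simp only:) (rule lborel_integral_affine, auto)
  qed
qed

lemma norm_tf_shift [simp]: "norm (tf_shift z f) = norm f"
proof -
  have "complex_of_real ((norm (tf_shift z f))\<^sup>2) = of_real ((norm f)\<^sup>2)"
    unfolding cinner_self[symmetric] by (rule cinner_tf_shift_tf_shift)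
  then show ?thesis by (simp only: of_real_eq_iff) simp
qed

text \<open>The phase undoes the one in \<open>tf_shift_tf_shift\<close>, which makes this the
  inverse of the isometry \<open>tf_shift z\<close> and hence its adjoint.\<close>

definition tf_adj :: "'a::euclidean_space \<times> 'a \<Rightarrow> 'a L2 \<Rightarrow> 'a L2" where
  "tf_adj z g = character (snd z) (- fst z) *\<^sub>C tf_shift (- z) g"

lemma tf_shift_tf_adj: "tf_shift z (tf_adj z g) = g"
proof (cases z)
  case (Pair x \<omega>)
  have "character \<omega> (- x) * character (- \<omega>) (- x) = 1"
    by (simp flip: exp_add)
  then show ?thesis
    unfolding Pair tf_adj_def uminus_Pair fst_conv snd_conv tf_shift_scaleC tf_shift_tf_shift
    by (simp add: tf_shift_zero)
qed

lemma cinner_tf_shift_left: "cinner (tf_shift z f) g = cinner f (tf_adj z g)"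
  by (metis cinner_tf_shift_tf_shift tf_shift_tf_adj)

lemma cinner_tf_shift_right: "cinner f (tf_shift z g) = cinner (tf_adj z f) g"
  by (metis cinner_tf_shift_tf_shift tf_shift_tf_adj)

lemma adj_tf_shift: "adj (tf_shift z) = tf_adj z"
  by (rule adj_eqI) (rule cinner_tf_shift_left)

lemma tf_adj_add: "tf_adj z (f + g) = tf_adj z f + tf_adj z g"
  by (simp add: tf_adj_def tf_shift_add scaleC_add_right)

lemma tf_adj_scaleC: "tf_adj z (c *\<^sub>C f) = c *\<^sub>C tf_adj z f"
  by (simp add: tf_adj_def tf_shift_scaleC mult.commute)

lemma norm_tf_adj [simp]: "norm (tf_adj z f) = norm f"
  by (simp add: tf_adj_def)

lemma cmod_cinner_tf_shift_minus:
  "cmod (cinner (tf_shift (- z) f) g) = cmod (cinner f (tf_shift z g))"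
  unfolding cinner_tf_shift_right tf_adj_def cinner_scaleC_left
  by (simp add: norm_mult)

lemma cmod_cinner_tf_shift_tf_shift:
  "cmod (cinner (tf_shift z f) (tf_shift w g)) = cmod (cinner f (tf_shift (w - z) g))"
proof -
  obtain x \<omega> y \<eta> where z: "z = (x, \<omega>)" and w: "w = (y, \<eta>)" by fastforce
  have "tf_shift (- z) (tf_shift w g) = character \<eta> x *\<^sub>C tf_shift (w - z) g"
    by (simp add: z w tf_shift_tf_shift)
  then show ?thesis
    unfolding cinner_tf_shift_left tf_adj_def cinner_scaleC_right
    by (simp add: cinner_scaleC_right norm_mult)
qed

lemma parity_scaleC: "parity (c *\<^sub>C f) = c *\<^sub>C parity f"
proof (transfer, rule l2relI)
  fix c and f :: "'a \<Rightarrow> complex"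
  assume "l2rel f f"
  then have "square_integrable (\<lambda>t. f (0 + (- 1) *\<^sub>R t))"
    by (intro square_integrable_affine) (auto simp: l2rel_def)
  then show "square_integrable (\<lambda>t. c * f (- t))"
    by (intro square_integrable_mult) simp
qed simp

lemma cinner_parity_left: "cinner (parity f) g = cinner f (parity g)"
proof transfer
  fix f g :: "'a \<Rightarrow> complex"
  assume "l2rel f f" "l2rel g g"
  then have [measurable]: "f \<in> borel_measurable borel" "g \<in> borel_measurable borel"
    by (auto simp: l2rel_def square_integrable_def)
  show "(LINT t|lborel. f (- t) * cnj (g t)) = (LINT t|lborel. f t * cnj (g (- t)))"
    using lborel_integral_affine[of "\<lambda>t. f t * cnj (g (- t))" "-1" 0] by simp
qed

lemma parity_tf_shift_parity: "parity (tf_shift z (parity f)) = tf_shift (- z) f"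
proof (cases z)
  case (Pair x \<omega>)
  show ?thesis unfolding Pair uminus_Pair
  proof (transfer, simp only: prod.case, rule l2relI)
    fix x \<omega> :: 'a and f :: "'a \<Rightarrow> complex"
    assume "l2rel f f"
    then have "square_integrable (\<lambda>t. character (- \<omega>) t * f (t - (- x)))"
      by (intro square_integrable_tf_shift) (auto simp: l2rel_def)
    then show "square_integrable (\<lambda>t. character \<omega> (- t) * f (- (- t - x)))"
      by (simp add: add.commute)
  qed (simp add: add.commute)
qed

lemma cinner_op_shift:
  "cinner (op_shift z S f) g = cinner (S (tf_adj z f)) (tf_adj z g)"
  by (simp add: op_shift_def adj_tf_shift cinner_tf_shift_left)

text \<open>The parities in \<open>op_check S\<close> and in the checked rank-one operator combine
  to P pi(z) P = pi(-z), and the trace of the resulting rank-one operator is an inner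
  product.\<close>

lemma cohen_eq:
  assumes S: "bounded_op S"
  shows "cohen S f z = cinner (S (tf_shift (- z) f)) (tf_shift (- z) f)"
proof -
  let ?g = "tf_shift z (parity f)"
  have "op_shift z (op_check (rank_one f f)) = rank_one ?g ?g"
    by (rule ext)
       (simp add: op_shift_def op_check_def rank_one_def adj_tf_shift parity_scaleC tf_shift_scaleC
         cinner_parity_left flip: cinner_tf_shift_right)
  then have "op_check S \<circ> op_shift z (op_check (rank_one f f)) = rank_one (op_check S ?g) ?g"
    by (auto simp: rank_one_def op_check_def parity_scaleC bounded_op_scaleC[OF S])
  then show ?thesis
    unfolding cohen_def op_op_conv_def
    by (simp add: op_trace_rank_one) (simp add: op_check_def cinner_parity_left parity_tf_shift_parity)
qed

text \<open>The short-time Fourier transform of \<open>f\<close> with window \<open>g\<close>.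
  Written through representatives it is a Fourier transform in the frequency, which gives
  measurability in (x, omega) and the link to Moyal's identity.\<close>

lemma cinner_tf_shift_integral:
  "cinner f (tf_shift (x, \<omega>) g)
    = (LINT t|lborel. rep_L2 f t * cnj (rep_L2 g (t - x)) * character \<omega> (- t))"
proof -
  have "tf_shift (x, \<omega>) g = abs_L2 (\<lambda>t. character \<omega> t * rep_L2 g (t - x))"
    using tf_shift.abs_eq[of "rep_L2 g" "(x, \<omega>)"] square_integrable_rep[of g]
    by (simp add: abs_rep l2rel_def)
  then have "cinner f (tf_shift (x, \<omega>) g)
      = cinner (abs_L2 (rep_L2 f)) (abs_L2 (\<lambda>t. character \<omega> t * rep_L2 g (t - x)))"
    by (simp add: abs_rep)
  also have "\<dots> = (LINT t|lborel. rep_L2 f t * cnj (character \<omega> t * rep_L2 g (t - x)))"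
    by (intro cinner_abs square_integrable_rep square_integrable_tf_shift)
  finally show ?thesis
    by (simp add: exp_cnj mult_ac)
qed

lemma measurable_cinner_tf_shift [measurable]:
  "(\<lambda>z. cinner f (tf_shift z g)) \<in> borel_measurable borel"
proof -
  have "(\<lambda>z. cinner f (tf_shift (fst z, snd z) g)) \<in> borel_measurable borel"
    unfolding cinner_tf_shift_integral
    by (intro lborel.borel_measurable_lebesgue_integral) (unfold borel_prod[symmetric], measurable)
  then show ?thesis by simp
qed

section \<open>Continuity of translations\<close>

lemma lborel_integrable_affine:
  fixes u :: "'a::euclidean_space \<Rightarrow> 'b::{banach, second_countable_topology}"
  assumes "integrable lborel u" "\<bar>c\<bar> = 1"
  shows "integrable lborel (\<lambda>t. u (a + c *\<^sub>R t))"
proof -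
  have "integrable (distr lborel borel (\<lambda>t. a + c *\<^sub>R t)) u"
    using assms(1) by (simp add: lborel_distr_affine[OF assms(2)])
  then show ?thesis by (subst (asm) integrable_distr_eq) (use assms(1) in auto)
qed

lemma lborel_integrable_shift:
  fixes u :: "'a::euclidean_space \<Rightarrow> 'b::{banach, second_countable_topology}"
  shows "integrable lborel u \<Longrightarrow> integrable lborel (\<lambda>t. u (t - a))"
  using lborel_integrable_affine[of u 1 "- a"] by simp

lemma lborel_integral_shift:
  fixes u :: "'a::euclidean_space \<Rightarrow> 'b::{banach, second_countable_topology}"
  shows "u \<in> borel_measurable borel \<Longrightarrow> (LINT t|lborel. u (t - a)) = (LINT t|lborel. u t)"
  using lborel_integral_affine[of u 1 "- a"] by simp

lemma lborel_nn_integral_scale: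
  fixes u :: "'a::euclidean_space \<Rightarrow> ennreal"
  assumes [measurable]: "u \<in> borel_measurable borel" and "c > 0"
  shows "(\<integral>\<^sup>+t. u t \<partial>lborel) = ennreal (c ^ DIM('a)) * (\<integral>\<^sup>+t. u (c *\<^sub>R t) \<partial>lborel)"
proof -
  have "(\<integral>\<^sup>+t. u t \<partial>lborel)
      = (\<integral>\<^sup>+t. u t \<partial>density (distr lborel borel (\<lambda>t. 0 + c *\<^sub>R t)) (\<lambda>_. \<bar>c\<bar> ^ DIM('a)))"
    using lborel_affine[of c "0 :: 'a"] assms(2) by simp
  also have "\<dots> = (\<integral>\<^sup>+t. ennreal (c ^ DIM('a)) * u (c *\<^sub>R t) \<partial>lborel)"
    using assms(2) by (simp add: nn_integral_density nn_integral_distr ennreal_power)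
  finally show ?thesis by (simp add: nn_integral_cmult)
qed

lemma lborel_integrable_scale:
  fixes u :: "'a::euclidean_space \<Rightarrow> 'b::{banach, second_countable_topology}"
  assumes u: "integrable lborel u" and "c > 0"
  shows "integrable lborel (\<lambda>t. u (c *\<^sub>R t))"
proof (rule integrableI_bounded)
  have [measurable]: "u \<in> borel_measurable borel" using u by simp
  show "(\<lambda>t. u (c *\<^sub>R t)) \<in> borel_measurable lborel" by measurable
  have "ennreal (c ^ DIM('a)) * (\<integral>\<^sup>+t. norm (u (c *\<^sub>R t)) \<partial>lborel) < \<infinity>"
    using u \<open>c > 0\<close> unfolding integrable_iff_bounded
    by (subst lborel_nn_integral_scale[symmetric]) auto
  then show "(\<integral>\<^sup>+t. norm (u (c *\<^sub>R t)) \<partial>lborel) < \<infinity>"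
    using \<open>c > 0\<close> by (auto simp: ennreal_mult_less_top)
qed

lemma lborel_integral_scale:
  fixes u :: "'a::euclidean_space \<Rightarrow> 'b::{banach, second_countable_topology}"
  assumes [measurable]: "u \<in> borel_measurable borel" and "c > 0"
  shows "(LINT t|lborel. u t) = c ^ DIM('a) *\<^sub>R (LINT t|lborel. u (c *\<^sub>R t))"
proof -
  have "(LINT t|lborel. u t)
      = (LINT t|density (distr lborel borel (\<lambda>t. 0 + c *\<^sub>R t)) (\<lambda>_. \<bar>c\<bar> ^ DIM('a)). u t)"
    using lborel_affine[of c "0 :: 'a"] assms(2) by simp
  also have "\<dots> = (LINT t|lborel. c ^ DIM('a) *\<^sub>R u (c *\<^sub>R t))"
    using assms(2) by (simp add: integral_density integral_distr ennreal_power)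
  finally show ?thesis by simp
qed

lemma L1_translation_approx:
  fixes u w :: "'a::euclidean_space \<Rightarrow> 'b::{banach, second_countable_topology}"
  assumes u: "integrable lborel u" and w: "integrable lborel w"
  shows "(LINT t|lborel. norm (u (t - a) - u t))
    \<le> 2 * (LINT t|lborel. norm (u t - w t)) + (LINT t|lborel. norm (w (t - a) - w t))"
proof -
  have uw: "integrable lborel (\<lambda>t. u t - w t)" using u w by simp
  note int = u w uw lborel_integrable_shift[OF u, of a] lborel_integrable_shift[OF w, of a]
    lborel_integrable_shift[OF uw, of a]
  have "(LINT t|lborel. norm (u (t - a) - u t))
    \<le> (LINT t|lborel. norm (u (t - a) - w (t - a)) + norm (u t - w t) + norm (w (t - a) - w t))"
  proof (rule integral_mono)
    fix t
    have "u (t - a) - u t = (u (t - a) - w (t - a)) - (u t - w t) + (w (t - a) - w t)" by simp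
    also have "norm \<dots> \<le> norm (u (t - a) - w (t - a)) + norm (u t - w t) + norm (w (t - a) - w t)"
      by (intro order_trans[OF norm_triangle_ineq] add_right_mono norm_triangle_ineq4)
    finally show "norm (u (t - a) - u t) \<le> \<dots>" .
  qed (intro integrable_norm Bochner_Integration.integrable_add Bochner_Integration.integrable_diff int)+
  also have "\<dots> = (LINT t|lborel. norm (u (t - a) - w (t - a))) + (LINT t|lborel. norm (u t - w t))
      + (LINT t|lborel. norm (w (t - a) - w t))"
    using int by simp
  also have "(LINT t|lborel. norm (u (t - a) - w (t - a))) = (LINT t|lborel. norm (u t - w t))"
    using u w by (intro lborel_integral_shift[of "\<lambda>t. norm (u t - w t)"]) simp
  finally show ?thesis by simp
qed

text \<open>The functions on which translation along \<open>a\<close> is continuous form a closed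
  set in L^1. Translation preserves the norm, so the approximation error counts twice: 2 (r / 4) + r
  / 2 = r.\<close>

lemma L1_translation_continuous_limit:
  fixes u :: "'a::euclidean_space \<Rightarrow> 'b::{banach, second_countable_topology}"
  assumes u: "integrable lborel u"
    and approx: "\<And>e. e > 0 \<Longrightarrow> \<exists>w. integrable lborel w \<and> (LINT t|lborel. norm (u t - w t)) < e
      \<and> (\<lambda>n. LINT t|lborel. norm (w (t - a n) - w t)) \<longlonglongrightarrow> 0"
  shows "(\<lambda>n. LINT t|lborel. norm (u (t - a n) - u t)) \<longlonglongrightarrow> 0"
proof (rule LIMSEQ_I)
  fix r :: real assume "0 < r"
  then obtain w where w: "integrable lborel w" "(LINT t|lborel. norm (u t - w t)) < r / 4"
    and lim: "(\<lambda>n. LINT t|lborel. norm (w (t - a n) - w t)) \<longlonglongrightarrow> 0"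
    using approx[of "r / 4"] by auto
  obtain N where N: "\<And>n. n \<ge> N \<Longrightarrow> norm (LINT t|lborel. norm (w (t - a n) - w t)) < r / 2"
    using LIMSEQ_D[OF lim, of "r / 2"] \<open>0 < r\<close> by auto
  have "norm (LINT t|lborel. norm (u (t - a n) - u t)) < r" if "n \<ge> N" for n
    using L1_translation_approx[OF u w(1), of "a n"] w(2) N[OF that] by simp
  then show "\<exists>N. \<forall>n\<ge>N. norm ((LINT t|lborel. norm (u (t - a n) - u t)) - 0) < r"
    by auto
qed

text \<open>Indicators of open sets of finite measure come first, where small shifts keep a point
  inside. Outer regularity passes to measurable sets, and induction over integrable functions does
  the rest.\<close>

lemma L1_translation_continuous:
  fixes u :: "'a::euclidean_space \<Rightarrow> 'b::{banach, second_countable_topology}"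
  assumes u: "integrable lborel u" and a: "a \<longlonglongrightarrow> 0"
  shows "(\<lambda>n. LINT t|lborel. norm (u (t - a n) - u t)) \<longlonglongrightarrow> 0"
  using u
proof (induction rule: integrable_induct)
  case (base A c)
  have op: "(\<lambda>n. LINT t|lborel. norm (indicator U (t - a n) *\<^sub>R c - indicator U t *\<^sub>R c)) \<longlonglongrightarrow> 0"
    if U: "open U" "emeasure lborel U < \<infinity>" for U
  proof -
    have iU: "integrable lborel (indicator U :: 'a \<Rightarrow> real)"
      using U by (simp add: integrable_indicator_iff borel_open)
    have [measurable]: "U \<in> sets borel" using U by auto
    have i2: "integrable lborel (\<lambda>t. indicator U t * indicator U (t - b) :: real)" for b
      by (rule Bochner_Integration.integrable_bound[OF iU]) (auto simp: indicator_def)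
    \<comment> \<open>The product, unlike the shifted indicator alone, is dominated by one
      integrable function and converges at every point: a point of U stays in U under small shifts,
      and elsewhere the product is 0.\<close>
    have "(\<lambda>n. LINT t|lborel. indicator U t * indicator U (t - a n) :: real)
        \<longlonglongrightarrow> (LINT t|lborel. indicator U t)"
    proof (rule integral_dominated_convergence[OF _ _ iU])
      show "AE t in lborel. (\<lambda>n. indicator U t * indicator U (t - a n) :: real) \<longlonglongrightarrow> indicator U t"
      proof (rule AE_I2)
        fix t
        show "(\<lambda>n. indicator U t * indicator U (t - a n) :: real) \<longlonglongrightarrow> indicator U t"
        proof (cases "t \<in> U")
          case True
          have "(\<lambda>n. t - a n) \<longlonglongrightarrow> t - 0" by (intro tendsto_intros a)
          then have "eventually (\<lambda>n. t - a n \<in> U) sequentially"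
            using topological_tendstoD[OF _ U(1)] True by simp
          then show ?thesis
            by (intro tendsto_eventually) (auto elim!: eventually_mono simp: True)
        qed simp
      qed
    qed (auto simp: indicator_def)
    then have "(\<lambda>n. 2 * norm c * ((LINT t|lborel. indicator U t)
          - (LINT t|lborel. indicator U t * indicator U (t - a n) :: real)))
        \<longlonglongrightarrow> 2 * norm c * ((LINT t|lborel. indicator U t) - (LINT t|lborel. indicator U t))"
      by (intro tendsto_intros)
    moreover have "(LINT t|lborel. norm (indicator U (t - b) *\<^sub>R c - indicator U t *\<^sub>R c))
        = 2 * norm c * ((LINT t|lborel. indicator U t)
          - (LINT t|lborel. indicator U t * indicator U (t - b) :: real))" for b
    proof -
      have "(LINT t|lborel. norm (indicator U (t - b) *\<^sub>R c - indicator U t *\<^sub>R c))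
        = (LINT t|lborel. norm c * (indicator U (t - b) + indicator U t
            - 2 * (indicator U t * indicator U (t - b))))"
        by (intro Bochner_Integration.integral_cong) (auto simp: indicator_def)
      also have "\<dots> = norm c * ((LINT t|lborel. indicator U (t - b)) + (LINT t|lborel. indicator U t)
            - 2 * (LINT t|lborel. indicator U t * indicator U (t - b)))"
        using iU i2[of b] lborel_integrable_shift[OF iU, of b] by simp
      also have "(LINT t|lborel. indicator U (t - b) :: real) = (LINT t|lborel. indicator U t)"
        using lborel_integral_shift[of "indicator U :: 'a \<Rightarrow> real" b] by simp
      finally show ?thesis by simp
    qed
    ultimately show ?thesis by simp
  qed
  have iA: "integrable lborel (\<lambda>t. indicator A t *\<^sub>R c)"
    using base by (intro integrable_scaleR_left) (simp add: integrable_indicator_iff)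
  show ?case
  proof (rule L1_translation_continuous_limit[OF iA])
    fix e :: real assume "e > 0"
    \<comment> \<open>The summand 1 keeps the quotient meaningful for c = 0.\<close>
    define d where "d = e / (norm c + 1)"
    have "d > 0" using \<open>e > 0\<close> by (auto simp: d_def intro!: divide_pos_pos add_nonneg_pos)
    obtain U where U: "open U" "A \<subseteq> U" "emeasure lborel (U - A) < ennreal d"
      using outer_regular_lborel[of A d] base(1) \<open>d > 0\<close> by auto
    have sU: "U \<in> sets lborel" using U by auto
    have "emeasure lborel U = emeasure lborel A + emeasure lborel (U - A)"
      using U(2) base(1) sU plus_emeasure[of A lborel "U - A"] by (simp add: Un_absorb1)
    also have "\<dots> < \<infinity>" using base(2) U(3) by (auto simp: less_top ennreal_add_less_top intro: order.strict_trans)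
    finally have fU: "emeasure lborel U < \<infinity>" .
    have "(LINT t|lborel. norm (indicator A t *\<^sub>R c - indicator U t *\<^sub>R c))
        = (LINT t|lborel. norm c * indicator (U - A) t)"
      using U(2) by (intro Bochner_Integration.integral_cong) (auto simp: indicator_def)
    also have "\<dots> = norm c * measure lborel (U - A)" using sU base(1) by simp
    also have "\<dots> \<le> norm c * d"
      using U(3) \<open>d > 0\<close> by (intro mult_left_mono) (auto simp: measure_def enn2real_leI)
    also have "\<dots> < (norm c + 1) * d" using \<open>d > 0\<close> by simp
    also have "\<dots> = e" by (simp add: d_def add_nonneg_eq_0_iff)
    finally show "\<exists>w. integrable lborel w \<and> (LINT t|lborel. norm (indicator A t *\<^sub>R c - w t)) < e
      \<and> (\<lambda>n. LINT t|lborel. norm (w (t - a n) - w t)) \<longlonglongrightarrow> 0"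
      using op[OF U(1) fU] U fU
      by (intro exI[of _ "\<lambda>t. indicator U t *\<^sub>R c"]) (auto simp: integrable_indicator_iff)
  qed
next
  case (add f g)
  note int = add.hyps lborel_integrable_shift[OF add.hyps(1)] lborel_integrable_shift[OF add.hyps(2)]
  have "(\<lambda>n. (LINT t|lborel. norm (f (t - a n) - f t)) + (LINT t|lborel. norm (g (t - a n) - g t)))
      \<longlonglongrightarrow> 0 + 0"
    by (intro tendsto_add add.IH)
  then have lim: "(\<lambda>n. (LINT t|lborel. norm (f (t - a n) - f t)) + (LINT t|lborel. norm (g (t - a n) - g t)))
      \<longlonglongrightarrow> 0" by simp
  show ?case
  proof (rule Lim_null_comparison[OF always_eventually lim], rule allI)
    fix n
    have "norm (LINT t|lborel. norm (f (t - a n) + g (t - a n) - (f t + g t)))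
        = (LINT t|lborel. norm (f (t - a n) + g (t - a n) - (f t + g t)))"
      by (simp add: integral_nonneg_AE)
    also have "\<dots> \<le> (LINT t|lborel. norm (f (t - a n) - f t) + norm (g (t - a n) - g t))"
    proof (rule integral_mono)
      fix t
      have "f (t - a n) + g (t - a n) - (f t + g t) = (f (t - a n) - f t) + (g (t - a n) - g t)" by simp
      then show "norm (f (t - a n) + g (t - a n) - (f t + g t))
          \<le> norm (f (t - a n) - f t) + norm (g (t - a n) - g t)"
        by (metis norm_triangle_ineq)
    qed (use int in simp_all)
    also have "\<dots> = (LINT t|lborel. norm (f (t - a n) - f t)) + (LINT t|lborel. norm (g (t - a n) - g t))"
      using int by simp
    finally show "norm (LINT t|lborel. norm (f (t - a n) + g (t - a n) - (f t + g t)))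
      \<le> (LINT t|lborel. norm (f (t - a n) - f t)) + (LINT t|lborel. norm (g (t - a n) - g t))" .
  qed
next
  case (lim f s)
  have [measurable]: "f \<in> borel_measurable lborel" "\<And>i. s i \<in> borel_measurable lborel"
    using lim.hyps by auto
  have conv: "(\<lambda>i. LINT t|lborel. norm (f t - s i t)) \<longlonglongrightarrow> (LINT t|(lborel :: 'a measure). (0 :: real))"
  \<comment> \<open>The approximants satisfy |s_i| <= 2 |f|, hence the factor 3.\<close>
  proof (rule integral_dominated_convergence[where w = "\<lambda>t. 3 * norm (f t)"
        and s = "\<lambda>i t. norm (f t - s i t)" and f = "\<lambda>_. 0"])
    show "AE t in lborel. (\<lambda>i. norm (f t - s i t)) \<longlonglongrightarrow> 0"
    proof (rule AE_I2)
      fix t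
      have "(\<lambda>i. norm (f t - s i t)) \<longlonglongrightarrow> norm (f t - f t)"
        by (intro tendsto_intros lim.hyps(2)) simp
      then show "(\<lambda>i. norm (f t - s i t)) \<longlonglongrightarrow> 0" by simp
    qed
    show "AE t in lborel. norm (norm (f t - s i t)) \<le> 3 * norm (f t)" for i
    proof (rule AE_I2)
      fix t
      show "norm (norm (f t - s i t)) \<le> 3 * norm (f t)"
        using norm_triangle_ineq4[of "f t" "s i t"] lim.hyps(3)[of t i] by simp
    qed
  qed (use lim.hyps in auto)
  show ?case
  proof (rule L1_translation_continuous_limit[OF lim.hyps(4)])
    fix e :: real assume "e > 0"
    then obtain i where "norm ((LINT t|lborel. norm (f t - s i t)) - (LINT t|(lborel :: 'a measure). (0 :: real))) < e"
      using LIMSEQ_D[OF conv \<open>e > 0\<close>] by auto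
    then show "\<exists>w. integrable lborel w \<and> (LINT t|lborel. norm (f t - w t)) < e
      \<and> (\<lambda>n. LINT t|lborel. norm (w (t - a n) - w t)) \<longlonglongrightarrow> 0"
      using lim.hyps(1) lim.IH by (intro exI[of _ "s i"]) auto
  qed
qed

text \<open>For nonnegative reals \<open>(p - q)\<^sup>2 \<le> \<bar>p\<^sup>2 - q\<^sup>2\<bar>\<close>; applied to the positive and negative parts of the
  real and imaginary parts, this reduces the claim to \<open>L\<^sup>1\<close>.\<close>

lemma L2_translation_continuous:
  fixes f :: "'a::euclidean_space \<Rightarrow> complex"
  assumes f: "square_integrable f" and a: "a \<longlonglongrightarrow> 0"
  shows "(\<lambda>n. LINT t|lborel. (cmod (f (t - a n) - f t))\<^sup>2) \<longlonglongrightarrow> 0"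
proof -
  have [measurable]: "f \<in> borel_measurable borel" using f by (simp add: square_integrable_def)
  define P :: "(complex \<Rightarrow> real) list" where
    "P = [\<lambda>z. max (Re z) 0, \<lambda>z. max (- Re z) 0, \<lambda>z. max (Im z) 0, \<lambda>z. max (- Im z) 0]"
  have int: "integrable lborel (\<lambda>t. (p (f t))\<^sup>2)" if "p \<in> set P" for p
  proof (rule Bochner_Integration.integrable_bound)
    show "integrable lborel (\<lambda>t. (cmod (f t))\<^sup>2)" using f by (simp add: square_integrable_def)
    show "(\<lambda>t. (p (f t))\<^sup>2) \<in> borel_measurable lborel" using that by (auto simp: P_def)
    have "\<bar>p z\<bar> \<le> cmod z" for z
      using that abs_Re_le_cmod[of z] abs_Im_le_cmod[of z] by (auto simp: P_def)
    then show "AE t in lborel. norm ((p (f t))\<^sup>2) \<le> norm ((cmod (f t))\<^sup>2)"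
      by (intro AE_I2) (simp add: power2_le_iff_abs_le)
  qed
  have parts: "(cmod (z - w))\<^sup>2 \<le> (\<Sum>p\<leftarrow>P. 2 * norm ((p z)\<^sup>2 - (p w)\<^sup>2))" for z w
  proof -
    have sq: "(p - q)\<^sup>2 \<le> \<bar>p\<^sup>2 - q\<^sup>2\<bar>" if "p \<ge> 0" "q \<ge> 0" for p q :: real
    proof -
      have "(p - q)\<^sup>2 = \<bar>p - q\<bar> * \<bar>p - q\<bar>" by (simp add: power2_eq_square)
      also have "\<dots> \<le> \<bar>p - q\<bar> * (p + q)" using that by (intro mult_left_mono) auto
      also have "\<dots> = \<bar>(p - q) * (p + q)\<bar>" using that by (simp add: abs_mult)
      also have "(p - q) * (p + q) = p\<^sup>2 - q\<^sup>2" by (simp add: algebra_simps power2_eq_square)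
      finally show ?thesis .
    qed
    have diff_sq: "(p - q)\<^sup>2 \<le> 2 * p\<^sup>2 + 2 * q\<^sup>2" for p q :: real
      using zero_le_power2[of "p + q"] by (simp add: power2_sum power2_diff)
    have rl: "(x - y)\<^sup>2 \<le> 2 * \<bar>(max x 0)\<^sup>2 - (max y 0)\<^sup>2\<bar> + 2 * \<bar>(max (- x) 0)\<^sup>2 - (max (- y) 0)\<^sup>2\<bar>" for x y :: real
    proof -
      have "x - y = (max x 0 - max y 0) - (max (- x) 0 - max (- y) 0)" by auto
      then have "(x - y)\<^sup>2 = ((max x 0 - max y 0) - (max (- x) 0 - max (- y) 0))\<^sup>2" by simp
      also have "\<dots> \<le> 2 * (max x 0 - max y 0)\<^sup>2 + 2 * (max (- x) 0 - max (- y) 0)\<^sup>2"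
        by (rule diff_sq)
      also have "\<dots> \<le> 2 * \<bar>(max x 0)\<^sup>2 - (max y 0)\<^sup>2\<bar> + 2 * \<bar>(max (- x) 0)\<^sup>2 - (max (- y) 0)\<^sup>2\<bar>"
        by (intro add_mono mult_left_mono sq) auto
      finally show ?thesis .
    qed
    show ?thesis
      using rl[of "Re z" "Re w"] rl[of "Im z" "Im w"] by (simp add: P_def cmod_power2)
  qed
  have intd: "integrable lborel (\<lambda>t. (p (f (t - b)))\<^sup>2 - (p (f t))\<^sup>2)" if "p \<in> set P" for p b
    using lborel_integrable_shift[OF int[OF that], of b] int[OF that] by simp
  have "(\<lambda>n. \<Sum>p\<leftarrow>P. 2 * (LINT t|lborel. norm ((p (f (t - a n)))\<^sup>2 - (p (f t))\<^sup>2))) \<longlonglongrightarrow> (\<Sum>p\<leftarrow>P. 2 * 0)"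
  proof -
    have "\<forall>p\<in>set P. (\<lambda>n. LINT t|lborel. norm ((p (f (t - a n)))\<^sup>2 - (p (f t))\<^sup>2)) \<longlonglongrightarrow> 0"
      using L1_translation_continuous[OF int a] by blast
    then show ?thesis
      unfolding P_def list.map sum_list.Cons sum_list.Nil
      by (intro tendsto_add tendsto_mult tendsto_const) simp_all
  qed
  then have lim: "(\<lambda>n. \<Sum>p\<leftarrow>P. 2 * (LINT t|lborel. norm ((p (f (t - a n)))\<^sup>2 - (p (f t))\<^sup>2))) \<longlonglongrightarrow> 0"
    by (simp add: P_def)
  show ?thesis
  proof (rule Lim_null_comparison[OF always_eventually lim], rule allI)
    fix n
    have intP: "\<forall>p\<in>set P. integrable lborel (\<lambda>t. (p (f (t - a n)))\<^sup>2 - (p (f t))\<^sup>2)"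
      using intd by blast
    have i: "integrable lborel (\<lambda>t. \<Sum>p\<leftarrow>P. 2 * norm ((p (f (t - a n)))\<^sup>2 - (p (f t))\<^sup>2))"
      using intP by (simp add: P_def)
    have "norm (LINT t|lborel. (cmod (f (t - a n) - f t))\<^sup>2) = (LINT t|lborel. (cmod (f (t - a n) - f t))\<^sup>2)"
      by (simp add: integral_nonneg_AE)
    also have "\<dots> \<le> (LINT t|lborel. (\<Sum>p\<leftarrow>P. 2 * norm ((p (f (t - a n)))\<^sup>2 - (p (f t))\<^sup>2)))"
      by (rule integral_mono'[OF i parts]) (simp add: P_def)
    also have "\<dots> = (\<Sum>p\<leftarrow>P. 2 * (LINT t|lborel. norm ((p (f (t - a n)))\<^sup>2 - (p (f t))\<^sup>2)))"
      using intP by (simp add: P_def)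
    finally show "norm (LINT t|lborel. (cmod (f (t - a n) - f t))\<^sup>2)
      \<le> (\<Sum>p\<leftarrow>P. 2 * (LINT t|lborel. norm ((p (f (t - a n)))\<^sup>2 - (p (f t))\<^sup>2)))" .
  qed
qed

section \<open>Moyal's identity\<close>

definition fourier :: "('a::euclidean_space \<Rightarrow> complex) \<Rightarrow> 'a \<Rightarrow> complex" where
  "fourier u \<omega> = (LINT t|lborel. u t * character \<omega> (- t))"

lemma measurable_fourier [measurable]:
  assumes [measurable]: "u \<in> borel_measurable borel"
  shows "fourier u \<in> borel_measurable borel"
  unfolding fourier_def[abs_def]
  by (intro lborel.borel_measurable_lebesgue_integral) measurable

lemma integrable_mult_character:
  assumes "integrable lborel u"
  shows "integrable lborel (\<lambda>t. u t * character \<omega> (- t))"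
  by (rule Bochner_Integration.integrable_bound[OF assms])
     (use assms in \<open>auto simp: norm_mult simp del: inner_minus_right\<close>)

lemma cmod_fourier_le:
  "cmod (fourier u \<omega>) \<le> (LINT t|lborel. cmod (u t))"
proof -
  have "cmod (fourier u \<omega>) \<le> (LINT t|lborel. cmod (u t * character \<omega> (- t)))"
    unfolding fourier_def by (rule integral_norm_bound)
  then show ?thesis by (simp add: norm_mult del: inner_minus_right)
qed

lemma fourier_cnj: "cnj (fourier u \<omega>) = fourier (\<lambda>t. cnj (u (- t))) \<omega>" if "u \<in> borel_measurable borel"
proof -
  have [measurable]: "u \<in> borel_measurable borel" by fact
  have "cnj (fourier u \<omega>) = (LINT t|lborel. cnj (u t) * character \<omega> t)"
    unfolding fourier_def Bochner_Integration.integral_cnj[symmetric]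
    by (simp only: complex_cnj_mult cnj_character minus_minus)
  also have "\<dots> = (LINT t|lborel. cnj (u (0 + (- 1) *\<^sub>R t)) * character \<omega> (0 + (- 1) *\<^sub>R t))"
    by (rule lborel_integral_affine[symmetric]) auto
  finally show ?thesis by (simp add: fourier_def)
qed

lemma integrable_pair_mult:
  fixes u :: "'a::euclidean_space \<Rightarrow> complex" and v :: "'b::euclidean_space \<Rightarrow> complex"
  assumes u: "integrable lborel u" and v: "integrable lborel v"
  shows "integrable (lborel \<Otimes>\<^sub>M lborel) (\<lambda>(s, t). u s * v t)"
proof (rule lborel_pair.Fubini_integrable)
  have [measurable]: "u \<in> borel_measurable borel" "v \<in> borel_measurable borel"
    using u v by auto
  show "(\<lambda>(s, t). u s * v t) \<in> borel_measurable (lborel \<Otimes>\<^sub>M lborel)" by measurable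
  show "integrable lborel (\<lambda>s. LINT t|lborel. norm (case (s, t) of (s, t) \<Rightarrow> u s * v t))"
    using u by (simp add: norm_mult)
  show "AE s in lborel. integrable lborel (\<lambda>t. case (s, t) of (s, t) \<Rightarrow> u s * v t)"
    using v by simp
qed

text \<open>Fubini together with the symmetry of the character in its two arguments. It takes the
  place of inversion and Plancherel in what follows.\<close>

lemma fourier_multiplication_formula:
  assumes u: "integrable lborel u" and v: "integrable lborel v"
  shows "(LINT \<omega>|lborel. fourier u \<omega> * v \<omega>) = (LINT t|lborel. u t * fourier v t)"
proof -
  have [measurable]: "u \<in> borel_measurable borel" "v \<in> borel_measurable borel"
    using u v by auto
  have int: "integrable (lborel \<Otimes>\<^sub>M lborel) (\<lambda>(t, \<omega>). u t * v \<omega> * character \<omega> (- t))"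
    by (rule Bochner_Integration.integrable_bound[OF integrable_pair_mult[OF u v]])
       (auto simp: norm_mult simp del: inner_minus_right)
  have "(LINT \<omega>|lborel. fourier u \<omega> * v \<omega>)
      = (LINT \<omega>|lborel. LINT t|lborel. u t * v \<omega> * character \<omega> (- t))"
    unfolding fourier_def
    by (intro Bochner_Integration.integral_cong refl)
       (simp add: mult_ac del: inner_minus_right flip: integral_mult_left_zero integral_mult_right_zero)
  also have "\<dots> = (LINT t|lborel. LINT \<omega>|lborel. u t * v \<omega> * character \<omega> (- t))"
    by (rule lborel_pair.Fubini_integral[OF int])
  also have "\<dots> = (LINT t|lborel. u t * fourier v t)"
    unfolding fourier_def
    by (intro Bochner_Integration.integral_cong refl)
       (simp add: inner_commute mult_ac flip: integral_mult_left_zero integral_mult_right_zero)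
  finally show ?thesis .
qed

lemma fourier_modulation:
  "fourier (\<lambda>\<omega>. w \<omega> * character \<omega> (- s)) t = fourier w (s + t)"
  unfolding fourier_def
  by (intro Bochner_Integration.integral_cong refl)
     (simp add: inner_add_left inner_commute algebra_simps flip: exp_add)

text \<open>A Plancherel identity with weight \<open>w\<close>. The multiplication formula is
  applied to \<open>u\<close>, and then to the reflected conjugate of \<open>u\<close>, whose
  transform is the conjugate factor. The variable r is the difference of the two arguments of
  \<open>u\<close>, and the weight appears through its transform at r.\<close>

lemma fourier_weighted_norm:
  assumes u: "integrable lborel u" and w: "integrable lborel w"
  shows "(LINT \<omega>|lborel. complex_of_real ((cmod (fourier u \<omega>))\<^sup>2) * w \<omega>)
    = (LINT s|lborel. LINT r|lborel. u s * cnj (u (s - r)) * fourier w r)"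
proof -
  have [measurable]: "u \<in> borel_measurable borel" "w \<in> borel_measurable borel"
    using u w by auto
  have fm [measurable]: "fourier u \<in> borel_measurable borel" by measurable
  let ?u' = "\<lambda>t. cnj (u (- t))"
  have u': "integrable lborel ?u'"
    using lborel_integrable_affine[OF u, of "-1" 0] by simp
  have wu: "integrable lborel (\<lambda>\<omega>. cnj (fourier u \<omega>) * w \<omega>)"
  proof (rule Bochner_Integration.integrable_bound)
    show "integrable lborel (\<lambda>\<omega>. (LINT t|lborel. cmod (u t)) *\<^sub>R w \<omega>)" using w by simp
    show "(\<lambda>\<omega>. cnj (fourier u \<omega>) * w \<omega>) \<in> borel_measurable lborel" by measurable
    show "AE \<omega> in lborel. norm (cnj (fourier u \<omega>) * w \<omega>) \<le> norm ((LINT t|lborel. cmod (u t)) *\<^sub>R w \<omega>)"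
      by (intro AE_I2) (auto simp: norm_mult integral_nonneg_AE intro!: mult_right_mono cmod_fourier_le)
  qed
  have "(LINT \<omega>|lborel. complex_of_real ((cmod (fourier u \<omega>))\<^sup>2) * w \<omega>)
      = (LINT \<omega>|lborel. fourier u \<omega> * (cnj (fourier u \<omega>) * w \<omega>))"
    by (intro Bochner_Integration.integral_cong refl) (simp add: mult_cnj_norm flip: mult.assoc)
  also have "\<dots> = (LINT s|lborel. u s * fourier (\<lambda>\<omega>. cnj (fourier u \<omega>) * w \<omega>) s)"
    by (rule fourier_multiplication_formula[OF u wu])
  also have "\<dots> = (LINT s|lborel. LINT r|lborel. u s * cnj (u (s - r)) * fourier w r)"
  proof (intro Bochner_Integration.integral_cong refl)
    fix s
    have "fourier (\<lambda>\<omega>. cnj (fourier u \<omega>) * w \<omega>) s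
        = (LINT \<omega>|lborel. fourier ?u' \<omega> * (w \<omega> * character \<omega> (- s)))"
      unfolding fourier_def[of "\<lambda>\<omega>. cnj (fourier u \<omega>) * w \<omega>"]
      by (simp add: fourier_cnj inner_commute mult.assoc)
    also have "\<dots> = (LINT t|lborel. ?u' t * fourier w (s + t))"
      unfolding fourier_modulation[symmetric]
      by (intro fourier_multiplication_formula u')
         (use integrable_mult_character[OF w, of s] in \<open>simp add: inner_commute[of _ s]\<close>)
    also have "\<dots> = (LINT r|lborel. ?u' (- s + 1 *\<^sub>R r) * fourier w (s + (- s + 1 *\<^sub>R r)))"
      by (rule lborel_integral_affine[symmetric]) auto
    also have "\<dots> = (LINT r|lborel. cnj (u (s - r)) * fourier w r)"
      by simp
    finally show "u s * fourier (\<lambda>\<omega>. cnj (fourier u \<omega>) * w \<omega>) s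
        = (LINT r|lborel. u s * cnj (u (s - r)) * fourier w r)"
      by (simp add: mult.assoc)
  qed
  finally show ?thesis .
qed

section \<open>Gaussians and their Fourier transforms\<close>

definition gauss :: "'a::euclidean_space \<Rightarrow> real" where
  "gauss t = exp (- pi * (t \<bullet> t))"

lemma gauss_pos: "0 < gauss t"
  by (simp add: gauss_def)

lemma measurable_gauss [measurable]: "gauss \<in> borel_measurable borel"
  unfolding gauss_def[abs_def] by measurable

text \<open>The substitution x = c t with c^2 = 2 pi turns the standard normal density into
  \<open>gauss\<close>, so the transform is read off the normal characteristic function.\<close>

lemma gauss_real:
  fixes \<omega> :: real
  shows "integrable lborel (\<lambda>t::real. complex_of_real (gauss t) * character \<omega> (- t))" (is ?I)
    and "fourier (\<lambda>t. complex_of_real (gauss t)) \<omega> = complex_of_real (gauss \<omega>)" (is ?F)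
proof -
  define c where "c = sqrt (2 * pi)"
  have c: "c > 0" "c * c = 2 * pi" by (simp_all add: c_def)
  have g: "c * std_normal_density (c * t) = gauss t" for t
    using c by (simp add: std_normal_density_def gauss_def c_def power2_eq_square)
  define F where "F x = complex_of_real (std_normal_density x) * exp (\<i> * complex_of_real (- (c * \<omega>) * x))" for x
  have Fint: "integrable lborel F"
  proof (rule Bochner_Integration.integrable_bound)
    show "integrable lborel std_normal_density" by simp
    show "F \<in> borel_measurable lborel" unfolding F_def[abs_def] by measurable
  qed (simp add: F_def norm_mult norm_exp_eq_Re)
  have Ft: "c *\<^sub>R F (0 + c * t) = complex_of_real (gauss t) * character \<omega> (- t)" for t
  proof -
    have "exp (\<i> * complex_of_real (- (c * \<omega>) * (0 + c * t))) = character \<omega> (- t)"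
    proof -
      have "- (c * \<omega>) * (0 + c * t) = - (2 * pi * \<omega> * t)"
        using c(2) by (metis add_0 mult.assoc mult.commute mult_minus_left)
      then show ?thesis by (simp only:) (simp add: mult_ac)
    qed
    then show ?thesis
      unfolding F_def g[symmetric] by (simp add: scaleR_conv_of_real mult.assoc)
  qed
  show ?I
    unfolding Ft[symmetric] using lborel_integrable_real_affine[OF Fint, of c 0] c by simp
  have "fourier (\<lambda>t. complex_of_real (gauss t)) \<omega> = (LINT t|lborel. c *\<^sub>R F (0 + c * t))"
    unfolding fourier_def Ft ..
  also have "\<dots> = (LINT x|lborel. F x)"
    using lborel_integral_real_affine[of c F 0] c by simp
  also have "\<dots> = char std_normal_distribution (- (c * \<omega>))"
    unfolding char_def F_def
    by (subst integral_density) (auto simp: scaleR_conv_of_real)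
  also have "\<dots> = complex_of_real (exp (- (- (c * \<omega>))\<^sup>2 / 2))"
    by (simp only: char_std_normal_distribution)
  also have "- (- (c * \<omega>))\<^sup>2 / 2 = - pi * (\<omega> \<bullet> \<omega>)"
  proof -
    have "(- (c * \<omega>))\<^sup>2 = (c * c) * (\<omega> * \<omega>)" by (simp add: power2_eq_square)
    then show ?thesis using c(2) by simp
  qed
  finally show ?F by (simp add: gauss_def)
qed

text \<open>The Gaussian and the character both factor over the coordinates, and Lebesgue measure is
  the image of a product measure.\<close>

lemma gauss_euclidean:
  fixes \<omega> :: "'a::euclidean_space"
  shows "integrable lborel (\<lambda>t::'a. complex_of_real (gauss t) * character \<omega> (- t))" (is ?I)
    and "fourier (\<lambda>t. complex_of_real (gauss t)) \<omega> = complex_of_real (gauss \<omega>)" (is ?F)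
proof -
  interpret product_sigma_finite "\<lambda>b::'a. lborel :: real measure" ..
  define h where "h b t = complex_of_real (gauss t) * character (\<omega> \<bullet> b) (- t)" for b :: 'a and t :: real
  let ?T = "\<lambda>x. \<Sum>b\<in>Basis. x b *\<^sub>R b :: 'a"
  have inner_T: "?T x \<bullet> b = x b" if "b \<in> Basis" for x b
    using that by (simp add: inner_sum_left inner_Basis if_distrib cong: if_cong)
  have prod_h: "complex_of_real (gauss (?T x)) * character \<omega> (- ?T x) = (\<Prod>b\<in>Basis. h b (x b))" for x
  proof -
    have "?T x \<bullet> ?T x = (\<Sum>b\<in>Basis. x b * x b)"
      by (subst euclidean_inner) (simp add: inner_T)
    then have 1: "gauss (?T x) = (\<Prod>b\<in>Basis. gauss (x b))"
      by (simp add: gauss_def sum_distrib_left flip: exp_sum)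
    have "\<omega> \<bullet> (- ?T x) = (\<Sum>b\<in>Basis. (\<omega> \<bullet> b) \<bullet> (- x b))"
      by (simp add: inner_sum_right sum_negf mult.commute)
    then have 2: "character \<omega> (- ?T x) = (\<Prod>b\<in>Basis. character (\<omega> \<bullet> b) (- x b))"
      by (simp add: sum_distrib_left flip: exp_sum)
    show ?thesis unfolding 1 2 h_def by (simp add: prod.distrib)
  qed
  have hint: "integrable lborel (h b)" for b
    unfolding h_def[abs_def] by (rule gauss_real)
  have hI: "integral\<^sup>L lborel (h b) = complex_of_real (gauss (\<omega> \<bullet> b))" for b
    using gauss_real(2)[of "\<omega> \<bullet> b"] by (simp add: h_def[abs_def] fourier_def)
  let ?g = "\<lambda>t. complex_of_real (gauss t) * character \<omega> (- t)"
  have T: "?T \<in> measurable (\<Pi>\<^sub>M b\<in>Basis. lborel) borel"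
    by measurable
  have gm: "?g \<in> borel_measurable borel"
    by measurable
  have "integrable (\<Pi>\<^sub>M b\<in>Basis. lborel) (\<lambda>x. \<Prod>b\<in>Basis. h b (x b))"
    by (rule product_integrable_prod) (simp, rule hint)
  then have "integrable (distr (\<Pi>\<^sub>M b\<in>Basis. lborel) borel ?T) ?g"
    unfolding integrable_distr_eq[OF T gm] prod_h .
  then show ?I by (subst lborel_eq)
  have "fourier (\<lambda>t. complex_of_real (gauss t)) \<omega>
      = (LINT x|(\<Pi>\<^sub>M b\<in>Basis. lborel). (\<Prod>b\<in>Basis. h b (x b)))"
    unfolding fourier_def by (subst lborel_eq) (simp only: integral_distr[OF T gm] prod_h)
  also have "\<dots> = (\<Prod>b\<in>Basis. complex_of_real (gauss (\<omega> \<bullet> b)))"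
    by (subst product_integral_prod) (auto simp: hint hI)
  also have "\<dots> = complex_of_real (gauss \<omega>)"
  proof -
    have "gauss \<omega> = (\<Prod>b\<in>Basis. gauss (\<omega> \<bullet> b))"
      by (simp add: gauss_def sum_distrib_left euclidean_inner[of \<omega> \<omega>] flip: exp_sum)
    then show ?thesis by simp
  qed
  finally show ?F .
qed

lemma integrable_gauss: "integrable lborel (gauss :: 'a::euclidean_space \<Rightarrow> real)"
  using integrable_norm[OF gauss_euclidean(1)[of "0::'a"]]
  by (simp add: norm_mult abs_of_pos[OF gauss_pos])

lemma integral_gauss: "(LINT t|lborel. gauss (t :: 'a::euclidean_space)) = 1"
proof -
  have "complex_of_real (LINT t|lborel. gauss (t :: 'a)) = fourier (\<lambda>t::'a. complex_of_real (gauss t)) 0"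
    by (simp add: fourier_def)
  also have "\<dots> = complex_of_real 1" unfolding gauss_euclidean(2) by (simp add: gauss_def)
  finally show ?thesis by (simp only: of_real_eq_iff)
qed

text \<open>As \<open>e\<close> tends to 0 the right side is an approximate identity: Gaussians of
  total mass 1 that concentrate at the origin.\<close>

lemma fourier_gauss_scaled:
  fixes r :: "'a::euclidean_space"
  assumes e: "e > 0"
  shows "fourier (\<lambda>\<omega>. complex_of_real (gauss (e *\<^sub>R \<omega>))) r
    = complex_of_real (gauss ((1 / e) *\<^sub>R r) / e ^ DIM('a))"
proof -
  have "complex_of_real (gauss ((1 / e) *\<^sub>R r))
      = (LINT \<omega>|lborel. complex_of_real (gauss \<omega>) * character ((1 / e) *\<^sub>R r) (- \<omega>))"
    using gauss_euclidean(2)[of "(1 / e) *\<^sub>R r"] by (simp add: fourier_def)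
  also have "\<dots> = e ^ DIM('a) *\<^sub>R (LINT \<omega>|lborel. complex_of_real (gauss (e *\<^sub>R \<omega>))
      * character ((1 / e) *\<^sub>R r) (- (e *\<^sub>R \<omega>)))"
    by (rule lborel_integral_scale[OF _ e]) measurable
  also have "(LINT \<omega>|lborel. complex_of_real (gauss (e *\<^sub>R \<omega>))
      * character ((1 / e) *\<^sub>R r) (- (e *\<^sub>R \<omega>))) = fourier (\<lambda>\<omega>. complex_of_real (gauss (e *\<^sub>R \<omega>))) r"
    unfolding fourier_def using e by (intro Bochner_Integration.integral_cong refl) simp
  finally show ?thesis
    using e by (simp add: scaleR_conv_of_real field_simps)
qed

section \<open>Autocorrelations, which separate the two factors in Moyal's identity\<close>

definition autocorr :: "('a::euclidean_space \<Rightarrow> complex) \<Rightarrow> 'a \<Rightarrow> complex" where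
  "autocorr u r = (LINT s|lborel. u s * cnj (u (s - r)))"

lemma measurable_autocorr [measurable]:
  assumes [measurable]: "u \<in> borel_measurable borel"
  shows "autocorr u \<in> borel_measurable borel"
  unfolding autocorr_def[abs_def]
  by (intro lborel.borel_measurable_lebesgue_integral) measurable

lemma norm_abs_L2: "square_integrable u \<Longrightarrow> (norm (abs_L2 u))\<^sup>2 = (LINT t|lborel. (cmod (u t))\<^sup>2)"
  unfolding norm_rep by (intro integral_cong_AE) (use rep_abs_AE[of u] in \<open>auto simp: square_integrable_def\<close>)

lemma Cauchy_Schwarz_square_integrable:
  assumes "square_integrable u" "square_integrable v"
  shows "cmod (LINT t|lborel. u t * cnj (v t))
    \<le> sqrt (LINT t|lborel. (cmod (u t))\<^sup>2) * sqrt (LINT t|lborel. (cmod (v t))\<^sup>2)"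
  using Cauchy_Schwarz_cinner[of "abs_L2 u" "abs_L2 v"] assms
  by (simp add: cinner_abs flip: norm_abs_L2)

lemma square_integrable_shift: "square_integrable u \<Longrightarrow> square_integrable (\<lambda>t. u (t - a))"
  using square_integrable_affine[of u 1 "- a"] by simp

text \<open>2 a b <= a^2 + b^2 and translation invariance give a bound that is uniform in the
  shift.\<close>

lemma nn_integral_shift_prod_le:
  assumes u: "square_integrable u"
  shows "(\<integral>\<^sup>+t. ennreal (cmod (u t) * cmod (u (t - r))) \<partial>lborel) \<le> ennreal (LINT t|lborel. (cmod (u t))\<^sup>2)"
proof -
  have [measurable]: "u \<in> borel_measurable borel" using u by (simp add: square_integrable_def)
  have int: "integrable lborel (\<lambda>t. (cmod (u t))\<^sup>2)" using u by (simp add: square_integrable_def)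
  note int' = lborel_integrable_shift[OF int, of r]
  have "(\<integral>\<^sup>+t. ennreal (cmod (u t) * cmod (u (t - r))) \<partial>lborel)
      \<le> (\<integral>\<^sup>+t. ennreal (((cmod (u t))\<^sup>2 + (cmod (u (t - r)))\<^sup>2) / 2) \<partial>lborel)"
    using sum_squares_bound[of "cmod (u _)" "cmod (u (_ - r))"]
    by (intro nn_integral_mono ennreal_leI) (simp add: mult_ac)
  also have "\<dots> = ennreal (LINT t|lborel. ((cmod (u t))\<^sup>2 + (cmod (u (t - r)))\<^sup>2) / 2)"
    using int int' by (intro nn_integral_eq_integral) auto
  also have "(LINT t|lborel. ((cmod (u t))\<^sup>2 + (cmod (u (t - r)))\<^sup>2) / 2)
      = ((LINT t|lborel. (cmod (u t))\<^sup>2) + (LINT t|lborel. (cmod (u (t - r)))\<^sup>2)) / 2"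
    using int int' by simp
  also have "(LINT t|lborel. (cmod (u (t - r)))\<^sup>2) = (LINT t|lborel. (cmod (u t))\<^sup>2)"
    by (rule lborel_integral_shift[of "\<lambda>t. (cmod (u t))\<^sup>2"]) simp
  finally show ?thesis by simp
qed

lemma cmod_autocorr_le:
  assumes u: "square_integrable u"
  shows "cmod (autocorr u r) \<le> (LINT t|lborel. (cmod (u t))\<^sup>2)"
proof -
  have "ennreal (cmod (autocorr u r)) \<le> (\<integral>\<^sup>+t. ennreal (cmod (u t * cnj (u (t - r)))) \<partial>lborel)"
    unfolding autocorr_def
    by (intro integral_norm_bound_ennreal square_integrable_prod u square_integrable_shift)
  also have "\<dots> \<le> ennreal (LINT t|lborel. (cmod (u t))\<^sup>2)"
    using nn_integral_shift_prod_le[OF u] by (simp add: norm_mult)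
  finally show ?thesis
    by (subst (asm) ennreal_le_iff) (auto simp: integral_nonneg_AE)
qed

lemma autocorr_tendsto:
  assumes u: "square_integrable u" and a: "a \<longlonglongrightarrow> 0"
  shows "(\<lambda>n. autocorr u (a n)) \<longlonglongrightarrow> of_real (LINT t|lborel. (cmod (u t))\<^sup>2)"
proof -
  let ?N = "LINT t|lborel. (cmod (u t))\<^sup>2"
  let ?D = "\<lambda>n. LINT t|lborel. (cmod (u (t - a n) - u t))\<^sup>2"
  have "(\<lambda>n. sqrt ?N * sqrt (?D n)) \<longlonglongrightarrow> sqrt ?N * sqrt 0"
    by (intro tendsto_intros L2_translation_continuous[OF u a])
  then have lim: "(\<lambda>n. sqrt ?N * sqrt (?D n)) \<longlonglongrightarrow> 0" by simp
  have "cmod (autocorr u (a n) - of_real ?N) \<le> sqrt ?N * sqrt (?D n)" for n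
  proof -
    have d: "square_integrable (\<lambda>t. u (t - a n) - u t)"
      by (rule square_integrable_diff[OF square_integrable_shift[OF u] u])
    have "complex_of_real ?N = (LINT t|lborel. u t * cnj (u t))"
      unfolding integral_complex_of_real[symmetric]
      by (intro Bochner_Integration.integral_cong refl) (simp add: mult_cnj_norm)
    then have "autocorr u (a n) - of_real ?N = (LINT t|lborel. u t * cnj (u (t - a n)) - u t * cnj (u t))"
      unfolding autocorr_def
      by (simp add: Bochner_Integration.integral_diff[OF square_integrable_prod[OF u square_integrable_shift[OF u]]
            square_integrable_prod[OF u u]])
    also have "\<dots> = (LINT t|lborel. u t * cnj (u (t - a n) - u t))"
      by (simp add: right_diff_distrib)
    also have "cmod \<dots> \<le> sqrt ?N * sqrt (?D n)"
      by (rule Cauchy_Schwarz_square_integrable[OF u d])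
    finally show ?thesis .
  qed
  then have "(\<lambda>n. autocorr u (a n) - of_real ?N) \<longlonglongrightarrow> 0"
    by (intro Lim_null_comparison[OF always_eventually lim]) simp
  then show ?thesis by (rule LIM_zero_cancel)
qed

text \<open>The Gaussian weight in \<open>\<omega>\<close> makes the exchange of integrals legitimate; it is removed by letting
  \<open>e\<close> tend to 0.\<close>

lemma gaussian_Moyal:
  fixes f g :: "'a::euclidean_space \<Rightarrow> complex" and e :: real
  assumes f: "square_integrable f" and g: "square_integrable g" and e: "e > 0"
  defines "V \<equiv> \<lambda>x. fourier (\<lambda>s. f s * cnj (g (s - x)))"
    and "k \<equiv> \<lambda>r. gauss ((1 / e) *\<^sub>R r) / e ^ DIM('a)"
  shows "(\<integral>\<^sup>+x. \<integral>\<^sup>+\<omega>. ennreal ((cmod (V x \<omega>))\<^sup>2 * gauss (e *\<^sub>R \<omega>)) \<partial>lborel \<partial>lborel)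
    = ennreal (Re (LINT r|lborel. of_real (k r) * (autocorr f r * cnj (autocorr g r))))"
proof -
  have [measurable]: "f \<in> borel_measurable borel" "g \<in> borel_measurable borel"
    using f g by (auto simp: square_integrable_def)
  have [measurable]: "(fst :: 'a \<times> 'a \<Rightarrow> 'a) \<in> measurable borel borel"
    and [measurable]: "(snd :: 'a \<times> 'a \<Rightarrow> 'a) \<in> measurable borel borel"
    by (simp_all flip: borel_prod)
  have k0: "0 \<le> k r" for r using gauss_pos[of "(1 / e) *\<^sub>R r"] e by (simp add: k_def)
  have kint: "integrable lborel k"
    unfolding k_def using e
    by (intro integrable_divide_zero lborel_integrable_scale[OF integrable_gauss]) simp
  have km [measurable]: "k \<in> borel_measurable borel" using kint by simp
  define w where "w \<omega> = complex_of_real (gauss (e *\<^sub>R \<omega>))" for \<omega> :: 'a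
  have wr: "integrable lborel (\<lambda>\<omega>::'a. gauss (e *\<^sub>R \<omega>))"
    by (rule lborel_integrable_scale[OF integrable_gauss e])
  then have wint: "integrable lborel w"
    by (simp add: w_def[abs_def])
  have wk: "fourier w r = of_real (k r)" for r
    unfolding w_def[abs_def] k_def by (rule fourier_gauss_scaled[OF e])
  \<comment> \<open>The integrand that \<open>fourier_weighted_norm\<close> yields for u(s) = f(s)
    cnj(g(s - x)), with p = (s, r) and \<open>k\<close> the transform of the weight.\<close>
  define \<Phi> where "\<Phi> x p = f (fst p) * cnj (g (fst p - x)) * cnj (f (fst p - snd p) * cnj (g (fst p - snd p - x)))
      * of_real (k (snd p))" for x and p :: "'a \<times> 'a"
  have \<Phi>m [measurable]: "(\<lambda>(x, p). \<Phi> x p) \<in> borel_measurable (borel \<Otimes>\<^sub>M borel)"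
    unfolding \<Phi>_def by measurable
  let ?F = "LINT t|lborel. (cmod (f t))\<^sup>2" and ?G = "LINT t|lborel. (cmod (g t))\<^sup>2"
  have F0: "0 \<le> ?F" and G0: "0 \<le> ?G" by (simp_all add: integral_nonneg_AE)
  \<comment> \<open>Absolute integrability is obtained in the order x, s, r: the x-integral of the
    g-factors is bounded uniformly in p, the s-integral of the f-factors uniformly in r, and the
    integrable \<open>k\<close> controls r.\<close>
  have inner: "(\<integral>\<^sup>+x. ennreal (cmod (\<Phi> x p)) \<partial>lborel)
      \<le> ennreal (cmod (f (fst p)) * cmod (f (fst p - snd p)) * k (snd p)) * ennreal ?G" for p
  proof -
    have "(\<integral>\<^sup>+x. ennreal (cmod (\<Phi> x p)) \<partial>lborel)
      = (\<integral>\<^sup>+x. ennreal (cmod (f (fst p)) * cmod (f (fst p - snd p)) * k (snd p))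
          * ennreal (cmod (g (fst p + (- 1) *\<^sub>R x)) * cmod (g (fst p + (- 1) *\<^sub>R x - snd p))) \<partial>lborel)"
    proof (intro nn_integral_cong)
      fix x
      have "fst p + (- 1) *\<^sub>R x = fst p - x" "fst p + (- 1) *\<^sub>R x - snd p = fst p - snd p - x" by simp_all
      then show "ennreal (cmod (\<Phi> x p)) = ennreal (cmod (f (fst p)) * cmod (f (fst p - snd p)) * k (snd p))
          * ennreal (cmod (g (fst p + (- 1) *\<^sub>R x)) * cmod (g (fst p + (- 1) *\<^sub>R x - snd p)))"
        by (simp only:) (simp add: \<Phi>_def norm_mult k0 mult_ac flip: ennreal_mult)
    qed
    also have "\<dots> = ennreal (cmod (f (fst p)) * cmod (f (fst p - snd p)) * k (snd p))
        * (\<integral>\<^sup>+x. ennreal (cmod (g (fst p + (- 1) *\<^sub>R x)) * cmod (g (fst p + (- 1) *\<^sub>R x - snd p))) \<partial>lborel)"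
      by (rule nn_integral_cmult) measurable
    also have "(\<integral>\<^sup>+x. ennreal (cmod (g (fst p + (- 1) *\<^sub>R x)) * cmod (g (fst p + (- 1) *\<^sub>R x - snd p))) \<partial>lborel)
        = (\<integral>\<^sup>+y. ennreal (cmod (g y) * cmod (g (y - snd p))) \<partial>lborel)"
      by (rule lborel_nn_integral_affine) auto
    also have "\<dots> \<le> ennreal ?G" by (rule nn_integral_shift_prod_le[OF g])
    finally show ?thesis by (simp add: mult_left_mono)
  qed
  have int: "integrable (lborel \<Otimes>\<^sub>M lborel) (\<lambda>(x, p). \<Phi> x p)"
  proof (rule integrableI_bounded)
    show "(\<lambda>(x, p). \<Phi> x p) \<in> borel_measurable (lborel \<Otimes>\<^sub>M lborel)" by measurable
    have "(\<integral>\<^sup>+z. ennreal (norm (case z of (x, p) \<Rightarrow> \<Phi> x p)) \<partial>(lborel \<Otimes>\<^sub>M lborel))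
        = (\<integral>\<^sup>+p. \<integral>\<^sup>+x. ennreal (cmod (\<Phi> x p)) \<partial>lborel \<partial>lborel)"
      by (subst lborel_pair.nn_integral_snd[symmetric]) simp_all
    also have "\<dots> \<le> (\<integral>\<^sup>+p. ennreal (cmod (f (fst p)) * cmod (f (fst p - snd p)) * k (snd p)) * ennreal ?G \<partial>lborel)"
      by (intro nn_integral_mono inner)
    also have "\<dots> = (\<integral>\<^sup>+p. ennreal (cmod (f (fst p)) * cmod (f (fst p - snd p)) * k (snd p)) * ennreal ?G
        \<partial>(lborel \<Otimes>\<^sub>M lborel))"
      by (simp add: lborel_prod)
    also have "\<dots> = (\<integral>\<^sup>+r. \<integral>\<^sup>+s. ennreal (cmod (f s) * cmod (f (s - r)) * k r) * ennreal ?G \<partial>lborel \<partial>lborel)"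
      by (subst lborel_pair.nn_integral_snd[symmetric]) simp_all
    also have "\<dots> \<le> (\<integral>\<^sup>+r. ennreal (k r) * (ennreal ?F * ennreal ?G) \<partial>lborel)"
    proof (rule nn_integral_mono)
      fix r
      have "(\<integral>\<^sup>+s. ennreal (cmod (f s) * cmod (f (s - r)) * k r) * ennreal ?G \<partial>lborel)
          = (\<integral>\<^sup>+s. ennreal (cmod (f s) * cmod (f (s - r))) * (ennreal (k r) * ennreal ?G) \<partial>lborel)"
        by (intro nn_integral_cong) (simp add: ennreal_mult k0 mult_ac)
      also have "\<dots> = (\<integral>\<^sup>+s. ennreal (cmod (f s) * cmod (f (s - r))) \<partial>lborel) * (ennreal (k r) * ennreal ?G)"
        by (rule nn_integral_multc) measurable
      also have "\<dots> \<le> ennreal ?F * (ennreal (k r) * ennreal ?G)"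
        by (intro mult_right_mono nn_integral_shift_prod_le f) simp
      finally show "(\<integral>\<^sup>+s. ennreal (cmod (f s) * cmod (f (s - r)) * k r) * ennreal ?G \<partial>lborel)
          \<le> ennreal (k r) * (ennreal ?F * ennreal ?G)" by (simp add: mult_ac)
    qed
    also have "\<dots> = (\<integral>\<^sup>+r. ennreal (k r) \<partial>lborel) * (ennreal ?F * ennreal ?G)"
      by (rule nn_integral_multc) measurable
    also have "\<dots> = ennreal (LINT r|lborel. k r) * (ennreal ?F * ennreal ?G)"
      using kint k0 by (subst nn_integral_eq_integral) auto
    also have "\<dots> < \<infinity>" by (simp add: ennreal_mult_less_top)
    finally show "(\<integral>\<^sup>+z. ennreal (norm (case z of (x, p) \<Rightarrow> \<Phi> x p)) \<partial>(lborel \<Otimes>\<^sub>M lborel)) < \<infinity>" .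
  qed
  have Vm [measurable]: "(\<lambda>(x, \<omega>). V x \<omega>) \<in> borel_measurable (borel \<Otimes>\<^sub>M borel)"
    unfolding V_def fourier_def case_prod_beta
    by (intro lborel.borel_measurable_lebesgue_integral) measurable
  have Fx: "integrable lborel (\<lambda>s. f s * cnj (g (s - x)))" for x
    by (intro square_integrable_prod f square_integrable_shift g)
  define J where "J x = (LINT \<omega>|lborel. (cmod (V x \<omega>))\<^sup>2 * gauss (e *\<^sub>R \<omega>))" for x
  have Jm [measurable]: "J \<in> borel_measurable borel"
    unfolding J_def[abs_def]
    by (intro lborel.borel_measurable_lebesgue_integral) measurable
  have Vint: "integrable lborel (\<lambda>\<omega>. (cmod (V x \<omega>))\<^sup>2 * gauss (e *\<^sub>R \<omega>))" for x
  proof (rule Bochner_Integration.integrable_bound)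
    let ?C = "LINT t|lborel. cmod (f t * cnj (g (t - x)))"
    show "integrable lborel (\<lambda>\<omega>::'a. ?C\<^sup>2 * gauss (e *\<^sub>R \<omega>))" using wr by simp
    show "AE \<omega> in lborel. norm ((cmod (V x \<omega>))\<^sup>2 * gauss (e *\<^sub>R \<omega>)) \<le> norm (?C\<^sup>2 * gauss (e *\<^sub>R \<omega>))"
    proof (rule AE_I2)
      fix \<omega>
      have "cmod (V x \<omega>) \<le> ?C" unfolding V_def by (rule cmod_fourier_le)
      then have "(cmod (V x \<omega>))\<^sup>2 \<le> ?C\<^sup>2" by (intro power_mono) auto
      then show "norm ((cmod (V x \<omega>))\<^sup>2 * gauss (e *\<^sub>R \<omega>)) \<le> norm (?C\<^sup>2 * gauss (e *\<^sub>R \<omega>))"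
        using gauss_pos[of "e *\<^sub>R \<omega>"] by (simp add: mult_right_mono)
    qed
  qed measurable
  \<comment> \<open>Fubini makes the section at x integrable only for almost every x, which suffices
    for the integral of \<open>J\<close>.\<close>
  have J\<Phi>: "AE x in lborel. complex_of_real (J x) = (LINT p|lborel. \<Phi> x p)"
    using lborel_pair.AE_integrable_fst[OF int]
  proof eventually_elim
    fix x assume "integrable lborel (\<Phi> x)"
    then have ip: "integrable (lborel \<Otimes>\<^sub>M lborel) (\<lambda>(s, r). \<Phi> x (s, r))"
      by (simp add: lborel_prod)
    have "complex_of_real (J x) = (LINT \<omega>|lborel. complex_of_real ((cmod (V x \<omega>))\<^sup>2) * w \<omega>)"
      unfolding J_def w_def integral_complex_of_real[symmetric] by simp
    also have "\<dots> = (LINT s|lborel. LINT r|lborel. \<Phi> x (s, r))"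
      unfolding V_def by (subst fourier_weighted_norm[OF Fx wint]) (simp add: \<Phi>_def wk)
    also have "\<dots> = (LINT p|lborel. \<Phi> x p)"
      using lborel_pair.integral_fst[OF ip] by (simp add: lborel_prod)
    finally show "complex_of_real (J x) = (LINT p|lborel. \<Phi> x p)" .
  qed
  have i1: "integrable lborel (\<lambda>x. LINT p|lborel. \<Phi> x p)"
    by (rule lborel_pair.integrable_fst[OF int])
  have Jint: "integrable lborel (\<lambda>x. complex_of_real (J x))"
    by (subst integrable_cong_AE[OF _ _ J\<Phi>]) (use i1 in auto)
  \<comment> \<open>After y = s - x the integral of the g-factors no longer depends on s, and the
    autocorrelations of f and g decouple.\<close>
  have x_int: "(LINT x|lborel. \<Phi> x (s, r)) = of_real (k r) * (f s * cnj (f (s - r)) * cnj (autocorr g r))" for s r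
  proof -
    have "(LINT x|lborel. \<Phi> x (s, r)) = (LINT x|lborel. (of_real (k r) * (f s * cnj (f (s - r))))
        * (cnj (g (s + (- 1) *\<^sub>R x)) * g (s + (- 1) *\<^sub>R x - r)))"
    proof (intro Bochner_Integration.integral_cong refl)
      fix x
      have "s + (- 1) *\<^sub>R x = s - x" "s + (- 1) *\<^sub>R x - r = s - r - x" by simp_all
      then show "\<Phi> x (s, r) = (of_real (k r) * (f s * cnj (f (s - r))))
        * (cnj (g (s + (- 1) *\<^sub>R x)) * g (s + (- 1) *\<^sub>R x - r))"
        by (simp only:) (simp add: \<Phi>_def mult_ac)
    qed
    also have "\<dots> = (of_real (k r) * (f s * cnj (f (s - r))))
        * (LINT x|lborel. cnj (g (s + (- 1) *\<^sub>R x)) * g (s + (- 1) *\<^sub>R x - r))"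
      by simp
    also have "(LINT x|lborel. cnj (g (s + (- 1) *\<^sub>R x)) * g (s + (- 1) *\<^sub>R x - r))
        = (LINT y|lborel. cnj (g y) * g (y - r))"
      by (rule lborel_integral_affine) auto
    also have "\<dots> = cnj (autocorr g r)"
      unfolding autocorr_def Bochner_Integration.integral_cnj[symmetric] by simp
    finally show ?thesis by (simp add: mult_ac)
  qed
  have i2: "integrable (lborel \<Otimes>\<^sub>M lborel) (\<lambda>(s, r). LINT x|lborel. \<Phi> x (s, r))"
    using lborel_pair.integrable_snd[OF int] by (simp add: lborel_prod case_prod_unfold)
  have "complex_of_real (LINT x|lborel. J x) = (LINT x|lborel. complex_of_real (J x))"
    by (rule integral_complex_of_real[symmetric])
  also have "\<dots> = (LINT x|lborel. LINT p|lborel. \<Phi> x p)"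
    by (rule integral_cong_AE[OF _ _ J\<Phi>]) (use i1 in auto)
  also have "\<dots> = (LINT p|lborel. LINT x|lborel. \<Phi> x p)"
    by (rule lborel_pair.Fubini_integral[OF int, symmetric])
  also have "\<dots> = (LINT r|lborel. LINT s|lborel. LINT x|lborel. \<Phi> x (s, r))"
    using lborel_pair.integral_snd[OF i2] by (simp add: lborel_prod case_prod_unfold)
  also have "\<dots> = (LINT r|lborel. of_real (k r) * (autocorr f r * cnj (autocorr g r)))"
    unfolding x_int by (simp add: autocorr_def[of f])
  finally have main: "complex_of_real (LINT x|lborel. J x)
      = (LINT r|lborel. of_real (k r) * (autocorr f r * cnj (autocorr g r)))" .
  have J0: "0 \<le> J x" for x
    unfolding J_def by (intro integral_nonneg_AE AE_I2) (simp add: less_imp_le[OF gauss_pos])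
  have "(\<integral>\<^sup>+x. \<integral>\<^sup>+\<omega>. ennreal ((cmod (V x \<omega>))\<^sup>2 * gauss (e *\<^sub>R \<omega>)) \<partial>lborel \<partial>lborel) = (\<integral>\<^sup>+x. ennreal (J x) \<partial>lborel)"
    unfolding J_def
    by (intro nn_integral_cong nn_integral_eq_integral Vint AE_I2) (simp add: less_imp_le[OF gauss_pos])
  also have "\<dots> = ennreal (LINT x|lborel. J x)"
  proof (rule nn_integral_eq_integral)
    show "integrable lborel J"
      using integrable_Re[OF Jint] by simp
  qed (simp add: J0)
  also have "(LINT x|lborel. J x) = Re (LINT r|lborel. of_real (k r) * (autocorr f r * cnj (autocorr g r)))"
    unfolding main[symmetric] by simp
  finally show ?thesis .
qed

text \<open>The same sequence has its limit computed twice. The Gaussian weights increase to 1, so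
  the left side converges monotonically; on the other side the substitution r = e t fixes the
  Gaussian, and the autocorrelations tend to their values at 0, the squared norms.\<close>

lemma Moyal_identity_functions:
  fixes f g :: "'a::euclidean_space \<Rightarrow> complex"
  assumes f: "square_integrable f" and g: "square_integrable g"
  defines "V \<equiv> \<lambda>x. fourier (\<lambda>s. f s * cnj (g (s - x)))"
  shows "(\<integral>\<^sup>+z. ennreal ((cmod (V (fst z) (snd z)))\<^sup>2) \<partial>lborel)
    = ennreal ((LINT t|lborel. (cmod (f t))\<^sup>2) * (LINT t|lborel. (cmod (g t))\<^sup>2))"
proof -
  have [measurable]: "f \<in> borel_measurable borel" "g \<in> borel_measurable borel"
    using f g by (auto simp: square_integrable_def)
  have Vm [measurable]: "(\<lambda>z. V (fst z) (snd z)) \<in> borel_measurable (borel \<Otimes>\<^sub>M borel)"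
    unfolding V_def fourier_def
    by (intro lborel.borel_measurable_lebesgue_integral) measurable
  define e where "e n = 1 / real (Suc n)" for n
  have e: "e n > 0" "e (Suc n) \<le> e n" for n by (simp_all add: e_def frac_le)
  have e0: "e \<longlonglongrightarrow> 0"
    unfolding e_def using LIMSEQ_inverse_real_of_nat by (simp add: inverse_eq_divide)
  define H where "H n z = ennreal ((cmod (V (fst z) (snd z)))\<^sup>2 * gauss (e n *\<^sub>R snd z))" for n and z :: "'a \<times> 'a"
  let ?F = "LINT t|lborel. (cmod (f t))\<^sup>2" and ?G = "LINT t|lborel. (cmod (g t))\<^sup>2"
  have lim1: "(\<lambda>n. \<integral>\<^sup>+z. H n z \<partial>(lborel \<Otimes>\<^sub>M lborel)) \<longlonglongrightarrow> (\<integral>\<^sup>+z. ennreal ((cmod (V (fst z) (snd z)))\<^sup>2) \<partial>(lborel \<Otimes>\<^sub>M lborel))"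
  proof (rule nn_integral_LIMSEQ)
    show "incseq H"
    proof (rule incseq_SucI, rule le_funI)
      fix n and z :: "'a \<times> 'a"
      have "e (Suc n) * e (Suc n) \<le> e n * e n"
        using e[of n] e(1)[of "Suc n"] by (intro mult_mono) auto
      then have "gauss (e n *\<^sub>R snd z) \<le> gauss (e (Suc n) *\<^sub>R snd z)"
        by (simp add: gauss_def mult_right_mono flip: mult.assoc)
      then show "H n z \<le> H (Suc n) z"
        unfolding H_def by (intro ennreal_leI mult_left_mono) auto
    qed
    show "H n \<in> borel_measurable (lborel \<Otimes>\<^sub>M lborel)" for n
      unfolding H_def[abs_def] by measurable
    show "(\<lambda>n. H n z) \<longlonglongrightarrow> ennreal ((cmod (V (fst z) (snd z)))\<^sup>2)" for z
    proof -
      have "(\<lambda>n. (cmod (V (fst z) (snd z)))\<^sup>2 * exp (- pi * ((e n *\<^sub>R snd z) \<bullet> (e n *\<^sub>R snd z))))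
          \<longlonglongrightarrow> (cmod (V (fst z) (snd z)))\<^sup>2 * exp (- pi * ((0 *\<^sub>R snd z) \<bullet> (0 *\<^sub>R snd z)))"
        by (intro tendsto_intros e0)
      then show ?thesis unfolding H_def gauss_def by (intro tendsto_ennrealI) simp
    qed
  qed
  define A where "A r = autocorr f r * cnj (autocorr g r)" for r
  have Am [measurable]: "A \<in> borel_measurable borel" unfolding A_def[abs_def] by measurable
  have Hn: "(\<integral>\<^sup>+z. H n z \<partial>(lborel \<Otimes>\<^sub>M lborel)) = ennreal (Re (LINT t|lborel. of_real (gauss t) * A (e n *\<^sub>R t)))" for n
  proof -
    have "(\<integral>\<^sup>+z. H n z \<partial>(lborel \<Otimes>\<^sub>M lborel)) = (\<integral>\<^sup>+x. \<integral>\<^sup>+\<omega>. H n (x, \<omega>) \<partial>lborel \<partial>lborel)"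
      by (rule lborel.nn_integral_fst[symmetric]) (unfold H_def[abs_def], measurable)
    also have "\<dots> = ennreal (Re (LINT r|lborel. of_real (gauss ((1 / e n) *\<^sub>R r) / e n ^ DIM('a)) * A r))"
      unfolding H_def V_def A_def fst_conv snd_conv by (rule gaussian_Moyal[OF f g e(1)])
    also have "(LINT r|lborel. of_real (gauss ((1 / e n) *\<^sub>R r) / e n ^ DIM('a)) * A r)
        = e n ^ DIM('a) *\<^sub>R (LINT t|lborel. of_real (gauss ((1 / e n) *\<^sub>R (e n *\<^sub>R t)) / e n ^ DIM('a)) * A (e n *\<^sub>R t))"
      by (rule lborel_integral_scale[OF _ e(1)]) measurable
    also have "\<dots> = (LINT t|lborel. e n ^ DIM('a) *\<^sub>R (of_real (gauss ((1 / e n) *\<^sub>R (e n *\<^sub>R t)) / e n ^ DIM('a)) * A (e n *\<^sub>R t)))"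
      by (rule integral_scaleR_right[symmetric])
    also have "\<dots> = (LINT t|lborel. of_real (gauss t) * A (e n *\<^sub>R t))"
      using e(1)[of n] by (intro Bochner_Integration.integral_cong refl) (simp add: scaleR_conv_of_real)
    finally show ?thesis .
  qed
  have "(\<lambda>n. LINT t|lborel. of_real (gauss t) * A (e n *\<^sub>R t))
      \<longlonglongrightarrow> (LINT t|lborel. of_real (gauss (t :: 'a)) * complex_of_real (?F * ?G))"
  proof (rule integral_dominated_convergence[where w = "\<lambda>t. gauss t * (?F * ?G)"])
    show "integrable lborel (\<lambda>t::'a. gauss t * (?F * ?G))" using integrable_gauss[where 'a = 'a] by simp
    show "AE t in lborel. (\<lambda>n. of_real (gauss t) * A (e n *\<^sub>R t)) \<longlonglongrightarrow> of_real (gauss (t :: 'a)) * complex_of_real (?F * ?G)"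
    proof (rule AE_I2)
      fix t :: 'a
      have et: "(\<lambda>n. e n *\<^sub>R t) \<longlonglongrightarrow> 0" using tendsto_scaleR[OF e0 tendsto_const[of t]] by simp
      have "(\<lambda>n. of_real (gauss t) * A (e n *\<^sub>R t)) \<longlonglongrightarrow> of_real (gauss t) * (complex_of_real ?F * cnj (complex_of_real ?G))"
        unfolding A_def by (intro tendsto_intros tendsto_cnj autocorr_tendsto f g et)
      then show "(\<lambda>n. of_real (gauss t) * A (e n *\<^sub>R t)) \<longlonglongrightarrow> of_real (gauss t) * complex_of_real (?F * ?G)"
        by simp
    qed
    show "AE t in lborel. norm (of_real (gauss t) * A (e n *\<^sub>R t)) \<le> gauss (t :: 'a) * (?F * ?G)" for n
      by (intro AE_I2)
         (auto simp: norm_mult A_def less_imp_le[OF gauss_pos] abs_of_pos[OF gauss_pos] integral_nonneg_AE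
           intro!: mult_left_mono mult_mono cmod_autocorr_le f g)
  qed measurable
  also have "(LINT t|lborel. of_real (gauss (t :: 'a)) * complex_of_real (?F * ?G)) = complex_of_real (?F * ?G)"
  proof -
    have "(LINT t|lborel. of_real (gauss (t :: 'a)) * complex_of_real (?F * ?G))
      = complex_of_real (LINT t|lborel. gauss (t :: 'a)) * complex_of_real (?F * ?G)"
      by (simp only: integral_mult_left_zero integral_complex_of_real)
    then show ?thesis by (simp add: integral_gauss)
  qed
  finally have "(\<lambda>n. ennreal (Re (LINT t|lborel. of_real (gauss t) * A (e n *\<^sub>R t)))) \<longlonglongrightarrow> ennreal (Re (complex_of_real (?F * ?G)))"
    by (intro tendsto_ennrealI tendsto_Re)
  then have lim2: "(\<lambda>n. \<integral>\<^sup>+z. H n z \<partial>(lborel \<Otimes>\<^sub>M lborel)) \<longlonglongrightarrow> ennreal (?F * ?G)"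
    unfolding Hn by simp
  show ?thesis
    using LIMSEQ_unique[OF lim1 lim2] by (simp add: lborel_prod)
qed

lemma Moyal_identity:
  "(\<integral>\<^sup>+z. ennreal ((cmod (cinner f (tf_shift z g)))\<^sup>2) \<partial>lborel) = ennreal ((norm f)\<^sup>2 * (norm g)\<^sup>2)"
proof -
  have "cinner f (tf_shift z g)
      = fourier (\<lambda>s. rep_L2 f s * cnj (rep_L2 g (s - fst z))) (snd z)" for z
    using cinner_tf_shift_integral[of f "fst z" "snd z" g] by (simp add: fourier_def)
  then show ?thesis
    using Moyal_identity_functions[OF square_integrable_rep[of f] square_integrable_rep[of g]]
    by (simp add: norm_rep)
qed

section \<open>Localization operators\<close>

text \<open>Only the quadratic form and the trace of \<open>S\<close> are recorded through
  \<open>v\<close>; the vectors \<open>v n\<close> may be linearly dependent or zero.\<close>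

locale density_decomposition =
  fixes S :: "'a::euclidean_space L2 \<Rightarrow> 'a L2" and v :: "nat \<Rightarrow> 'a L2"
  assumes positive: "positive_op S"
    and quadratic_sums: "\<And>f. (\<lambda>n. (cmod (cinner f (v n)))\<^sup>2) sums Re (cinner (S f) f)"
    and trace_sums: "(\<lambda>n. (norm (v n))\<^sup>2) sums 1"
begin

definition Q :: "'a L2 \<Rightarrow> 'a \<times> 'a \<Rightarrow> real" where
  "Q f z = (\<Sum>n. (cmod (cinner f (tf_shift z (v n))))\<^sup>2)"

lemma bounded: "bounded_op S"
  using positive by (simp add: positive_op_def)

lemma Q_eq: "Q f z = Re (cinner (S (tf_adj z f)) (tf_adj z f))"
  and Q_sums: "(\<lambda>n. (cmod (cinner f (tf_shift z (v n))))\<^sup>2) sums Q f z"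
  using quadratic_sums[of "tf_adj z f"] unfolding Q_def cinner_tf_shift_right
  by (auto simp: sums_iff)

lemma Q_nonneg: "0 \<le> Q f z"
  unfolding Q_eq by (rule positive_op_cinner_self[OF positive])

text \<open>\<open>cohen\<close> produces pi(-z) f where \<open>Q\<close> has the adjoint of pi(z);
  the two vectors differ by a phase, which a quadratic form ignores.\<close>

lemma cohen_eq_Q: "cohen S f z = of_real (Q f z)"
proof -
  have "(\<lambda>n. (cmod (cinner f (tf_shift z (v n))))\<^sup>2) sums Re (cinner (S (tf_shift (- z) f)) (tf_shift (- z) f))"
    using quadratic_sums[of "tf_shift (- z) f"] by (simp only: cmod_cinner_tf_shift_minus)
  then have "Q f z = Re (cinner (S (tf_shift (- z) f)) (tf_shift (- z) f))"
    using Q_sums sums_unique2 by blast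
  then show ?thesis
    unfolding cohen_eq[OF bounded] by (subst positive_op_cinner_self(1)[OF positive]) simp
qed

lemma cinner_op_shift_self: "cinner (op_shift z S f) f = of_real (Q f z)"
  unfolding cinner_op_shift Q_eq by (rule positive_op_cinner_self[OF positive])

lemma measurable_Q [measurable]: "Q f \<in> borel_measurable borel"
  unfolding Q_def[abs_def] by measurable

lemma ennreal_Q: "ennreal (Q f z) = (\<Sum>n. ennreal ((cmod (cinner f (tf_shift z (v n))))\<^sup>2))"
  by (rule suminf_ennreal_eq[OF _ Q_sums, symmetric]) simp

lemma ennreal_trace: "(\<Sum>n. ennreal (c * (norm (v n))\<^sup>2)) = ennreal c" if "c \<ge> 0"
proof (rule suminf_ennreal_eq)
  show "(\<lambda>n. c * (norm (v n))\<^sup>2) sums c" using sums_mult[OF trace_sums, of c] by simp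
qed (use that in simp)

lemma nn_integral_Q: "(\<integral>\<^sup>+z. ennreal (Q f z) \<partial>lborel) = ennreal ((norm f)\<^sup>2)"
proof -
  have "(\<integral>\<^sup>+z. ennreal (Q f z) \<partial>lborel) = (\<Sum>n. \<integral>\<^sup>+z. ennreal ((cmod (cinner f (tf_shift z (v n))))\<^sup>2) \<partial>lborel)"
    unfolding ennreal_Q by (rule nn_integral_suminf) measurable
  also have "\<dots> = ennreal ((norm f)\<^sup>2)"
    unfolding Moyal_identity by (rule ennreal_trace) simp
  finally show ?thesis .
qed

lemma integrable_Q: "integrable lborel (Q f)"
  by (rule integrableI_bounded) (simp_all add: Q_nonneg nn_integral_Q)

lemma integral_Q: "(LINT z|lborel. Q f z) = (norm f)\<^sup>2"
  using nn_integral_Q[of f] nn_integral_eq_integral[OF integrable_Q[of f]]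
  by (simp add: Q_nonneg integral_nonneg_AE)

lemma sum_Q_le_1:
  fixes h :: "nat \<Rightarrow> 'a L2"
  assumes h: "\<And>j k. cinner (h j) (h k) = (if j = k then 1 else 0)"
  shows "(\<Sum>k<N. Q (h k) z) \<le> 1"
proof (rule sums_le)
  show "(\<lambda>n. \<Sum>k<N. (cmod (cinner (h k) (tf_shift z (v n))))\<^sup>2) sums (\<Sum>k<N. Q (h k) z)"
    by (intro sums_sum Q_sums)
  show "(\<lambda>n. (norm (v n))\<^sup>2) sums 1" by (rule trace_sums)
  fix n
  have inj: "inj_on h {..<N}"
    by (rule inj_onI) (metis h zero_neq_one)
  have "(\<Sum>k<N. (cmod (cinner (h k) (tf_shift z (v n))))\<^sup>2) = (\<Sum>e\<in>h ` {..<N}. (cmod (cinner (tf_shift z (v n)) e))\<^sup>2)"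
    unfolding sum.reindex[OF inj] o_def by (simp only: cmod_cinner_commute)
  also have "\<dots> \<le> (norm (tf_shift z (v n)))\<^sup>2"
  proof (rule Bessel_inequality[OF _ order_refl])
    show "orthonormal (h ` {..<N})"
      unfolding orthonormal_def
    proof (intro ballI)
      fix e e' assume "e \<in> h ` {..<N}" "e' \<in> h ` {..<N}"
      then obtain j k where jk: "j < N" "k < N" "e = h j" "e' = h k" by blast
      then have "e = e' \<longleftrightarrow> j = k" using inj by (auto simp: inj_on_def)
      then show "cinner e e' = (if e = e' then 1 else 0)" using jk h by simp
    qed
  qed simp
  finally show "(\<Sum>k<N. (cmod (cinner (h k) (tf_shift z (v n))))\<^sup>2) \<le> (norm (v n))\<^sup>2" by simp
qed

text \<open>Besides the values at f and g, those at f + g and f + i g suffice. Measurability and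
  integrability of all matrix elements thereby reduce to \<open>Q\<close>.\<close>

lemma polarization:
  "cinner (op_shift z S f) g = (of_real (Q (f + g) z) + \<i> * of_real (Q (f + \<i> *\<^sub>C g) z)
    - (1 + \<i>) * (of_real (Q f z) + of_real (Q g z))) / 2"
  unfolding cinner_op_shift_self[symmetric]
  by (simp add: cinner_op_shift tf_adj_add tf_adj_scaleC bounded_op_add[OF bounded]
      bounded_op_scaleC[OF bounded] cinner_add_left cinner_add_right cinner_scaleC_left
      cinner_scaleC_right field_simps)

lemma integrable_cinner_op_shift: "integrable lborel (\<lambda>z. cinner (op_shift z S f) g)"
  unfolding polarization using integrable_Q by simp

text \<open>Shows that the description in \<open>fun_op_conv\<close> denotes: existence comes from a
  bounded sesquilinear form, uniqueness from the matrix elements.\<close>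

lemma fun_op_conv_properties:
  assumes D: "D \<in> sets borel" "emeasure lborel D < \<infinity>"
  shows "bounded_op (fun_op_conv (indicator D) S)"
    and "cinner (fun_op_conv (indicator D) S f) g = (LINT z|lborel. indicator D z * cinner (op_shift z S f) g)"
proof -
  define B where "B f g = (LINT z|lborel. indicator D z * cinner (op_shift z S f) g)" for f g
  have int: "integrable lborel (\<lambda>z. indicator D z * cinner (op_shift z S f) g)" for f g
    by (rule Bochner_Integration.integrable_bound[OF integrable_cinner_op_shift[of f g]])
       (use D integrable_cinner_op_shift[of f g] in \<open>auto simp: indicator_def\<close>)
  obtain K where K: "\<And>f. norm (S f) \<le> norm f * K"
    using bounded bounded_linear.bounded unfolding bounded_op_def by blast
  have iD: "integrable lborel (indicator D :: _ \<Rightarrow> real)"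
    using D by (simp add: integrable_indicator_iff)
  have "cmod (B f g) \<le> (measure lborel D * K) * norm f * norm g" for f g
  proof -
    have "cmod (B f g) \<le> (LINT z|lborel. cmod (indicator D z * cinner (op_shift z S f) g))"
      unfolding B_def by (rule integral_norm_bound)
    also have "\<dots> \<le> (LINT z|lborel. indicator D z * (K * norm f * norm g))"
    proof (rule integral_mono)
      fix z
      have "cmod (cinner (op_shift z S f) g) \<le> norm (S (tf_adj z f)) * norm (tf_adj z g)"
        unfolding cinner_op_shift by (rule Cauchy_Schwarz_cinner)
      also have "\<dots> \<le> K * norm f * norm g"
        using mult_right_mono[OF K[of "tf_adj z f"], of "norm g"] by (simp add: mult_ac)
      finally show "cmod (indicator D z * cinner (op_shift z S f) g) \<le> indicator D z * (K * norm f * norm g)"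
        by (simp add: indicator_def)
    qed (use iD int in auto)
    also have "\<dots> = (measure lborel D * K) * norm f * norm g" using D by simp
    finally show ?thesis .
  qed
  moreover have "B (f + f') g = B f g + B f' g" for f f' g
    unfolding B_def
    by (subst Bochner_Integration.integral_add[symmetric, OF int int])
       (simp add: cinner_op_shift tf_adj_add bounded_op_add[OF bounded] cinner_add_left distrib_left)
  moreover have "B f (g + g') = B f g + B f g'" for f g g'
    unfolding B_def
    by (subst Bochner_Integration.integral_add[symmetric, OF int int])
       (simp add: cinner_op_shift tf_adj_add cinner_add_right distrib_left)
  moreover have "B (c *\<^sub>C f) g = c * B f g" for c f g
    unfolding B_def integral_mult_right_zero[symmetric]
    by (simp add: cinner_op_shift tf_adj_scaleC bounded_op_scaleC[OF bounded] cinner_scaleC_left mult_ac)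
  moreover have "B f (c *\<^sub>C g) = cnj c * B f g" for c f g
    unfolding B_def integral_mult_right_zero[symmetric]
    by (simp add: cinner_op_shift tf_adj_scaleC cinner_scaleC_right mult_ac)
  ultimately obtain T where T: "bounded_op T" "\<And>f g. cinner (T f) g = B f g"
    using bounded_op_of_sesquilinear_form[of B "measure lborel D * K"] by metis
  have "fun_op_conv (indicator D) S = T"
    unfolding fun_op_conv_def
  proof (rule the_equality)
    fix T' assume "bounded_op T' \<and> (\<forall>\<phi> \<psi>. cinner (T' \<phi>) \<psi> = (LINT z|lborel. indicator D z * cinner (op_shift z S \<phi>) \<psi>))"
    then show "T' = T" by (intro ext cinner_eqI) (simp add: T(2) B_def)
  qed (simp add: T B_def)
  then show "bounded_op (fun_op_conv (indicator D) S)"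
    and "cinner (fun_op_conv (indicator D) S f) g = (LINT z|lborel. indicator D z * cinner (op_shift z S f) g)"
    by (simp_all add: T B_def)
qed

lemma integrable_indicator_Q:
  "D \<in> sets borel \<Longrightarrow> integrable lborel (\<lambda>z. indicator D z * Q f z)"
  using integrable_mult_indicator[OF _ integrable_Q[of f], of D] by simp

lemma cinner_fun_op_conv_self:
  assumes D: "D \<in> sets borel" "emeasure lborel D < \<infinity>"
  shows "cinner (fun_op_conv (indicator D) S f) f = of_real (LINT z|lborel. indicator D z * Q f z)"
proof -
  have "indicator D z * cinner (op_shift z S f) f = complex_of_real (indicator D z * Q f z)" for z
    unfolding cinner_op_shift_self by (simp add: indicator_def)
  then show ?thesis
    unfolding fun_op_conv_properties(2)[OF D] by (simp only: integral_complex_of_real)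
qed

text \<open>This is tr(S alpha_w(S)), the convolution of \<open>S\<close> with its reflection.
  Values in \<open>ennreal\<close> keep the double series free of convergence questions.\<close>

definition G :: "'a \<times> 'a \<Rightarrow> ennreal" where
  "G w = (\<Sum>n. \<Sum>m. ennreal ((cmod (cinner (v n) (tf_shift w (v m))))\<^sup>2))"

lemma measurable_G [measurable]: "G \<in> borel_measurable borel"
  unfolding G_def[abs_def] by measurable

lemma nn_integral_G: "(\<integral>\<^sup>+w. G w \<partial>lborel) = 1"
proof -
  have "(\<integral>\<^sup>+w. G w \<partial>lborel) = (\<Sum>n. \<integral>\<^sup>+w. ennreal (Q (v n) w) \<partial>lborel)"
    unfolding G_def ennreal_Q[symmetric] by (rule nn_integral_suminf) measurable
  also have "\<dots> = (\<Sum>n. ennreal (1 * (norm (v n))\<^sup>2))"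
    by (simp add: nn_integral_Q)
  also have "\<dots> = 1" by (subst ennreal_trace) auto
  finally show ?thesis .
qed

lemma sum_Q_tf_shift: "(\<Sum>n. ennreal (Q (tf_shift z (v n)) w)) = G (w - z)"
  unfolding G_def ennreal_Q cmod_cinner_tf_shift_tf_shift ..

end

section \<open>Overlap of a set with its translates\<close>

definition overlap :: "'b::euclidean_space set \<Rightarrow> 'b \<Rightarrow> real" where
  "overlap D w = (LINT z|lborel. indicator D z * indicator D (z + w))"

lemma overlap_nonneg: "0 \<le> overlap D w"
  unfolding overlap_def by (intro integral_nonneg_AE AE_I2) simp

lemma measurable_overlap [measurable]:
  fixes D :: "'b::euclidean_space set"
  assumes [measurable]: "D \<in> sets borel"
  shows "overlap D \<in> borel_measurable borel"
  unfolding overlap_def[abs_def]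
  by (intro lborel.borel_measurable_lebesgue_integral) measurable

lemma integrable_overlap:
  fixes D :: "'b::euclidean_space set"
  assumes D: "D \<in> sets borel" "emeasure lborel D < \<infinity>"
  shows "integrable lborel (\<lambda>z. indicator D z * indicator D (z + w) :: real)"
proof (rule Bochner_Integration.integrable_bound)
  have [measurable]: "D \<in> sets borel" by (fact D)
  show "integrable lborel (indicator D :: _ \<Rightarrow> real)" using D by (simp add: integrable_indicator_iff)
  show "(\<lambda>z. indicator D z * indicator D (z + w) :: real) \<in> borel_measurable lborel" by measurable
qed (auto simp: indicator_def)

lemma overlap_le:
  fixes D :: "'b::euclidean_space set"
  assumes D: "D \<in> sets borel" "emeasure lborel D < \<infinity>"
  shows "overlap D w \<le> measure lborel D"
proof -
  have iD: "integrable lborel (indicator D :: _ \<Rightarrow> real)"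
    using D by (simp add: integrable_indicator_iff)
  have "overlap D w \<le> (LINT z|lborel. indicator D z)"
    unfolding overlap_def
    by (rule integral_mono[OF integrable_overlap[OF D] iD]) (simp add: indicator_def)
  then show ?thesis using D by simp
qed

lemma overlap_tendsto:
  fixes D :: "'b::euclidean_space set"
  assumes D: "D \<in> sets borel" "emeasure lborel D < \<infinity>" and a: "a \<longlonglongrightarrow> 0"
  shows "(\<lambda>n. overlap D (a n)) \<longlonglongrightarrow> measure lborel D"
proof -
  have iD: "integrable lborel (indicator D :: _ \<Rightarrow> real)"
    using D by (simp add: integrable_indicator_iff)
  have "(\<lambda>n. - a n) \<longlonglongrightarrow> 0" using tendsto_minus[OF a] by simp
  from L1_translation_continuous[OF iD this]
  have lim: "(\<lambda>n. LINT z|lborel. norm (indicator D (z + a n) - indicator D z :: real)) \<longlonglongrightarrow> 0"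
    by simp
  have "norm (overlap D w - measure lborel D) \<le> (LINT z|lborel. norm (indicator D (z + w) - indicator D z :: real))" for w
  proof -
    have iw: "integrable lborel (\<lambda>z. indicator D (z + w) :: real)"
      using lborel_integrable_shift[OF iD, of "- w"] by simp
    have "overlap D w - measure lborel D = (LINT z|lborel. indicator D z * indicator D (z + w) - indicator D z)"
      unfolding overlap_def using D iD integrable_overlap[OF D, of w] by simp
    also have "norm \<dots> \<le> (LINT z|lborel. norm (indicator D z * indicator D (z + w) - indicator D z :: real))"
      by (rule integral_norm_bound)
    also have "\<dots> \<le> (LINT z|lborel. norm (indicator D (z + w) - indicator D z :: real))"
    proof (rule integral_mono)
      show "norm (indicator D z * indicator D (z + w) - indicator D z :: real)
          \<le> norm (indicator D (z + w) - indicator D z :: real)" for z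
        by (simp add: indicator_def)
    qed (use iD iw integrable_overlap[OF D, of w] in simp_all)
    finally show ?thesis .
  qed
  then have "(\<lambda>n. overlap D (a n) - measure lborel D) \<longlonglongrightarrow> 0"
    by (intro Lim_null_comparison[OF always_eventually lim]) simp
  then show ?thesis by (rule LIM_zero_cancel)
qed

lemma ennreal_suminf_swap:
  fixes a :: "nat \<Rightarrow> nat \<Rightarrow> ennreal"
  shows "(\<Sum>i. \<Sum>j. a i j) = (\<Sum>j. \<Sum>i. a i j)"
  using nn_integral_suminf[of "\<lambda>j i. a i j" "count_space UNIV"]
  by (simp add: nn_integral_count_space_nat)

text \<open>Compare with the threshold m = \<open>lam A\<close>, the first value left out of the
  partial sum. Below index A, (lam k - m) (1 - lam k) >= 0 gives (lam k)^2 <= (1 + m) lam k - m;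
  from A on, (lam k)^2 <= m lam k. In the total, m multiplies a sum of the lam k minus A, which is
  at most 0.\<close>

lemma sum_squares_le_partial_sum:
  fixes lam :: "nat \<Rightarrow> real"
  assumes dec: "decseq lam" and lam: "\<And>k. 0 \<le> lam k" "\<And>k. lam k \<le> 1"
    and A: "\<And>N. (\<Sum>k<N. lam k) \<le> real A"
  shows "(\<Sum>k<N. (lam k)\<^sup>2) \<le> (\<Sum>k<A. lam k)"
proof -
  define m where "m = lam A"
  define M where "M = max N A"
  have split: "{..<M} = {..<A} \<union> {A..<M}" "{..<A} \<inter> {A..<M} = {}" by (auto simp: M_def)
  have "(\<Sum>k<N. (lam k)\<^sup>2) \<le> (\<Sum>k<M. (lam k)\<^sup>2)"
    by (rule sum_mono2) (auto simp: M_def)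
  also have "\<dots> = (\<Sum>k<A. (lam k)\<^sup>2) + (\<Sum>k\<in>{A..<M}. (lam k)\<^sup>2)"
    unfolding split(1) by (rule sum.union_disjoint) (auto simp: split(2))
  also have "\<dots> \<le> (\<Sum>k<A. (1 + m) * lam k - m) + (\<Sum>k\<in>{A..<M}. m * lam k)"
  proof (intro add_mono sum_mono)
    fix k assume "k \<in> {..<A}"
    then have "m \<le> lam k" using dec by (simp add: m_def decseqD)
    then have "0 \<le> (lam k - m) * (1 - lam k)" using lam by simp
    then show "(lam k)\<^sup>2 \<le> (1 + m) * lam k - m" by (simp add: algebra_simps power2_eq_square)
  next
    fix k assume "k \<in> {A..<M}"
    then have "lam k \<le> m" using dec by (simp add: m_def decseqD)
    then show "(lam k)\<^sup>2 \<le> m * lam k" using lam[of k] by (simp add: power2_eq_square mult_right_mono)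
  qed
  also have "\<dots> = (\<Sum>k<A. lam k) + m * ((\<Sum>k<A. lam k) + (\<Sum>k\<in>{A..<M}. lam k) - A)"
    by (simp add: sum_subtractf algebra_simps sum_distrib_left sum.distrib)
  also have "(\<Sum>k<A. lam k) + (\<Sum>k\<in>{A..<M}. lam k) = (\<Sum>k<M. lam k)"
    unfolding split(1) by (rule sum.union_disjoint[symmetric]) (auto simp: split(2))
  also have "(\<Sum>k<A. lam k) + m * ((\<Sum>k<M. lam k) - A) \<le> (\<Sum>k<A. lam k)"
    using A[of M] lam(1)[of A] by (simp add: m_def mult_nonneg_nonpos)
  finally show ?thesis .
qed

section \<open>Eigenvalues of a localization operator\<close>

context density_decomposition
begin

context
  fixes D :: "('a \<times> 'a) set" and lam :: "nat \<Rightarrow> real" and h :: "nat \<Rightarrow> 'a L2"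
  assumes D: "D \<in> sets borel" "emeasure lborel D < \<infinity>"
    and eig: "eigensystem (fun_op_conv (indicator D) S) lam h"
begin

lemma h_orth: "cinner (h j) (h k) = (if j = k then 1 else 0)"
  using eig by (simp add: eigensystem_def)

lemma norm_h: "norm (h k) = 1"
proof -
  have "complex_of_real ((norm (h k))\<^sup>2) = of_real 1"
    unfolding cinner_self[symmetric] by (simp add: h_orth)
  then have "(norm (h k))\<^sup>2 = 1" by (simp only: of_real_eq_iff)
  then show ?thesis by (simp add: power2_eq_1_iff)
      (metis norm_ge_zero le_minus_one_simps(3))
qed

lemma lam_eq: "lam k = (LINT z|lborel. indicator D z * Q (h k) z)"
proof -
  have "fun_op_conv (indicator D) S (h k) = lam k *\<^sub>R h k"
    using eig by (simp add: eigensystem_def)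
  then have "complex_of_real (lam k) = cinner (fun_op_conv (indicator D) S (h k)) (h k)"
    by (simp add: cinner_scaleR_left h_orth)
  also have "\<dots> = of_real (LINT z|lborel. indicator D z * Q (h k) z)"
    by (rule cinner_fun_op_conv_self[OF D])
  finally show ?thesis by (simp only: of_real_eq_iff)
qed

lemma lam_nonneg: "0 \<le> lam k"
  unfolding lam_eq by (intro integral_nonneg_AE AE_I2) (simp add: Q_nonneg)

lemma lam_le_1: "lam k \<le> 1"
proof -
  have "lam k \<le> (LINT z|lborel. Q (h k) z)"
    unfolding lam_eq
    by (rule integral_mono[OF integrable_indicator_Q[OF D(1)] integrable_Q])
       (auto simp: indicator_def Q_nonneg)
  then show ?thesis by (simp add: integral_Q norm_h)
qed

lemma sum_lam_eq: "(\<Sum>k<N. lam k) = (LINT z|lborel. indicator D z * (\<Sum>k<N. Q (h k) z))"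
  unfolding lam_eq sum_distrib_left
  by (rule Bochner_Integration.integral_sum[symmetric]) (rule integrable_indicator_Q[OF D(1)])

lemma sum_lam_le: "(\<Sum>k<N. lam k) \<le> measure lborel D"
proof -
  have "(\<Sum>k<N. lam k) \<le> (LINT z|lborel. indicator D z)"
    unfolding sum_lam_eq
  proof (rule integral_mono)
    show "integrable lborel (\<lambda>z. indicator D z * (\<Sum>k<N. Q (h k) z))"
      unfolding sum_distrib_left
      by (intro Bochner_Integration.integrable_sum integrable_indicator_Q D)
    show "indicator D z * (\<Sum>k<N. Q (h k) z) \<le> indicator D z" for z
      using sum_Q_le_1[OF h_orth, where N = N and z = z] by (simp add: indicator_def)
  qed (use D in \<open>simp add: integrable_indicator_iff\<close>)
  then show ?thesis using D by simp
qed

lemma nn_lam_eq: "ennreal (lam k) = (\<integral>\<^sup>+z. indicator D z * ennreal (Q (h k) z) \<partial>lborel)"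
proof -
  have "(\<integral>\<^sup>+z. indicator D z * ennreal (Q (h k) z) \<partial>lborel) = (\<integral>\<^sup>+z. ennreal (indicator D z * Q (h k) z) \<partial>lborel)"
    by (intro nn_integral_cong) (simp add: indicator_def)
  also have "\<dots> = ennreal (lam k)"
    unfolding lam_eq by (intro nn_integral_eq_integral integrable_indicator_Q D AE_I2) (simp add: Q_nonneg)
  finally show ?thesis by simp
qed

text \<open>The rank-one expansion in \<open>eigensystem\<close> enters here: it evaluates the
  quadratic form of the localization operator at an arbitrary vector.\<close>

lemma nn_quadratic_eq:
  "(\<Sum>k. ennreal (lam k) * ennreal ((cmod (cinner f (h k)))\<^sup>2)) = (\<integral>\<^sup>+z. indicator D z * ennreal (Q f z) \<partial>lborel)"
proof -
  have "(\<lambda>k. lam k *\<^sub>R rank_one (h k) (h k) f) sums fun_op_conv (indicator D) S f"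
    using eig by (simp add: eigensystem_def)
  then have "(\<lambda>k. cinner (lam k *\<^sub>R rank_one (h k) (h k) f) f) sums cinner (fun_op_conv (indicator D) S f) f"
    by (rule bounded_linear.sums[OF bounded_linear_cinner_left])
  moreover have "cinner (lam k *\<^sub>R rank_one (h k) (h k) f) f = of_real (lam k * (cmod (cinner f (h k)))\<^sup>2)" for k
    by (simp add: rank_one_def cinner_scaleR_left cinner_scaleC_left cinner_mult_commuted)
  ultimately have "(\<lambda>k. complex_of_real (lam k * (cmod (cinner f (h k)))\<^sup>2))
      sums of_real (LINT z|lborel. indicator D z * Q f z)"
    by (simp only: cinner_fun_op_conv_self[OF D])
  then have "(\<lambda>k. lam k * (cmod (cinner f (h k)))\<^sup>2) sums (LINT z|lborel. indicator D z * Q f z)"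
    by (simp only: sums_of_real_iff)
  then have "(\<Sum>k. ennreal (lam k * (cmod (cinner f (h k)))\<^sup>2)) = ennreal (LINT z|lborel. indicator D z * Q f z)"
    by (rule suminf_ennreal_eq[rotated]) (simp add: lam_nonneg)
  also have "\<dots> = (\<integral>\<^sup>+z. ennreal (indicator D z * Q f z) \<partial>lborel)"
    by (intro nn_integral_eq_integral[symmetric] integrable_indicator_Q D AE_I2) (simp add: Q_nonneg)
  also have "\<dots> = (\<integral>\<^sup>+z. indicator D z * ennreal (Q f z) \<partial>lborel)"
    by (intro nn_integral_cong) (simp add: indicator_def)
  finally show ?thesis by (simp add: ennreal_mult lam_nonneg)
qed

lemma ennreal_overlap: "(\<integral>\<^sup>+z. indicator D z * indicator D (z + w) \<partial>lborel) = ennreal (overlap D w)"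
proof -
  have "(\<integral>\<^sup>+z. ennreal (indicator D z * indicator D (z + w)) \<partial>lborel) = ennreal (overlap D w)"
    unfolding overlap_def by (intro nn_integral_eq_integral integrable_overlap[OF D]) auto
  moreover have "ennreal (indicator D z * indicator D (z + w)) = indicator D z * indicator D (z + w)" for z
    by (simp add: indicator_def)
  ultimately show ?thesis by simp
qed

text \<open>Both sides are the squared Hilbert--Schmidt norm of the localization operator.\<close>

lemma suminf_lam_squared:
  "(\<Sum>k. ennreal ((lam k)\<^sup>2)) = (\<integral>\<^sup>+w. G w * ennreal (overlap D w) \<partial>lborel)"
proof -
  have [measurable]: "D \<in> sets borel" by (fact D)
  have "(\<Sum>k. ennreal ((lam k)\<^sup>2)) = (\<Sum>k. \<integral>\<^sup>+z. indicator D z * (\<Sum>n. ennreal (lam k)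
      * ennreal ((cmod (cinner (h k) (tf_shift z (v n))))\<^sup>2)) \<partial>lborel)"
  proof (rule suminf_cong)
    fix k
    \<comment> \<open>One factor \<open>lam k\<close> becomes the mass of \<open>Q (h k)\<close> on
      \<open>D\<close>; the other is kept as a weight for the eigenexpansion.\<close>
    have "ennreal ((lam k)\<^sup>2) = ennreal (lam k) * (\<integral>\<^sup>+z. indicator D z * ennreal (Q (h k) z) \<partial>lborel)"
      unfolding nn_lam_eq[symmetric] power2_eq_square by (simp add: ennreal_mult lam_nonneg)
    also have "\<dots> = (\<integral>\<^sup>+z. ennreal (lam k) * (indicator D z * ennreal (Q (h k) z)) \<partial>lborel)"
      by (rule nn_integral_cmult[symmetric]) measurable
    also have "\<dots> = (\<integral>\<^sup>+z. indicator D z * (\<Sum>n. ennreal (lam k)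
      * ennreal ((cmod (cinner (h k) (tf_shift z (v n))))\<^sup>2)) \<partial>lborel)"
      by (intro nn_integral_cong) (simp only: ennreal_Q ennreal_suminf_cmult, rule mult.left_commute)
    finally show "ennreal ((lam k)\<^sup>2) = \<dots>" .
  qed
  also have "\<dots> = (\<integral>\<^sup>+z. (\<Sum>k. indicator D z * (\<Sum>n. ennreal (lam k)
      * ennreal ((cmod (cinner (h k) (tf_shift z (v n))))\<^sup>2))) \<partial>lborel)"
    by (rule nn_integral_suminf[symmetric]) measurable
  also have "\<dots> = (\<integral>\<^sup>+z. indicator D z * (\<Sum>n. \<Sum>k. ennreal (lam k)
      * ennreal ((cmod (cinner (tf_shift z (v n)) (h k)))\<^sup>2)) \<partial>lborel)"
  proof (rule nn_integral_cong)
    fix z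
    have sym: "cmod (cinner (h k) (tf_shift z (v n))) = cmod (cinner (tf_shift z (v n)) (h k))" for k n
      by (rule cmod_cinner_commute)
    show "(\<Sum>k. indicator D z * (\<Sum>n. ennreal (lam k) * ennreal ((cmod (cinner (h k) (tf_shift z (v n))))\<^sup>2)))
        = indicator D z * (\<Sum>n. \<Sum>k. ennreal (lam k) * ennreal ((cmod (cinner (tf_shift z (v n)) (h k)))\<^sup>2))"
      unfolding sym by (rule trans[OF ennreal_suminf_cmult]) (rule arg_cong[OF ennreal_suminf_swap])
  qed
  also have "\<dots> = (\<integral>\<^sup>+z. indicator D z * (\<integral>\<^sup>+z'. indicator D z' * G (z' - z) \<partial>lborel) \<partial>lborel)"
  proof (rule nn_integral_cong)
    fix z
    \<comment> \<open>\<open>nn_quadratic_eq\<close> at the vector pi(z) v_n absorbs the remaining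
      weight. After summation over n, covariance of \<open>Q\<close> leaves a function of z' - z
      alone.\<close>
    have "(\<Sum>n. \<Sum>k. ennreal (lam k) * ennreal ((cmod (cinner (tf_shift z (v n)) (h k)))\<^sup>2))
        = (\<integral>\<^sup>+z'. (\<Sum>n. indicator D z' * ennreal (Q (tf_shift z (v n)) z')) \<partial>lborel)"
      unfolding nn_quadratic_eq by (rule nn_integral_suminf[symmetric]) measurable
    then show "indicator D z * (\<Sum>n. \<Sum>k. ennreal (lam k) * ennreal ((cmod (cinner (tf_shift z (v n)) (h k)))\<^sup>2))
        = indicator D z * (\<integral>\<^sup>+z'. indicator D z' * G (z' - z) \<partial>lborel)"
      by (simp add: ennreal_suminf_cmult sum_Q_tf_shift)
  qed
  also have "\<dots> = (\<integral>\<^sup>+z. \<integral>\<^sup>+w. G w * (indicator D z * indicator D (z + w)) \<partial>lborel \<partial>lborel)"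
  proof (rule nn_integral_cong)
    fix z
    have "(\<integral>\<^sup>+z'. indicator D z' * G (z' - z) \<partial>lborel)
        = (\<integral>\<^sup>+w. indicator D (z + 1 *\<^sub>R w) * G (z + 1 *\<^sub>R w - z) \<partial>lborel)"
      by (rule lborel_nn_integral_affine[symmetric]) auto
    also have "\<dots> = (\<integral>\<^sup>+w. G w * indicator D (z + w) \<partial>lborel)" by (simp add: mult.commute)
    finally show "indicator D z * (\<integral>\<^sup>+z'. indicator D z' * G (z' - z) \<partial>lborel)
        = (\<integral>\<^sup>+w. G w * (indicator D z * indicator D (z + w)) \<partial>lborel)"
      by (simp add: mult.left_commute nn_integral_cmult)
  qed
  also have "\<dots> = (\<integral>\<^sup>+w. \<integral>\<^sup>+z. G w * (indicator D z * indicator D (z + w)) \<partial>lborel \<partial>lborel)"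
    by (rule lborel_pair.Fubini') measurable
  also have "\<dots> = (\<integral>\<^sup>+w. G w * ennreal (overlap D w) \<partial>lborel)"
    by (intro nn_integral_cong) (simp add: nn_integral_cmult ennreal_overlap)
  finally show ?thesis .
qed

text \<open>The ceiling contributes the constant 1: the masses |D| and \<open>A\<close> add up to at
  most 2 |D| + 1.\<close>

lemma accumulated_deviation:
  defines "A \<equiv> nat \<lceil>measure lborel D\<rceil>"
  defines "\<rho> \<equiv> \<lambda>z. \<Sum>k<A. cohen S (h k) z"
  shows "integrable lborel (\<lambda>z. \<rho> z - indicator D z)"
    and "(LINT z|lborel. cmod (\<rho> z - indicator D z))
      \<le> 2 * measure lborel D + 1 - 2 * enn2real (\<integral>\<^sup>+w. G w * ennreal (overlap D w) \<partial>lborel)"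
proof -
  let ?r = "\<lambda>z. \<Sum>k<A. Q (h k) z"
  have iD: "integrable lborel (indicator D :: _ \<Rightarrow> real)"
    using D by (simp add: integrable_indicator_iff)
  have ir: "integrable lborel ?r" by (intro Bochner_Integration.integrable_sum integrable_Q)
  have iDr: "integrable lborel (\<lambda>z. indicator D z * ?r z)"
    unfolding sum_distrib_left by (intro Bochner_Integration.integrable_sum integrable_indicator_Q D)
  have eq: "\<rho> z - indicator D z = complex_of_real (?r z - indicator D z)" for z
    unfolding \<rho>_def cohen_eq_Q by (simp add: indicator_def)
  show "integrable lborel (\<lambda>z. \<rho> z - indicator D z)"
    unfolding eq using ir iD by (intro integrable_of_real Bochner_Integration.integrable_diff)
  have "0 \<le> measure lborel D" by simp
  then have A: "measure lborel D \<le> A" "A \<le> measure lborel D + 1"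
    unfolding A_def by linarith+
  define P where "P = (\<Sum>k<A. lam k)"
  have "(\<Sum>k<N. (lam k)\<^sup>2) \<le> P" for N
    unfolding P_def
    using eig lam_nonneg lam_le_1 order_trans[OF sum_lam_le A(1)]
    by (intro sum_squares_le_partial_sum) (auto simp: eigensystem_def)
  then have "(\<Sum>k. ennreal ((lam k)\<^sup>2)) \<le> ennreal P"
    by (intro suminf_le_const summableI) (simp add: sum_ennreal ennreal_leI)
  then have "(\<integral>\<^sup>+w. G w * ennreal (overlap D w) \<partial>lborel) \<le> ennreal P"
    unfolding suminf_lam_squared .
  then have P: "enn2real (\<integral>\<^sup>+w. G w * ennreal (overlap D w) \<partial>lborel) \<le> P"
    by (intro enn2real_leI) (simp_all add: P_def sum_nonneg lam_nonneg)
  \<comment> \<open>The sum lies in [0, 1], so the modulus is 1 minus the sum on \<open>D\<close>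
    and the sum itself off \<open>D\<close>; no absolute value survives.\<close>
  have "cmod (\<rho> z - indicator D z) = ?r z + indicator D z - 2 * (indicator D z * ?r z)" for z
    unfolding eq norm_of_real
    using sum_Q_le_1[OF h_orth, where N = A and z = z] sum_nonneg[of "{..<A}" "\<lambda>k. Q (h k) z"]
    by (auto simp: indicator_def Q_nonneg)
  then have "(LINT z|lborel. cmod (\<rho> z - indicator D z))
      = (LINT z|lborel. ?r z + indicator D z - 2 * (indicator D z * ?r z))" by simp
  also have "\<dots> = (LINT z|lborel. ?r z) + (LINT z|lborel. indicator D z) - 2 * (LINT z|lborel. indicator D z * ?r z)"
    using ir iD iDr by simp
  also have "(LINT z|lborel. ?r z) = A"
    by (subst Bochner_Integration.integral_sum) (simp_all add: integrable_Q integral_Q norm_h)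
  also have "(LINT z|lborel. indicator D z) = measure lborel D" using D by simp
  also have "(LINT z|lborel. indicator D z * ?r z) = P"
    unfolding P_def by (rule sum_lam_eq[symmetric])
  finally show "(LINT z|lborel. cmod (\<rho> z - indicator D z))
      \<le> 2 * measure lborel D + 1 - 2 * enn2real (\<integral>\<^sup>+w. G w * ennreal (overlap D w) \<partial>lborel)"
    using A P by linarith
qed

end

end

section \<open>Dilations\<close>

lemma indicator_scaleR_image:
  "R > 0 \<Longrightarrow> indicator ((*\<^sub>R) R ` D) (R *\<^sub>R z) = (indicator D z :: 'c::zero_neq_one)"
  for z :: "'b::real_vector"
  by (auto simp: indicator_def)

lemma measure_scaleR_image:
  fixes D :: "'b::euclidean_space set"
  assumes D: "compact D" and R: "R > 0"
  shows "measure lborel ((*\<^sub>R) R ` D) = R ^ DIM('b) * measure lborel D"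
proof -
  have [measurable]: "D \<in> sets borel" "(*\<^sub>R) R ` D \<in> sets borel"
    using D compact_scaling[OF D, of R] by (auto simp: compact_imp_closed)
  have "measure lborel ((*\<^sub>R) R ` D) = (LINT z|lborel. indicator ((*\<^sub>R) R ` D) z)"
    by simp
  also have "\<dots> = R ^ DIM('b) *\<^sub>R (LINT z|lborel. indicator ((*\<^sub>R) R ` D) (R *\<^sub>R z))"
    by (rule lborel_integral_scale[OF _ R]) measurable
  finally show ?thesis by (simp add: indicator_scaleR_image[OF R])
qed

lemma overlap_scaleR_image:
  fixes D :: "'b::euclidean_space set"
  assumes D: "compact D" and R: "R > 0"
  shows "overlap ((*\<^sub>R) R ` D) w = R ^ DIM('b) * overlap D ((1 / R) *\<^sub>R w)"
proof -
  have [measurable]: "D \<in> sets borel" "(*\<^sub>R) R ` D \<in> sets borel"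
    using D compact_scaling[OF D, of R] by (auto simp: compact_imp_closed)
  have "overlap ((*\<^sub>R) R ` D) w
      = R ^ DIM('b) *\<^sub>R (LINT z|lborel. indicator ((*\<^sub>R) R ` D) (R *\<^sub>R z) * indicator ((*\<^sub>R) R ` D) (R *\<^sub>R z + w))"
    unfolding overlap_def by (rule lborel_integral_scale[OF _ R]) measurable
  also have "(\<lambda>z. indicator ((*\<^sub>R) R ` D) (R *\<^sub>R z) * indicator ((*\<^sub>R) R ` D) (R *\<^sub>R z + w) :: real)
      = (\<lambda>z. indicator D z * indicator D (z + (1 / R) *\<^sub>R w))"
  proof
    fix z
    have "R *\<^sub>R z + w = R *\<^sub>R (z + (1 / R) *\<^sub>R w)" using R by (simp add: scaleR_add_right)
    then show "indicator ((*\<^sub>R) R ` D) (R *\<^sub>R z) * indicator ((*\<^sub>R) R ` D) (R *\<^sub>R z + w)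
        = (indicator D z * indicator D (z + (1 / R) *\<^sub>R w) :: real)"
      by (simp only: indicator_scaleR_image[OF R])
  qed
  finally show ?thesis by (simp add: overlap_def)
qed

context density_decomposition
begin

text \<open>For R > 0, the squared Hilbert-Schmidt norm belonging to the dilated domain, divided by
  the factor that dilation puts on volumes.\<close>

definition smoothed_mass :: "('a \<times> 'a) set \<Rightarrow> real \<Rightarrow> real" where
  "smoothed_mass D R = enn2real (\<integral>\<^sup>+w. G w * ennreal (overlap D ((1 / R) *\<^sub>R w)) \<partial>lborel)"

lemma smoothed_mass_tendsto:
  assumes D: "compact D"
  shows "(smoothed_mass D \<longlongrightarrow> measure lborel D) at_top"
proof (rule tendsto_at_topI_sequentially)
  fix X :: "nat \<Rightarrow> real" assume X: "filterlim X at_top sequentially"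
  have D': "D \<in> sets borel" "emeasure lborel D < \<infinity>"
    by (rule borel_compact[OF D], rule emeasure_compact_finite[OF D])
  have [measurable]: "D \<in> sets borel" by (fact D')
  have "(\<lambda>n. \<integral>\<^sup>+w. G w * ennreal (overlap D ((1 / X n) *\<^sub>R w)) \<partial>lborel)
      \<longlonglongrightarrow> (\<integral>\<^sup>+w. G w * ennreal (measure lborel D) \<partial>lborel)"
  proof (rule nn_integral_dominated_convergence[where w = "\<lambda>w. G w * ennreal (measure lborel D)"])
    show "AE w in lborel. G w * ennreal (overlap D ((1 / X n) *\<^sub>R w)) \<le> G w * ennreal (measure lborel D)" for n
      by (intro AE_I2 mult_left_mono ennreal_leI overlap_le D') simp
    show "(\<integral>\<^sup>+w. G w * ennreal (measure lborel D) \<partial>lborel) < \<infinity>"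
      by (simp add: nn_integral_multc nn_integral_G)
    \<comment> \<open>Multiplication by infinity in \<open>ennreal\<close> is not continuous at 0,
      so the null set where \<open>G\<close> is infinite is discarded.\<close>
    have "AE w in lborel. G w \<noteq> \<infinity>"
      by (rule nn_integral_PInf_AE) (simp_all add: nn_integral_G)
    then show "AE w in lborel. (\<lambda>n. G w * ennreal (overlap D ((1 / X n) *\<^sub>R w))) \<longlonglongrightarrow> G w * ennreal (measure lborel D)"
    proof eventually_elim
      case (elim w)
      have "(\<lambda>n. inverse (X n)) \<longlonglongrightarrow> 0"
        by (rule tendsto_inverse_0_at_top[OF X])
      then have "(\<lambda>n. (1 / X n) *\<^sub>R w) \<longlonglongrightarrow> 0"
        using tendsto_scaleR[OF _ tendsto_const[of w], of "\<lambda>n. inverse (X n)" 0] by (simp add: inverse_eq_divide)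
      then have "(\<lambda>n. ennreal (overlap D ((1 / X n) *\<^sub>R w))) \<longlonglongrightarrow> ennreal (measure lborel D)"
        by (intro tendsto_ennrealI overlap_tendsto D')
      then show ?case
        using elim by (intro ennreal_tendsto_cmult) (auto simp: less_top)
    qed
  qed measurable
  then have "(\<lambda>n. \<integral>\<^sup>+w. G w * ennreal (overlap D ((1 / X n) *\<^sub>R w)) \<partial>lborel) \<longlonglongrightarrow> ennreal (measure lborel D)"
    by (simp add: nn_integral_multc nn_integral_G)
  then show "(\<lambda>n. smoothed_mass D (X n)) \<longlonglongrightarrow> measure lborel D"
    unfolding smoothed_mass_def by (rule tendsto_enn2real) simp
qed

end

text \<open>A Bochner integral of a non-integrable function is 0 by default, so the first conjunct
  is what makes the limit in the second a statement about L^1 norms. The families \<open>lam\<close>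
  and \<open>h\<close> encode an arbitrary fixed choice of eigensystem for every compact
  domain.\<close>

theorem theorem1p1:
  fixes S :: "(real ^ 'd) L2 \<Rightarrow> (real ^ 'd) L2"
    and \<Omega> :: "((real ^ 'd) \<times> (real ^ 'd)) set"
    and lam :: "((real ^ 'd) \<times> (real ^ 'd)) set \<Rightarrow> nat \<Rightarrow> real"
    and h :: "((real ^ 'd) \<times> (real ^ 'd)) set \<Rightarrow> nat \<Rightarrow> (real ^ 'd) L2"
  assumes "density_op S"
    and "compact \<Omega>"
    and "\<And>D. compact D \<Longrightarrow> eigensystem (fun_op_conv (indicator D) S) (lam D) (h D)"
  shows "(\<forall>R>0. integrable lborel
      (\<lambda>z. accumulated_cohen S h ((*\<^sub>R) R ` \<Omega>) (R *\<^sub>R z) - indicator \<Omega> z)) \<and>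
    ((\<lambda>R. LINT z|lborel. cmod
      (accumulated_cohen S h ((*\<^sub>R) R ` \<Omega>) (R *\<^sub>R z) - indicator \<Omega> z)) \<longlongrightarrow> 0) at_top"
proof -
  obtain v where v: "\<And>f. (\<lambda>n. (cmod (cinner f (v n)))\<^sup>2) sums Re (cinner (S f) f)" "(\<lambda>n. (norm (v n))\<^sup>2) sums 1"
    using density_op_decomposition[OF assms(1)] by blast
  interpret density_decomposition S v
    using assms(1) v by unfold_locales (auto simp: density_op_def)
  define m where "m = DIM((real ^ 'd) \<times> (real ^ 'd))"
  define u where "u R w = accumulated_cohen S h ((*\<^sub>R) R ` \<Omega>) w - indicator ((*\<^sub>R) R ` \<Omega>) w" for R w
  have u: "accumulated_cohen S h ((*\<^sub>R) R ` \<Omega>) (R *\<^sub>R z) - indicator \<Omega> z = u R (R *\<^sub>R z)" if "R > 0" for R z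
    unfolding u_def indicator_scaleR_image[OF that] ..
  have D: "(*\<^sub>R) R ` \<Omega> \<in> sets borel" "emeasure lborel ((*\<^sub>R) R ` \<Omega>) < \<infinity>"
      "eigensystem (fun_op_conv (indicator ((*\<^sub>R) R ` \<Omega>)) S) (lam ((*\<^sub>R) R ` \<Omega>)) (h ((*\<^sub>R) R ` \<Omega>))" for R
    using borel_compact emeasure_compact_finite assms(3) compact_scaling[OF assms(2), of R] by blast+
  have int: "integrable lborel (u R)" for R
    using accumulated_deviation(1)[OF D[of R]] by (simp add: u_def[abs_def] accumulated_cohen_def)
  \<comment> \<open>The ceiling error 1 is written as R^m (1 / R)^m, so that the whole bound carries
    the factor R^m which the change of variables cancels.\<close>
  have bound: "(LINT w|lborel. cmod (u R w)) \<le> R ^ m * (2 * measure lborel \<Omega> + (1 / R) ^ m - 2 * smoothed_mass \<Omega> R)"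
    if "R > 0" for R
  proof -
    have [measurable]: "overlap \<Omega> \<in> borel_measurable borel"
      using assms(2) by (intro measurable_overlap) (auto simp: compact_imp_closed)
    have "(\<integral>\<^sup>+w. G w * ennreal (overlap ((*\<^sub>R) R ` \<Omega>) w) \<partial>lborel)
        = (\<integral>\<^sup>+w. ennreal (R ^ m) * (G w * ennreal (overlap \<Omega> ((1 / R) *\<^sub>R w))) \<partial>lborel)"
      using that
      by (intro nn_integral_cong)
         (simp add: overlap_scaleR_image[OF assms(2)] m_def ennreal_mult overlap_nonneg mult.left_commute)
    also have "\<dots> = ennreal (R ^ m) * (\<integral>\<^sup>+w. G w * ennreal (overlap \<Omega> ((1 / R) *\<^sub>R w)) \<partial>lborel)"
      by (rule nn_integral_cmult) measurable
    finally have "enn2real (\<integral>\<^sup>+w. G w * ennreal (overlap ((*\<^sub>R) R ` \<Omega>) w) \<partial>lborel) = R ^ m * smoothed_mass \<Omega> R"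
      using that by (simp add: enn2real_mult smoothed_mass_def)
    moreover have "R ^ m * (1 / R) ^ m = 1" using that by (simp flip: power_mult_distrib)
    ultimately show ?thesis
      using accumulated_deviation(2)[OF D[of R]] measure_scaleR_image[OF assms(2) that]
      by (simp add: u_def accumulated_cohen_def m_def algebra_simps)
  qed
  have I: "(LINT z|lborel. cmod (u R (R *\<^sub>R z))) \<le> 2 * measure lborel \<Omega> + (1 / R) ^ m - 2 * smoothed_mass \<Omega> R"
    if "R > 0" for R
  proof -
    have "R ^ m * (LINT z|lborel. cmod (u R (R *\<^sub>R z))) = (LINT w|lborel. cmod (u R w))"
      using lborel_integral_scale[of "\<lambda>w. cmod (u R w)" R] int[of R] that by (simp add: m_def)
    with bound[OF that] show ?thesis
      using that by (metis mult_le_cancel_left_pos zero_less_power)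
  qed
  \<comment> \<open>Positive dimension makes the ceiling error (1 / R)^m vanish in the
    limit.\<close>
  have "m > 0" by (simp add: m_def)
  have "((\<lambda>R. 2 * measure lborel \<Omega> + (1 / R) ^ m - 2 * smoothed_mass \<Omega> R)
      \<longlongrightarrow> 2 * measure lborel \<Omega> + 0 ^ m - 2 * measure lborel \<Omega>) at_top"
    by (intro tendsto_intros smoothed_mass_tendsto assms(2))
       (simp add: tendsto_inverse_0_at_top filterlim_ident flip: inverse_eq_divide)
  then have lim: "((\<lambda>R. 2 * measure lborel \<Omega> + (1 / R) ^ m - 2 * smoothed_mass \<Omega> R) \<longlongrightarrow> 0) at_top"
    using \<open>m > 0\<close> by (simp add: zero_power)
  have "((\<lambda>R. LINT z|lborel. cmod
      (accumulated_cohen S h ((*\<^sub>R) R ` \<Omega>) (R *\<^sub>R z) - indicator \<Omega> z)) \<longlongrightarrow> 0) at_top"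
  proof (rule Lim_null_comparison[OF _ lim])
    show "eventually (\<lambda>R. norm (LINT z|lborel. cmod
        (accumulated_cohen S h ((*\<^sub>R) R ` \<Omega>) (R *\<^sub>R z) - indicator \<Omega> z))
      \<le> 2 * measure lborel \<Omega> + (1 / R) ^ m - 2 * smoothed_mass \<Omega> R) at_top"
      using eventually_gt_at_top[of 0]
    proof eventually_elim
      case (elim R)
      then show ?case using I[OF elim] by (simp add: u integral_nonneg_AE)
    qed
  qed
  moreover have "\<forall>R>0. integrable lborel
      (\<lambda>z. accumulated_cohen S h ((*\<^sub>R) R ` \<Omega>) (R *\<^sub>R z) - indicator \<Omega> z)"
    using lborel_integrable_scale[OF int] by (simp add: u)
  ultimately show ?thesis by blast
qed

end
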